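(* Let $X$ be a relatively compact domain in a complex manifold. Let $A$ be the divisor of a holomorphic function $f$ on $X$. If $u$ is a negative plurisubharmonic function on $X$ (i.e. $u\le 0$) such that (1) $u$ is locally bounded and maximal in $X\setminus A$, (2) for every $\epsilon>0$ there is a compact subset $K$ of $X$ such that $G_A\le u+\epsilon$ on $X\setminus K$, and (3) every point in $A$ has a neighbourhood $U$ with a constant $C>0$ such that $$\log|f|-C\le u\le\log|f|+C\qquad\text{on }U,$$ then $u=G_A$.
   Context: The divisor $A$ of $f$ ($f$ not identically zero) is the complex subspace of $X$ whose ideal sheaf is generated by $f$; its underlying set is $\{f=0\}$, and $X\setminus A=\{f\neq0\}$. $\mathrm{PSH}(X)$ is the class of plurisubharmonic functions on $X$, including the constant $-\infty$. The Lelong number of a plurisubharmonic $u$ at $a$ is, in local coordinates centred at $a$, $\nu_u(a)=\lim_{r\to0}\frac{\sup_{|z|=r}u(z)}{\log r}$. Set $\nu_A=\nu_{\log|f|}$ and $$G_A=\sup\{u\in\mathrm{PSH}(X): u\le0,\ \nu_u\ge\nu_A\}.$$ A plurisubharmonic function $u$ on an open set $W$ is maximal in $W$ if for every relatively compact open $U\subset W$ and every plurisubharmonic $v$ on $W$ with $v\le u$ on $\partial U$ we have $v\le u$ on $U$. *)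

theory Defs
  imports "HOL-Analysis.Analysis"
begin

text \<open>
  Holomorphy on an open set of \<open>\<complex>\<^sup>n\<close>: the real Frechet derivative exists and is complex linear.
\<close>

definition holomorphic_Cn :: "(complex ^ 'n) set \<Rightarrow> (complex ^ 'n \<Rightarrow> complex) \<Rightarrow> bool" where
  "holomorphic_Cn S g \<longleftrightarrow>
     (\<forall>z\<in>S. \<exists>D. (g has_derivative D) (at z) \<and> (\<forall>c v. D (c *s v) = c * D v))"

definition usc_on :: "'a::topological_space set \<Rightarrow> ('a \<Rightarrow> ereal) \<Rightarrow> bool" where
  "usc_on S u \<longleftrightarrow> (\<forall>c. openin (top_of_set S) {x\<in>S. u x < c})"

text \<open>
  Mean over the unit circle of an extended-real function \<open>g\<close>, as the Lebesgue integral of the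
  positive part minus that of the negative part (\<open>e2ennreal\<close> sends negative numbers to 0).
  It is used for functions bounded above on the circle, so that the first integral is finite.
\<close>

definition circle_mean :: "(complex \<Rightarrow> ereal) \<Rightarrow> ereal" where
  "circle_mean g =
     (enn2ereal (\<integral>\<^sup>+\<theta>\<in>{0..2*pi}. e2ennreal (g (cis \<theta>)) \<partial>lborel)
      - enn2ereal (\<integral>\<^sup>+\<theta>\<in>{0..2*pi}. e2ennreal (- g (cis \<theta>)) \<partial>lborel)) / ereal (2*pi)"

text \<open>
  Plurisubharmonicity on an open set of \<open>\<complex>\<^sup>n\<close>: upper semicontinuous with values in
  \<open>[-\<infinity>, \<infinity>)\<close>, and the sub-mean value inequality on every closed disc contained in a complex line.
  The constant \<open>-\<infinity>\<close> is allowed.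
\<close>

definition psh_Cn :: "(complex ^ 'n) set \<Rightarrow> (complex ^ 'n \<Rightarrow> ereal) \<Rightarrow> bool" where
  "psh_Cn S u \<longleftrightarrow>
     (\<forall>z\<in>S. u z < \<infinity>) \<and> usc_on S u \<and>
     (\<forall>a\<in>S. \<forall>w. (\<forall>\<zeta>. cmod \<zeta> \<le> 1 \<longrightarrow> a + \<zeta> *s w \<in> S) \<longrightarrow>
        u a \<le> circle_mean (\<lambda>\<zeta>. u (a + \<zeta> *s w)))"

text \<open>
  A chart is a pair of its domain and its coordinate map; only the values of the map on the domain
  matter.  The underlying space of the manifold is the whole type.
\<close>

type_synonym ('a, 'n) chart = "'a set \<times> ('a \<Rightarrow> complex ^ 'n)"

definition complex_manifold ::
  "('a::{t2_space, second_countable_topology}, 'n::finite) chart set \<Rightarrow> bool" where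
  "complex_manifold \<A> \<longleftrightarrow>
     (\<Union>(U, \<phi>)\<in>\<A>. U) = UNIV \<and>
     (\<forall>(U, \<phi>)\<in>\<A>. open U \<and> open (\<phi> ` U) \<and> homeomorphism U (\<phi> ` U) \<phi> (inv_into U \<phi>)) \<and>
     (\<forall>(U, \<phi>)\<in>\<A>. \<forall>(V, \<psi>)\<in>\<A>. \<forall>i.
        holomorphic_Cn (\<phi> ` (U \<inter> V)) (\<lambda>z. \<psi> (inv_into U \<phi> z) $ i))"

definition holomorphic_fun ::
  "('a, 'n::finite) chart set \<Rightarrow> 'a set \<Rightarrow> ('a \<Rightarrow> complex) \<Rightarrow> bool" where
  "holomorphic_fun \<A> W f \<longleftrightarrow>
     (\<forall>(U, \<phi>)\<in>\<A>. holomorphic_Cn (\<phi> ` (U \<inter> W)) (f \<circ> inv_into U \<phi>))"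

definition psh :: "('a, 'n::finite) chart set \<Rightarrow> 'a set \<Rightarrow> ('a \<Rightarrow> ereal) \<Rightarrow> bool" where
  "psh \<A> W u \<longleftrightarrow> (\<forall>(U, \<phi>)\<in>\<A>. psh_Cn (\<phi> ` (U \<inter> W)) (u \<circ> inv_into U \<phi>))"

definition maximal_psh ::
  "('a::topological_space, 'n::finite) chart set \<Rightarrow> 'a set \<Rightarrow> ('a \<Rightarrow> ereal) \<Rightarrow> bool" where
  "maximal_psh \<A> W u \<longleftrightarrow> psh \<A> W u \<and>
     (\<forall>U v. open U \<and> compact (closure U) \<and> closure U \<subseteq> W \<and> psh \<A> W v \<and>
        (\<forall>x\<in>frontier U. v x \<le> u x) \<longrightarrow> (\<forall>x\<in>U. v x \<le> u x))"

definition locally_bounded_on :: "'a::topological_space set \<Rightarrow> ('a \<Rightarrow> ereal) \<Rightarrow> bool" where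
  "locally_bounded_on W u \<longleftrightarrow>
     (\<forall>x\<in>W. \<exists>V C. open V \<and> x \<in> V \<and> (\<forall>y\<in>V \<inter> W. \<bar>u y\<bar> \<le> ereal C))"

text \<open>
  The Lelong number at \<open>a\<close>, in some chart around \<open>a\<close>; for plurisubharmonic functions the limit exists
  and does not depend on the chart.  Coordinates are centred at \<open>a\<close> by taking spheres around \<open>\<phi> a\<close>.
  If \<open>u\<close> is \<open>-\<infinity>\<close> near \<open>a\<close>, the value is \<open>\<infinity>\<close>.
\<close>

definition lelong :: "('a, 'n::finite) chart set \<Rightarrow> ('a \<Rightarrow> ereal) \<Rightarrow> 'a \<Rightarrow> ereal" where
  "lelong \<A> u a =
     (case (SOME c. c \<in> \<A> \<and> a \<in> fst c) of (U, \<phi>) \<Rightarrow>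
        Lim (at_right 0) (\<lambda>r. (SUP z\<in>sphere (\<phi> a) r. u (inv_into U \<phi> z)) / ereal (ln r)))"

definition log_abs :: "('a \<Rightarrow> complex) \<Rightarrow> 'a \<Rightarrow> ereal" where
  "log_abs f x = (if f x = 0 then -\<infinity> else ereal (ln (cmod (f x))))"

text \<open>
  The divisor \<open>A\<close> of \<open>f\<close> on \<open>X\<close> is represented by \<open>f\<close>: it enters through its underlying set and
  through \<open>\<nu>\<^sub>A\<close>, the Lelong number of \<open>log |f|\<close>.
\<close>

definition divisor_set :: "'a set \<Rightarrow> ('a \<Rightarrow> complex) \<Rightarrow> 'a set" where
  "divisor_set X f = {x\<in>X. f x = 0}"

definition divisor_lelong ::
  "('a, 'n::finite) chart set \<Rightarrow> ('a \<Rightarrow> complex) \<Rightarrow> 'a \<Rightarrow> ereal" where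
  "divisor_lelong \<A> f = lelong \<A> (log_abs f)"

definition green_class ::
  "('a, 'n::finite) chart set \<Rightarrow> 'a set \<Rightarrow> ('a \<Rightarrow> complex) \<Rightarrow> ('a \<Rightarrow> ereal) set" where
  "green_class \<A> X f =
     {u. psh \<A> X u \<and> (\<forall>x\<in>X. u x \<le> 0) \<and> (\<forall>a\<in>X. divisor_lelong \<A> f a \<le> lelong \<A> u a)}"

definition green ::
  "('a, 'n::finite) chart set \<Rightarrow> 'a set \<Rightarrow> ('a \<Rightarrow> complex) \<Rightarrow> 'a \<Rightarrow> ereal" where
  "green \<A> X f x = (SUP u\<in>green_class \<A> X f. u x)"

end

theory Submission
  imports Defs "HOL-Complex_Analysis.Complex_Analysis" "HOL-Real_Asymp.Real_Asymp"
begin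

text \<open>
  The function \<open>u\<close> belongs to the class defining \<open>G\<^sub>A\<close>: near
  \<open>A\<close> it differs from \<open>log |f|\<close> by a bounded function, hence has the
  same Lelong numbers, and off \<open>A\<close> the required Lelong number is \<open>0\<close>
  (\<open>solution_in_green_class\<close>). So \<open>u \<le> G\<^sub>A\<close>.

  Conversely let \<open>v\<close> be in the class. Suppose that \<open>v \<le> log |f| +
  C\<close> near every point of \<open>A\<close>. Then for \<open>t > 0\<close> the function
  \<open>(1 + t) v - t\<close> lies below \<open>u\<close> near \<open>A\<close>, since there
  \<open>(1 + t) log |f|\<close> is much smaller than \<open>log |f|\<close>, and it lies below
  \<open>u\<close> outside a compact set because \<open>v \<le> G\<^sub>A\<close> and
  \<open>G\<^sub>A \<le> u + t\<close> there. What remains is a compact subset of \<open>X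
  \<setminus> A\<close>, where maximality of \<open>u\<close> applies
  (\<open>scaled_green_class_le\<close>). Letting \<open>t \<rightarrow> 0\<close> gives
  \<open>v \<le> u\<close> off \<open>A\<close>, and on \<open>A\<close> both sides are
  \<open>-\<infinity>\<close>.

  The analytic core is therefore the upper bound \<open>v \<le> log |f| + C\<close> near a point
  \<open>a\<close> of \<open>A\<close>, singular points of \<open>A\<close> included. At a point
  \<open>y\<close> where \<open>f\<close> vanishes to order \<open>m\<close>, the Lelong
  condition and Hadamard's three circles theorem give \<open>v \<le> m log |z - y| +
  O(1)\<close> (\<open>green_class_le_order\<close>). Restrict to a complex line through a point
  \<open>x\<close> close to \<open>a\<close> with \<open>f x \<noteq> 0\<close>, chosen so that
  \<open>|f|\<close> is bounded below on a fixed circle around \<open>x\<close>. If at every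
  zero inside the circle the order of \<open>f\<close> in the ambient space is as large as its
  order along the line, then \<open>v - log |f|\<close> is bounded above near these zeros, up to
  replacing \<open>v\<close> by \<open>(1 + t) v\<close>, and the maximum principle bounds it at
  \<open>x\<close> by its values on the circle (\<open>psh_le_log_on_transversal_line\<close>).

  Such lines exist arbitrarily close to any line through \<open>x\<close> on which
  \<open>f\<close> has no zero on the circle (\<open>exists_transversal_line\<close>): take a
  direction for which the number of distinct zeros in the disc is maximal; it is bounded by
  Rouche's theorem. Under small changes of the direction no zero can then split, so each zero of
  order \<open>m\<close> moves as one zero of order \<open>m\<close>, and it moves Lipschitz
  continuously because it is a simple zero of the derivative of order \<open>m - 1\<close>.
  Consequently \<open>|f z| \<le> C |z - y|\<^sup>m\<close> near the zero \<open>y\<close>. This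
  avoids any analysis of the singular locus of \<open>A\<close> and any extension theorem for
  plurisubharmonic functions.
\<close>

section \<open>Upper semicontinuity and circle means\<close>

lemma usc_on_attains_max:
  fixes q :: "'a::topological_space \<Rightarrow> ereal"
  assumes "compact S" "S \<noteq> {}" "usc_on S q"
  obtains x where "x \<in> S" "\<And>y. y \<in> S \<Longrightarrow> q y \<le> q x"
proof -
  have "\<exists>x\<in>S. \<forall>y\<in>S. q y \<le> q x"
  proof (rule ccontr)
    assume "\<not> ?thesis"
    then have no_max: "\<forall>x\<in>S. \<exists>y\<in>S. q x < q y"
      by (meson not_le)
    have "\<exists>T. open T \<and> {x\<in>S. q x < q y} = S \<inter> T" for y
      using assms(3) unfolding usc_on_def openin_open by blast
    then obtain T where T: "\<And>y. open (T y)" "\<And>y. {x\<in>S. q x < q y} = S \<inter> T y"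
      by metis
    have "S \<subseteq> (\<Union>y\<in>S. T y)"
      using no_max T(2) by blast
    then obtain D where D: "D \<subseteq> S" "finite D" "S \<subseteq> (\<Union>y\<in>D. T y)"
      using compactE_image[OF assms(1), of S T] T(1) by metis
    have "D \<noteq> {}" using D assms(2) by auto
    then have "Max (q ` D) \<in> q ` D" using D(2) by (intro Max_in) auto
    then obtain y where "y \<in> D" "Max (q ` D) = q y" by blast
    then have y: "y \<in> D" "\<And>z. z \<in> D \<Longrightarrow> q z \<le> q y"
      using D(2) by (metis Max_ge finite_imageI imageI)+
    then obtain z where "z \<in> D" "y \<in> T z" using D by blast
    then have "q y < q z" using T(2)[of z] y D by blast
    then show False using y(2)[OF \<open>z \<in> D\<close>] by simp
  qed
  then show ?thesis using that by blast
qed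

text \<open>
  For nonpositive functions the mean is a single, possibly infinite, nonnegative integral up to
  sign. All functions averaged below are nonpositive, so differences of infinities never arise.
\<close>

lemma circle_mean_nonpos:
  assumes "\<And>\<theta>. g (cis \<theta>) \<le> 0"
  shows "circle_mean g =
    - (enn2ereal (\<integral>\<^sup>+\<theta>\<in>{0..2*pi}. e2ennreal (- g (cis \<theta>)) \<partial>lborel) / ereal (2*pi))"
proof -
  have "e2ennreal (g (cis \<theta>)) = 0" for \<theta>
    using assms[of \<theta>] by (simp add: e2ennreal_neg)
  moreover have "(0 - x) / ereal (2*pi) = - (x / ereal (2*pi))" for x
    by (cases x) auto
  ultimately show ?thesis by (simp add: circle_mean_def zero_ennreal.rep_eq)
qed

text \<open>
  An integrable majorant on the circle suffices: monotonicity of the nonnegative integral holds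
  without any measurability of \<open>g\<close>.
\<close>

lemma circle_mean_le:
  fixes k :: "real \<Rightarrow> real"
  assumes neg: "\<And>\<theta>. g (cis \<theta>) \<le> 0"
    and le: "\<And>\<theta>. \<theta> \<in> {0..2*pi} \<Longrightarrow> g (cis \<theta>) \<le> ereal (k \<theta>)"
    and k: "continuous_on {0..2*pi} k" "(k has_integral I) {0..2*pi}"
  shows "circle_mean g \<le> ereal (I / (2*pi))"
proof -
  define N where "N = (\<integral>\<^sup>+\<theta>\<in>{0..2*pi}. e2ennreal (- g (cis \<theta>)) \<partial>lborel)"
  define h where "h \<theta> = max 0 (- k \<theta>)" for \<theta>
  have hc: "continuous_on {0..2*pi} h"
    unfolding h_def by (intro continuous_intros k)
  then have hi: "h integrable_on {0..2*pi}"
    by (rule integrable_continuous_real)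
  have "- I \<le> integral {0..2*pi} h"
    by (rule has_integral_le[OF has_integral_neg[OF k(2)] integrable_integral[OF hi]])
       (simp add: h_def)
  moreover have "(\<integral>\<^sup>+\<theta>\<in>{0..2*pi}. ennreal (h \<theta>) \<partial>lborel) = ennreal (integral {0..2*pi} h)"
    by (rule nn_integral_has_integral_lebesgue'[OF _ integrable_integral[OF hi]]) (simp add: h_def)
  moreover have "(\<integral>\<^sup>+\<theta>\<in>{0..2*pi}. ennreal (h \<theta>) \<partial>lborel) \<le> N"
    unfolding N_def
  proof (rule nn_integral_mono)
    fix \<theta>
    have "ennreal (h \<theta>) \<le> e2ennreal (- g (cis \<theta>))" if "\<theta> \<in> {0..2*pi}"
    proof -
      have "ereal (- k \<theta>) \<le> - g (cis \<theta>)"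
        using le[OF that] by (metis ereal_minus_le_minus uminus_ereal.simps(1))
      moreover have "0 \<le> - g (cis \<theta>)" using neg[of \<theta>] by (simp add: ereal_uminus_le_reorder)
      ultimately have "ereal (h \<theta>) \<le> - g (cis \<theta>)"
        by (auto simp: h_def max_def zero_ereal_def)
      then show ?thesis
        by (metis e2ennreal_ereal e2ennreal_mono)
    qed
    then show "ennreal (h \<theta>) * indicator {0..2*pi} \<theta> \<le> e2ennreal (- g (cis \<theta>)) * indicator {0..2*pi} \<theta>"
      by (auto simp: indicator_def)
  qed
  ultimately have "- I \<le> integral {0..2*pi} h" "ennreal (integral {0..2*pi} h) \<le> N"
    by auto
  moreover have "integral {0..2*pi} h \<ge> 0"
    by (rule integral_nonneg[OF hi]) (simp add: h_def)
  ultimately have "ereal (- I) \<le> enn2ereal N"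
    by (metis enn2ereal_ennreal ereal_less_eq(3) less_eq_ennreal.rep_eq order_trans)
  then have "ereal (- I) / ereal (2*pi) \<le> enn2ereal N / ereal (2*pi)"
    by (intro ereal_divide_right_mono) auto
  then show ?thesis
    unfolding circle_mean_nonpos[of g, OF neg] N_def[symmetric]
    by (simp add: ereal_uminus_le_reorder)
qed

lemma usc_on_circle_measurable:
  assumes "usc_on (sphere 0 1) g"
  shows "(\<lambda>\<theta>. g (cis \<theta>)) \<in> borel_measurable borel"
proof (rule borel_measurableI_less)
  fix c :: ereal
  obtain T where T: "open T" "{z \<in> sphere 0 1. g z < c} = sphere 0 1 \<inter> T"
    using assms unfolding usc_on_def openin_open by blast
  have "cis \<theta> \<in> sphere 0 1" for \<theta> by simp
  then have "{\<theta>. g (cis \<theta>) < c} = cis -` T" using T(2) by blast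
  moreover have "open (cis -` T)"
    by (intro open_vimage T continuous_intros)
  ultimately show "{\<theta> \<in> space borel. g (cis \<theta>) < c} \<in> sets borel" by simp
qed

text \<open>
  Unlike the upper estimate above, pulling a factor out of the integral needs measurability,
  which is where upper semicontinuity on the circle enters.
\<close>

lemma circle_mean_affine:
  fixes g :: "complex \<Rightarrow> ereal"
  assumes neg: "\<And>\<theta>. g (cis \<theta>) \<le> 0" and usc: "usc_on (sphere 0 1) g"
    and c: "c > 0" and e: "e \<ge> 0"
  shows "circle_mean (\<lambda>z. ereal c * g z - ereal e) = ereal c * circle_mean g - ereal e"
proof -
  have neg': "ereal c * g (cis \<theta>) - ereal e \<le> 0" for \<theta>
    using neg[of \<theta>] c e
    by (cases "g (cis \<theta>)") (auto simp: zero_ereal_def intro: order_trans[OF mult_nonneg_nonpos])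
  have split: "e2ennreal (- (ereal c * g (cis \<theta>) - ereal e)) = ennreal c * e2ennreal (- g (cis \<theta>)) + ennreal e" for \<theta>
  proof (cases "g (cis \<theta>)")
    case (real r)
    then have "r \<le> 0" using neg[of \<theta>] by (simp add: zero_ereal_def)
    then show ?thesis using real c e
      by (simp add: ennreal_mult[symmetric] ennreal_plus[symmetric] mult_nonneg_nonpos del: ennreal_plus)
  next
    case PInf then show ?thesis using neg[of \<theta>] by simp
  next
    case MInf then show ?thesis using c by (simp add: ennreal_mult_top)
  qed
  define N where "N = (\<integral>\<^sup>+\<theta>\<in>{0..2*pi}. e2ennreal (- g (cis \<theta>)) \<partial>lborel)"
  have [measurable]: "(\<lambda>\<theta>. g (cis \<theta>)) \<in> borel_measurable borel"
    by (rule usc_on_circle_measurable[OF usc])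
  have "(\<integral>\<^sup>+\<theta>\<in>{0..2*pi}. (ennreal c * e2ennreal (- g (cis \<theta>)) + ennreal e) \<partial>lborel)
      = (\<integral>\<^sup>+\<theta>. (ennreal c * (e2ennreal (- g (cis \<theta>)) * indicator {0..2*pi} \<theta>)
          + ennreal e * indicator {0..2*pi} \<theta>) \<partial>lborel)"
    by (intro nn_integral_cong) (auto simp: indicator_def)
  also have "\<dots> = ennreal c * N + ennreal e * ennreal (2*pi)"
    by (simp add: N_def nn_integral_add nn_integral_cmult nn_integral_cmult_indicator)
  finally have eq: "(\<integral>\<^sup>+\<theta>\<in>{0..2*pi}. (ennreal c * e2ennreal (- g (cis \<theta>)) + ennreal e) \<partial>lborel)
      = ennreal c * N + ennreal e * ennreal (2*pi)" .
  show ?thesis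
    unfolding circle_mean_nonpos[of "\<lambda>z. ereal c * g z - ereal e", OF neg'] circle_mean_nonpos[of g, OF neg] split eq N_def[symmetric]
  proof (cases N rule: ennreal_cases)
    case (real r)
    then have "ennreal c * N + ennreal e * ennreal (2*pi) = ennreal (c * r + e * (2*pi))"
      using c e by (simp add: ennreal_mult ennreal_plus)
    then show "- (enn2ereal (ennreal c * N + ennreal e * ennreal (2 * pi)) / ereal (2 * pi)) =
        ereal c * - (enn2ereal N / ereal (2 * pi)) - ereal e"
      using real c e by (simp add: enn2ereal_ennreal field_simps del: ennreal_plus)
  next
    case top
    then show "- (enn2ereal (ennreal c * N + ennreal e * ennreal (2 * pi)) / ereal (2 * pi)) =
        ereal c * - (enn2ereal N / ereal (2 * pi)) - ereal e"
      using c e by (simp add: ennreal_mult_top)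
  qed
qed

section \<open>The maximum principle in the plane\<close>

text \<open>
  On a disc without zeros, \<open>f = exp g\<close> with \<open>g\<close> holomorphic, so
  \<open>ln |f|\<close> is the real part of \<open>g\<close> and Cauchy's integral formula for
  \<open>g\<close> on the circle gives the mean value property.
\<close>

lemma mean_value_ln_norm:
  assumes "f holomorphic_on ball z R" "\<And>w. w \<in> ball z R \<Longrightarrow> f w \<noteq> 0" "0 < \<rho>" "\<rho> < R"
  shows "((\<lambda>\<theta>. ln (cmod (f (z + of_real \<rho> * cis \<theta>)))) has_integral 2*pi * ln (cmod (f z))) {0..2*pi}"
proof -
  obtain g where g: "g holomorphic_on ball z R" and fg: "\<And>w. w \<in> ball z R \<Longrightarrow> exp (g w) = f w"
    using holomorphic_logarithm_exists[OF convex_ball open_ball assms(1,2), of z] assms by auto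
  have sub: "cball z \<rho> \<subseteq> ball z R" using assms by auto
  have ln_eq: "ln (cmod (f w)) = Re (g w)" if "w \<in> ball z R" for w
    using fg[OF that] by (metis norm_exp_eq_Re ln_exp)
  have "((\<lambda>u. g u / (u - z)) has_contour_integral (2 * of_real pi * \<i> * g z)) (circlepath z \<rho>)"
    using assms sub g
    by (intro Cauchy_integral_circlepath holomorphic_on_imp_continuous_on)
       (auto intro: holomorphic_on_subset)
  then have "((\<lambda>t. g (z + of_real \<rho> * cis t) / ((z + of_real \<rho> * cis t) - z) * of_real \<rho> * \<i> * cis t)
      has_integral 2 * of_real pi * \<i> * g z) {0..2*pi}"
    unfolding circlepath_def by (subst (asm) has_contour_integral_part_circlepath_iff) auto
  moreover have "g (z + of_real \<rho> * cis t) / ((z + of_real \<rho> * cis t) - z) * of_real \<rho> * \<i> * cis t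
      = \<i> * g (z + of_real \<rho> * cis t)" for t
    using assms by simp
  ultimately have "((\<lambda>t. \<i> * g (z + of_real \<rho> * cis t)) has_integral 2 * of_real pi * \<i> * g z) {0..2*pi}"
    by (simp only:)
  from has_integral_Im[OF this]
  have "((\<lambda>t. Re (g (z + of_real \<rho> * cis t))) has_integral 2*pi * Re (g z)) {0..2*pi}"
    by simp
  moreover have "z + of_real \<rho> * cis t \<in> ball z R" for t
    using assms by (auto simp: dist_norm norm_mult)
  ultimately show ?thesis using assms by (simp add: ln_eq)
qed

lemma has_integral_circle_norm_square:
  "((\<lambda>\<theta>. (cmod (z + of_real \<rho> * cis \<theta>))\<^sup>2) has_integral 2*pi * ((cmod z)\<^sup>2 + \<rho>\<^sup>2)) {0..2*pi}"
proof -
  have sq: "(cmod (z + of_real \<rho> * cis \<theta>))\<^sup>2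
      = ((cmod z)\<^sup>2 + \<rho>\<^sup>2) + 2 * \<rho> * (Re z * cos \<theta> + Im z * sin \<theta>)" for \<theta>
  proof -
    have "(\<rho> * cos \<theta>)\<^sup>2 + (\<rho> * sin \<theta>)\<^sup>2 = \<rho>\<^sup>2"
      by (simp add: power_mult_distrib flip: distrib_left)
    then show ?thesis unfolding cmod_power2 by (simp add: power2_sum algebra_simps)
  qed
  have "((\<lambda>\<theta>. 2 * \<rho> * (Re z * cos \<theta> + Im z * sin \<theta>)) has_integral
      2 * \<rho> * (Re z * sin (2*pi) - Im z * cos (2*pi)) - 2 * \<rho> * (Re z * sin 0 - Im z * cos 0)) {0..2*pi}"
    by (rule fundamental_theorem_of_calculus)
       (auto intro!: derivative_eq_intros simp flip: has_real_derivative_iff_has_vector_derivative)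
  moreover have "((\<lambda>\<theta>. (cmod z)\<^sup>2 + \<rho>\<^sup>2) has_integral 2*pi * ((cmod z)\<^sup>2 + \<rho>\<^sup>2)) {0..2*pi}"
    using has_integral_const_real[of "(cmod z)\<^sup>2 + \<rho>\<^sup>2" 0 "2*pi"] by simp
  from has_integral_add[OF this calculation] show ?thesis
    unfolding sq by simp
qed

lemma usc_on_add_continuous:
  fixes s :: "'a::topological_space \<Rightarrow> ereal"
  assumes "usc_on S s" "continuous_on S P" "\<And>z. z \<in> S \<Longrightarrow> s z < \<infinity>"
  shows "usc_on S (\<lambda>w. s w + ereal (P w))"
  unfolding usc_on_def
proof
  fix c
  have "{x \<in> S. s x + ereal (P x) < c} = (\<Union>r::real. {x \<in> S. s x < ereal r} \<inter> {x\<in>S. ereal (P x) < c - ereal r})"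
  proof (intro equalityI subsetI)
    fix x assume "x \<in> {x \<in> S. s x + ereal (P x) < c}"
    then have x: "x \<in> S" "s x + ereal (P x) < c" by auto
    then have "s x < c - ereal (P x)"
      by (simp add: ereal_less_minus)
    then obtain r where "s x < ereal r" "ereal r < c - ereal (P x)"
      using ereal_dense2 by blast
    then show "x \<in> (\<Union>r::real. {x \<in> S. s x < ereal r} \<inter> {x\<in>S. ereal (P x) < c - ereal r})"
      using x by (auto simp: ereal_less_minus add.commute)
  next
    fix x assume "x \<in> (\<Union>r::real. {x \<in> S. s x < ereal r} \<inter> {x\<in>S. ereal (P x) < c - ereal r})"
    then obtain r where x: "x \<in> S" "s x < ereal r" "ereal (P x) < c - ereal r" by auto
    then show "x \<in> {x \<in> S. s x + ereal (P x) < c}"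
      by (cases "s x"; cases c) auto
  qed
  moreover have "openin (top_of_set S) {x\<in>S. ereal (P x) < c - ereal r}" for r
  proof -
    have "continuous_on S (\<lambda>x. ereal (P x))" by (intro continuous_intros assms)
    then have "openin (top_of_set S) (S \<inter> (\<lambda>x. ereal (P x)) -` {..<c - ereal r})"
      by (rule continuous_openin_preimage_gen) simp
    then show ?thesis by (simp add: vimage_def Int_def)
  qed
  ultimately show "openin (top_of_set S) {x \<in> S. s x + ereal (P x) < c}"
    using assms(1) unfolding usc_on_def by (auto intro!: openin_Int)
qed

text \<open>
  The maximum principle for \<open>s + H\<close> with \<open>s\<close> subharmonic and
  \<open>H\<close> harmonic. Adding the small strictly subharmonic function \<open>\<eta>
  (|z|\<^sup>2 - R\<^sup>2)\<close> makes the mean value inequality strict, so that a maximum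
  outside \<open>B\<close> is impossible at once and no connectedness argument is needed. The
  set \<open>B\<close> is an arbitrary part of \<open>S\<close> where the inequality is known,
  not merely the boundary; this allows neighbourhoods of logarithmic poles of \<open>H\<close>
  to be treated as part of \<open>B\<close>.
\<close>

lemma max_principle:
  fixes s :: "complex \<Rightarrow> ereal" and H :: "complex \<Rightarrow> real"
  assumes "compact S" and usc: "usc_on S s" and cont: "continuous_on S H"
    and neg: "\<And>z. z \<in> S \<Longrightarrow> s z \<le> 0"
    and mean: "\<And>z. z \<in> S - B \<Longrightarrow> \<exists>\<rho>>0. cball z \<rho> \<subseteq> S \<and>
        s z \<le> circle_mean (\<lambda>\<xi>. s (z + of_real \<rho> * \<xi>)) \<and>
        ((\<lambda>\<theta>. H (z + of_real \<rho> * cis \<theta>)) has_integral 2*pi * H z) {0..2*pi}"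
    and bdry: "\<And>z. z \<in> S \<inter> B \<Longrightarrow> s z + ereal (H z) \<le> 0"
    and "z \<in> S"
  shows "s z + ereal (H z) \<le> 0"
proof (rule ccontr)
  assume "\<not> s z + ereal (H z) \<le> 0"
  then have pos: "s z + ereal (H z) > 0" by simp
  then have "s z \<noteq> -\<infinity>" by auto
  moreover have "s z \<noteq> \<infinity>" using neg[OF \<open>z \<in> S\<close>] by auto
  ultimately obtain t where t: "s z = ereal t" by (cases "s z") auto
  obtain R where R: "R > 0" "\<And>w. w \<in> S \<Longrightarrow> cmod w \<le> R"
    using compact_imp_bounded[OF \<open>compact S\<close>] bounded_pos by blast
  \<comment> \<open>small enough that the perturbed function is still positive at \<open>z\<close>\<close>
  define \<eta> where "\<eta> = (t + H z) / (2 * R\<^sup>2)"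
  have tH: "t + H z > 0" using pos t by simp
  have \<eta>: "\<eta> > 0" using tH R by (simp add: \<eta>_def)
  define P where "P w = H w + \<eta> * ((cmod w)\<^sup>2 - R\<^sup>2)" for w
  have contP: "continuous_on S P"
    unfolding P_def by (intro continuous_intros cont)
  have uscP: "usc_on S (\<lambda>w. s w + ereal (P w))"
    by (rule usc_on_add_continuous[OF usc contP]) (use neg in \<open>force intro: le_less_trans\<close>)
  have "S \<noteq> {}" using \<open>z \<in> S\<close> by auto
  then obtain w where w: "w \<in> S" "\<And>y. y \<in> S \<Longrightarrow> s y + ereal (P y) \<le> s w + ereal (P w)"
    using usc_on_attains_max[OF \<open>compact S\<close> _ uscP] by blast
  have "\<eta> * (0 - R\<^sup>2) \<le> \<eta> * ((cmod z)\<^sup>2 - R\<^sup>2)" using \<eta> by (intro mult_left_mono) auto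
  moreover have "\<eta> * R\<^sup>2 = (t + H z) / 2" using R by (simp add: \<eta>_def)
  ultimately have "t + P z > 0" using tH by (simp add: P_def algebra_simps)
  then have "0 < s z + ereal (P z)" using t by simp
  then have wpos: "s w + ereal (P w) > 0"
    using w(2)[OF \<open>z \<in> S\<close>] by (rule less_le_trans)
  then have "s w \<noteq> -\<infinity>" by auto
  moreover have "s w \<noteq> \<infinity>" using neg[OF w(1)] by auto
  ultimately obtain a where a: "s w = ereal a" by (cases "s w") auto
  have PH: "P y \<le> H y" if "y \<in> S" for y
    using R(2)[OF that] \<eta> R(1) unfolding P_def
    by (simp add: mult_nonneg_nonpos power_mono)
  have "w \<notin> B"
  proof
    assume "w \<in> B"
    then have "s w + ereal (H w) \<le> 0" using bdry w by blast
    then show False using wpos PH[OF w(1)] a by simp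
  qed
  then obtain \<rho> where \<rho>: "\<rho> > 0" "cball w \<rho> \<subseteq> S"
      and sm: "s w \<le> circle_mean (\<lambda>\<xi>. s (w + of_real \<rho> * \<xi>))"
      and Hm: "((\<lambda>\<theta>. H (w + of_real \<rho> * cis \<theta>)) has_integral 2*pi * H w) {0..2*pi}"
    using mean[of w] w(1) by blast
  have inS: "w + of_real \<rho> * cis \<theta> \<in> S" for \<theta>
    using \<rho> by (intro subsetD[OF \<rho>(2)]) (auto simp: dist_norm norm_mult)
  define k where "k \<theta> = a + P w - P (w + of_real \<rho> * cis \<theta>)" for \<theta>
  have "continuous_on {0..2*pi} k" unfolding k_def
    by (intro continuous_intros continuous_on_compose2[OF contP]) (use inS in auto)
  moreover have "(k has_integral (2*pi*(a + P w) - (2*pi*H w + \<eta> * (2*pi*((cmod w)\<^sup>2 + \<rho>\<^sup>2) - 2*pi*R\<^sup>2)))) {0..2*pi}"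
  proof -
    have c: "((\<lambda>\<theta>. c) has_integral 2*pi*c) {0..2*pi}" for c :: real
      using has_integral_const_real[of c 0 "2*pi"] by simp
    show ?thesis unfolding k_def P_def[of "_ + _"]
      by (intro has_integral_diff c has_integral_add Hm has_integral_mult_right has_integral_circle_norm_square)
  qed
  moreover have "s (w + of_real \<rho> * cis \<theta>) \<le> ereal (k \<theta>)" for \<theta>
  proof -
    have "s (w + of_real \<rho> * cis \<theta>) + ereal (P (w + of_real \<rho> * cis \<theta>)) \<le> ereal (a + P w)"
      using w(2)[OF inS] a by simp
    then show ?thesis unfolding k_def
      by (cases "s (w + of_real \<rho> * cis \<theta>)") auto
  qed
  ultimately have "circle_mean (\<lambda>\<xi>. s (w + of_real \<rho> * \<xi>)) \<le>
      ereal ((2*pi*(a + P w) - (2*pi*H w + \<eta> * (2*pi*((cmod w)\<^sup>2 + \<rho>\<^sup>2) - 2*pi*R\<^sup>2))) / (2*pi))"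
    by (intro circle_mean_le) (use neg inS in auto)
  also have "(2*pi*(a + P w) - (2*pi*H w + \<eta> * (2*pi*((cmod w)\<^sup>2 + \<rho>\<^sup>2) - 2*pi*R\<^sup>2))) / (2*pi) = a - \<eta> * \<rho>\<^sup>2"
    by (simp add: P_def field_simps)
  finally have "s w \<le> ereal (a - \<eta> * \<rho>\<^sup>2)" by (rule order_trans[OF sm])
  moreover have "\<eta> * \<rho>\<^sup>2 > 0" using \<eta> \<rho> by simp
  ultimately show False using a by simp
qed


section \<open>Zeros of holomorphic functions under perturbation\<close>

lemma finite_zeros_cball:
  fixes f :: "complex \<Rightarrow> complex"
  assumes f: "f holomorphic_on ball c R" and "r < R" "w \<in> ball c R" "f w \<noteq> 0"
  shows "finite {z \<in> cball c r. f z = 0}"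
proof (cases "f constant_on ball c R")
  case True
  then have "f z \<noteq> 0" if "z \<in> cball c r" for z
    using that assms unfolding constant_on_def by (metis (no_types) mem_ball mem_cball order_le_less_trans)
  then have empty: "{z \<in> cball c r. f z = 0} = {}" by blast
  show ?thesis unfolding empty by simp
next
  case False
  have "cball c r \<subseteq> ball c R" using assms by auto
  then show ?thesis
    using holomorphic_compact_finite_zeros[OF f open_ball connected_ball compact_cball] False by blast
qed

lemma rouche_disc:
  fixes f g :: "complex \<Rightarrow> complex"
  assumes r: "0 < r" "r < R" and f: "f holomorphic_on ball c R" and g: "g holomorphic_on ball c R"
    and less: "\<And>z. z \<in> sphere c r \<Longrightarrow> cmod (g z - f z) < cmod (f z)"
  shows "finite {z \<in> ball c r. f z = 0}" "finite {z \<in> ball c r. g z = 0}"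
    "(\<Sum>z | z \<in> ball c r \<and> g z = 0. zorder g z) = (\<Sum>z | z \<in> ball c r \<and> f z = 0. zorder f z)"
proof -
  define R' where "R' = (r + R) / 2"
  have R': "r < R'" "R' < R" using r by (auto simp: R'_def field_simps)
  define p where "p = c + of_real r"
  have p: "p \<in> sphere c r" "p \<in> ball c R" using r by (auto simp: p_def dist_norm)
  have nz: "f z \<noteq> 0" "g z \<noteq> 0" if "z \<in> sphere c r" for z
    using less[OF that] by auto
  have fin: "finite {z \<in> cball c R'. f z = 0}" "finite {z \<in> cball c R'. g z = 0}"
    using finite_zeros_cball[OF f R'(2) p(2)] finite_zeros_cball[OF g R'(2) p(2)] nz[OF p(1)] by auto
  show "finite {z \<in> ball c r. f z = 0}" "finite {z \<in> ball c r. g z = 0}"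
    by (rule finite_subset[OF _ fin(1)], use R' in force) (rule finite_subset[OF _ fin(2)], use R' in force)
  have finb: "finite {z \<in> ball c R'. f z = 0}" "finite {z \<in> ball c R'. g z = 0}"
    by (rule rev_finite_subset[OF fin(1)], force) (rule rev_finite_subset[OF fin(2)], force)
  have sub: "ball c R' \<subseteq> ball c R" using R' by auto
  have wn: "winding_number (circlepath c r) z = (if z \<in> ball c r then 1 else 0)"
    if "z \<notin> sphere c r" for z
  proof (cases "z \<in> ball c r")
    case True
    then show ?thesis
      using winding_number_circlepath[of z c r] by (auto simp: dist_norm norm_minus_commute)
  next
    case False
    then have "z \<notin> cball c r" using that by auto
    then have "winding_number (circlepath c r) z = 0"
      using r by (intro winding_number_zero_outside[of _ "cball c r"]) auto
    then show ?thesis using False by simp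
  qed
  have sum_eq: "(\<Sum>z\<in>{z \<in> ball c R'. h z = 0}. winding_number (circlepath c r) z * of_int (zorder h z))
      = of_int (\<Sum>z | z \<in> ball c r \<and> h z = 0. zorder h z)"
    if "\<And>z. z \<in> sphere c r \<Longrightarrow> h z \<noteq> 0" "finite {z \<in> ball c R'. h z = 0}" for h
  proof -
    have "(\<Sum>z\<in>{z \<in> ball c R'. h z = 0}. winding_number (circlepath c r) z * of_int (zorder h z))
       = (\<Sum>z\<in>{z \<in> ball c r. h z = 0}. winding_number (circlepath c r) z * of_int (zorder h z))"
    proof (rule sum.mono_neutral_right[OF that(2)])
      show "{z \<in> ball c r. h z = 0} \<subseteq> {z \<in> ball c R'. h z = 0}" using R' by auto
      show "\<forall>i\<in>{z \<in> ball c R'. h z = 0} - {z \<in> ball c r. h z = 0}.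
         winding_number (circlepath c r) i * of_int (zorder h i) = 0"
      proof
        fix i assume i: "i \<in> {z \<in> ball c R'. h z = 0} - {z \<in> ball c r. h z = 0}"
        then have "i \<notin> sphere c r" using that(1) by blast
        then show "winding_number (circlepath c r) i * of_int (zorder h i) = 0"
          using wn[of i] i by auto
      qed
    qed
    also have "\<dots> = (\<Sum>z\<in>{z \<in> ball c r. h z = 0}. of_int (zorder h z))"
      by (intro sum.cong refl) (use wn in auto)
    finally show ?thesis by simp
  qed
  have "(\<Sum>z\<in>{z \<in> ball c R'. f z + (g z - f z) = 0}.
          winding_number (circlepath c r) z * of_int (zorder (\<lambda>z. f z + (g z - f z)) z))
      = (\<Sum>z\<in>{z \<in> ball c R'. f z = 0}. winding_number (circlepath c r) z * of_int (zorder f z))"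
  proof (rule Rouche_theorem)
    show "f holomorphic_on ball c R'" "(\<lambda>z. g z - f z) holomorphic_on ball c R'"
      using sub f g by (auto intro!: holomorphic_intros intro: holomorphic_on_subset)
    show "path_image (circlepath c r) \<subseteq> ball c R'" using R' r by auto
    show "\<forall>z\<in>path_image (circlepath c r). cmod (g z - f z) < cmod (f z)"
      using less r by auto
    show "\<forall>z. z \<notin> ball c R' \<longrightarrow> winding_number (circlepath c r) z = 0"
      using wn R' by auto
  qed (use finb in auto)
  then have "of_int (\<Sum>z | z \<in> ball c r \<and> g z = 0. zorder g z)
      = (of_int (\<Sum>z | z \<in> ball c r \<and> f z = 0. zorder f z) :: complex)"
    using sum_eq[of f] sum_eq[of g] nz finb by simp
  then show "(\<Sum>z | z \<in> ball c r \<and> g z = 0. zorder g z) = (\<Sum>z | z \<in> ball c r \<and> f z = 0. zorder f z)"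
    by (simp only: of_int_eq_iff)
qed

lemma zorder_zero_pos:
  assumes "f holomorphic_on ball c R" "z \<in> ball c R" "w \<in> ball c R" "f w \<noteq> 0" "f z = 0"
  shows "zorder f z > 0"
proof -
  have "\<exists>w\<in>ball c R. f w \<noteq> 0" using assms by blast
  from zorder_exist_zero[OF assms(1) open_ball connected_ball assms(2) this] assms(5)
  show ?thesis by presburger
qed

text \<open>
  The first nonvanishing derivative at \<open>z\<close> exists by the identity theorem, and its
  index is the order.
\<close>

lemma zorder_higher_deriv:
  assumes f: "f holomorphic_on ball c R" and z: "z \<in> ball c R" and w: "w \<in> ball c R" "f w \<noteq> 0"
    and m: "zorder f z = int m"
  shows "\<And>i. i < m \<Longrightarrow> (deriv ^^ i) f z = 0" "(deriv ^^ m) f z \<noteq> 0"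
proof -
  have "\<exists>n. (deriv ^^ n) f z \<noteq> 0"
    using holomorphic_fun_eq_0_on_connected[OF f open_ball connected_ball _ z w(1)] w(2) by blast
  then obtain n where n: "(deriv ^^ n) f z \<noteq> 0" "\<And>i. i < n \<Longrightarrow> (deriv ^^ i) f z = 0"
    using exists_least_iff[of "\<lambda>n. (deriv ^^ n) f z \<noteq> 0"] by blast
  have "zorder f z = int n"
    by (rule zorder_zero_eqI[OF f open_ball z]) (use n in auto)
  then have "n = m" using m by simp
  then show "\<And>i. i < m \<Longrightarrow> (deriv ^^ i) f z = 0" "(deriv ^^ m) f z \<noteq> 0" using n by auto
qed

lemma factor_zero:
  assumes f: "f holomorphic_on ball c R" and z: "z \<in> ball c R" and w: "w \<in> ball c R" "f w \<noteq> 0"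
    and m: "zorder f z = int m"
  obtains h where "h holomorphic_on ball c R" "h z \<noteq> 0"
    "\<And>\<zeta>. \<zeta> \<in> ball c R \<Longrightarrow> f \<zeta> = h \<zeta> * (\<zeta> - z) ^ m"
proof -
  obtain r where r: "r > 0" "cball z r \<subseteq> ball c R" "zor_poly f z holomorphic_on cball z r"
      "\<And>\<zeta>. \<zeta> \<in> cball z r \<Longrightarrow> f \<zeta> = zor_poly f z \<zeta> * (\<zeta> - z) ^ m \<and> zor_poly f z \<zeta> \<noteq> 0"
  proof -
    have "\<exists>w\<in>ball c R. f w \<noteq> 0" using w by blast
    from zorder_exist_zero[OF f open_ball connected_ball z this] show ?thesis
      using that m by (metis nat_int)
  qed
  define h where "h \<zeta> = (if \<zeta> = z then zor_poly f z z else f \<zeta> / (\<zeta> - z) ^ m)" for \<zeta>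
  have "h holomorphic_on ball c R - {z}"
  proof (rule holomorphic_transform)
    show "(\<lambda>\<zeta>. f \<zeta> / (\<zeta> - z) ^ m) holomorphic_on ball c R - {z}"
      by (intro holomorphic_intros holomorphic_on_subset[OF f]) auto
  qed (auto simp: h_def)
  moreover have "h holomorphic_on ball z r"
  proof (rule holomorphic_transform)
    show "zor_poly f z holomorphic_on ball z r"
      by (rule holomorphic_on_subset[OF r(3)]) auto
    fix \<zeta> assume "\<zeta> \<in> ball z r"
    then have "f \<zeta> = zor_poly f z \<zeta> * (\<zeta> - z) ^ m" using r(4)[of \<zeta>] by auto
    then show "zor_poly f z \<zeta> = h \<zeta>" by (auto simp: h_def)
  qed
  ultimately have "h holomorphic_on (ball c R - {z}) \<union> ball z r"
    by (rule holomorphic_on_Un) auto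
  moreover have "(ball c R - {z}) \<union> ball z r = ball c R" using r by auto
  ultimately have "h holomorphic_on ball c R" by simp
  moreover have "h z \<noteq> 0" using r(4)[of z] r(1) by (simp add: h_def)
  moreover have "f \<zeta> = h \<zeta> * (\<zeta> - z) ^ m" for \<zeta>
  proof (cases "\<zeta> = z")
    case True
    then show ?thesis using r(4)[of z] r(1) by (simp add: h_def)
  qed (simp add: h_def)
  ultimately show ?thesis using that by blast
qed

text \<open>
  Divide out the zero: \<open>f = h (\<zeta> - z)\<^sup>m\<close> with \<open>h\<close>
  holomorphic on the whole disc. On the circle of radius \<open>r\<close> around
  \<open>c\<close> the quotient \<open>h\<close> is at most \<open>M / (r - |z -
  c|)\<^sup>m\<close>, hence also at \<open>c\<close>.
\<close>

lemma norm_le_near_multiple_zero: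
  assumes f: "f holomorphic_on ball c R" and w: "w \<in> ball c R" "f w \<noteq> 0"
    and m: "zorder f z = int m" and M: "\<And>\<zeta>. \<zeta> \<in> ball c R \<Longrightarrow> cmod (f \<zeta>) \<le> M"
    and r: "cmod (z - c) < r" "r < R"
  shows "cmod (f c) \<le> M * (cmod (z - c) / (r - cmod (z - c))) ^ m"
proof -
  have z: "z \<in> ball c R" using r by (simp add: dist_norm norm_minus_commute)
  have r0: "r > 0" using r norm_ge_zero[of "z - c"] by linarith
  obtain h where h: "h holomorphic_on ball c R"
    "\<And>\<zeta>. \<zeta> \<in> ball c R \<Longrightarrow> f \<zeta> = h \<zeta> * (\<zeta> - z) ^ m"
    using factor_zero[OF f z w m] by metis
  define d where "d = r - cmod (z - c)"
  have d: "d > 0" using r by (simp add: d_def)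
  have "cmod ((deriv ^^ 0) h c) \<le> fact 0 * (M / d ^ m) / r ^ 0"
  proof (rule Cauchy_inequality)
    show "h holomorphic_on ball c r" using r by (intro holomorphic_on_subset[OF h(1)]) auto
    show "continuous_on (cball c r) h"
      using r by (intro holomorphic_on_imp_continuous_on holomorphic_on_subset[OF h(1)]) auto
    show "0 < r" by fact
    fix \<zeta> assume \<zeta>: "cmod (c - \<zeta>) = r"
    then have in_ball: "\<zeta> \<in> ball c R" using r by (simp add: dist_norm)
    have "r \<le> cmod (\<zeta> - z) + cmod (z - c)"
      using norm_triangle_ineq[of "\<zeta> - z" "z - c"] \<zeta> by (simp add: norm_minus_commute)
    then have "d \<le> cmod (\<zeta> - z)" by (simp add: d_def)
    then have "cmod (h \<zeta>) * d ^ m \<le> cmod (h \<zeta>) * cmod (\<zeta> - z) ^ m"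
      using d by (intro mult_left_mono power_mono) auto
    also have "\<dots> = cmod (f \<zeta>)" using h(2)[OF in_ball] by (simp add: norm_mult norm_power)
    also have "\<dots> \<le> M" by (rule M[OF in_ball])
    finally show "cmod (h \<zeta>) \<le> M / d ^ m" using d by (simp add: field_simps)
  qed
  then have "cmod (h c) \<le> M / d ^ m" by simp
  moreover have "cmod (f c) = cmod (h c) * cmod (z - c) ^ m"
    using h(2)[of c] r r0 by (simp add: norm_mult norm_power norm_minus_commute)
  ultimately have "cmod (f c) \<le> M / d ^ m * cmod (z - c) ^ m"
    by (metis mult_right_mono norm_ge_zero zero_le_power)
  then show ?thesis by (simp add: d_def power_divide)
qed

text \<open>
  The derivative \<open>D\<close> of \<open>f\<close> of order \<open>m - 1\<close> has a simple
  zero at \<open>c\<close>, so \<open>|D z|\<close> is bounded below by a multiple of \<open>|z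
  - c|\<close>. At a zero \<open>z\<close> of \<open>g\<close> of the same order
  \<open>m\<close>, the corresponding derivative of \<open>g\<close> vanishes, and Cauchy's
  inequality for \<open>g - f\<close> shows that \<open>|D z|\<close> is at most a multiple of
  \<open>e\<close>. The displacement of a multiple zero that does not split is thus linear in
  the perturbation, whereas for a zero that may split it is only of the order of
  \<open>e\<close> to the power \<open>1/m\<close>.
\<close>

lemma multiple_zero_displacement:
  assumes f: "f holomorphic_on ball c R" and w: "w \<in> ball c R" "f w \<noteq> 0"
    and m: "zorder f c = int m" "m > 0" and R: "R > 0"
  obtains L \<rho> where "0 < \<rho>" "\<rho> \<le> R / 4" "0 < L"
    "\<And>g e z w'. \<lbrakk>g holomorphic_on ball c R; \<And>\<zeta>. \<zeta> \<in> ball c R \<Longrightarrow> cmod (g \<zeta> - f \<zeta>) \<le> e;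
       z \<in> ball c \<rho>; zorder g z = int m; w' \<in> ball c R; g w' \<noteq> 0\<rbrakk> \<Longrightarrow> cmod (z - c) \<le> L * e"
proof -
  define D where "D = (deriv ^^ (m - 1)) f"
  have c: "c \<in> ball c R" using R by simp
  have D0: "D c = 0"
    unfolding D_def using zorder_higher_deriv(1)[OF f c w m(1)] m(2) by simp
  have D1: "deriv D c \<noteq> 0"
    using zorder_higher_deriv(2)[OF f c w m(1)] m(2)
    unfolding D_def by (cases m) auto
  have "D holomorphic_on ball c R"
    unfolding D_def by (rule holomorphic_higher_deriv[OF f open_ball])
  then have "(D has_field_derivative deriv D c) (at c)"
    using c holomorphic_derivI open_ball by blast
  then have "((\<lambda>z. cmod ((D z - D c) / (z - c))) \<longlongrightarrow> cmod (deriv D c)) (at c)"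
    unfolding has_field_derivative_iff by (rule tendsto_norm)
  then have "eventually (\<lambda>z. cmod ((D z - D c) / (z - c)) > cmod (deriv D c) / 2) (at c)"
    by (rule order_tendstoD) (use D1 in simp)
  then obtain d where d: "d > 0"
      "\<And>z. z \<noteq> c \<Longrightarrow> dist z c < d \<Longrightarrow> cmod ((D z - D c) / (z - c)) > cmod (deriv D c) / 2"
    unfolding eventually_at by auto
  define b where "b = cmod (deriv D c) / 2"
  have b: "b > 0" using D1 by (simp add: b_def)
  have lower: "b * cmod (z - c) \<le> cmod (D z)" if "dist z c < d" for z
  proof (cases "z = c")
    case False
    then show ?thesis using d(2)[OF False that] D0 by (simp add: b_def norm_divide field_simps)
  qed simp
  define K where "K = fact (m - 1) / (R / 4) ^ (m - 1)"
  have K: "K > 0" using R by (simp add: K_def)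
  show ?thesis
  proof (rule that[of "min d (R / 4)" "K / b"])
    show "0 < min d (R / 4)" "min d (R / 4) \<le> R / 4" "0 < K / b" using d R K b by auto
    fix g e z w'
    assume g: "g holomorphic_on ball c R" and e: "\<And>\<zeta>. \<zeta> \<in> ball c R \<Longrightarrow> cmod (g \<zeta> - f \<zeta>) \<le> e"
      and z: "z \<in> ball c (min d (R / 4))" and mg: "zorder g z = int m" and w': "w' \<in> ball c R" "g w' \<noteq> 0"
    have zR: "z \<in> ball c R" using z R by auto
    have sub: "cball z (R / 4) \<subseteq> ball c R"
    proof
      fix y assume "y \<in> cball z (R / 4)"
      then show "y \<in> ball c R" using z R dist_triangle[of c y z] by auto
    qed
    have gh: "(\<lambda>\<zeta>. g \<zeta> - f \<zeta>) holomorphic_on ball c R" by (intro holomorphic_intros f g)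
    have "(deriv ^^ (m - 1)) (\<lambda>\<zeta>. g \<zeta> - f \<zeta>) z = (deriv ^^ (m - 1)) g z - D z"
      unfolding D_def by (rule higher_deriv_diff[OF g f open_ball zR])
    also have "(deriv ^^ (m - 1)) g z = 0"
      using zorder_higher_deriv(1)[OF g zR w' mg] m(2) by simp
    finally have "cmod (D z) = cmod ((deriv ^^ (m - 1)) (\<lambda>\<zeta>. g \<zeta> - f \<zeta>) z)" by simp
    also have "\<dots> \<le> fact (m - 1) * e / (R / 4) ^ (m - 1)"
    proof (rule Cauchy_inequality)
      show "(\<lambda>\<zeta>. g \<zeta> - f \<zeta>) holomorphic_on ball z (R / 4)"
        using sub by (intro holomorphic_on_subset[OF gh]) auto
      show "continuous_on (cball z (R / 4)) (\<lambda>\<zeta>. g \<zeta> - f \<zeta>)"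
        by (intro holomorphic_on_imp_continuous_on holomorphic_on_subset[OF gh] sub)
      show "0 < R / 4" using R by simp
      fix x assume "cmod (z - x) = R / 4"
      then have "x \<in> cball z (R / 4)" by (simp add: dist_norm)
      then show "cmod (g x - f x) \<le> e" using e sub by blast
    qed
    finally have "b * cmod (z - c) \<le> K * e"
      using lower[of z] z by (simp add: K_def dist_commute)
    then show "cmod (z - c) \<le> K / b * e" using b by (simp add: field_simps)
  qed
qed

text \<open>
  If the perturbation \<open>g\<close> keeps a zero of order \<open>m\<close> near
  \<open>c\<close>, this zero is at distance \<open>O(e)\<close> from \<open>c\<close>, and so
  \<open>g\<close> is of size \<open>e\<^sup>m\<close> at \<open>c\<close>, rather than merely
  of size \<open>e\<close>.
\<close>

lemma norm_le_perturbed_multiple_zero: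
  assumes f: "f holomorphic_on ball c R" and w: "w \<in> ball c R" "f w \<noteq> 0"
    and m: "zorder f c = int m" "m > 0" and R: "R > 0"
    and M: "\<And>\<zeta>. \<zeta> \<in> ball c R \<Longrightarrow> cmod (f \<zeta>) \<le> M"
  obtains C \<rho> where "0 < \<rho>" "\<rho> \<le> R / 4" "0 < C"
    "\<And>g e z w'. \<lbrakk>g holomorphic_on ball c R; \<And>\<zeta>. \<zeta> \<in> ball c R \<Longrightarrow> cmod (g \<zeta> - f \<zeta>) \<le> e; e \<le> 1;
       z \<in> ball c \<rho>; zorder g z = int m; w' \<in> ball c R; g w' \<noteq> 0\<rbrakk> \<Longrightarrow> cmod (g c) \<le> C * e ^ m"
proof -
  obtain L \<rho> where L: "0 < \<rho>" "\<rho> \<le> R / 4" "0 < L"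
    and disp: "\<And>g e z w'. \<lbrakk>g holomorphic_on ball c R; \<And>\<zeta>. \<zeta> \<in> ball c R \<Longrightarrow> cmod (g \<zeta> - f \<zeta>) \<le> e;
       z \<in> ball c \<rho>; zorder g z = int m; w' \<in> ball c R; g w' \<noteq> 0\<rbrakk> \<Longrightarrow> cmod (z - c) \<le> L * e"
    using multiple_zero_displacement[OF f w m R] by metis
  have "M \<ge> 0" using M[of c] R by (meson centre_in_ball norm_ge_zero order_trans)
  show ?thesis
  proof (rule that[of \<rho> "(M + 1) * (L * 4 / R) ^ m"])
    show "0 < (M + 1) * (L * 4 / R) ^ m" using \<open>M \<ge> 0\<close> L R by simp
    fix g e z w'
    assume g: "g holomorphic_on ball c R" and e: "\<And>\<zeta>. \<zeta> \<in> ball c R \<Longrightarrow> cmod (g \<zeta> - f \<zeta>) \<le> e" "e \<le> 1"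
      and z: "z \<in> ball c \<rho>" and mg: "zorder g z = int m" and w': "w' \<in> ball c R" "g w' \<noteq> 0"
    have zc: "cmod (z - c) \<le> L * e" by (rule disp[OF g e(1) z mg w'])
    have zR: "cmod (z - c) < R / 4" using z L by (simp add: dist_norm norm_minus_commute)
    have "cmod (g \<zeta>) \<le> M + 1" if "\<zeta> \<in> ball c R" for \<zeta>
      using e(1)[OF that] e(2) M[OF that] norm_triangle_ineq[of "g \<zeta> - f \<zeta>" "f \<zeta>"] by simp
    then have "cmod (g c) \<le> (M + 1) * (cmod (z - c) / (R / 2 - cmod (z - c))) ^ m"
      using zR R by (intro norm_le_near_multiple_zero[OF g w' mg]) auto
    also have "\<dots> \<le> (M + 1) * (L * e / (R / 4)) ^ m"
      using zR zc R \<open>M \<ge> 0\<close> order_trans[OF norm_ge_zero zc]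
      by (intro mult_left_mono power_mono frac_le) auto
    also have "\<dots> = (M + 1) * (L * 4 / R) ^ m * e ^ m"
      by (simp add: power_mult_distrib power_divide)
    finally show "cmod (g c) \<le> (M + 1) * (L * 4 / R) ^ m * e ^ m" .
  qed (use L in auto)
qed


section \<open>Holomorphic functions along complex lines\<close>

lemma norm_vector_scalar_mult: "norm (c *s v) = cmod c * norm v" for v :: "complex ^ 'n"
  by (simp add: norm_vec_def norm_mult L2_set_right_distrib)

lemma dist_on_lines: "dist (x + \<zeta> *s w) (x + \<zeta> *s w') = cmod \<zeta> * dist w w'" for w :: "complex ^ 'n"
proof -
  have "(x + \<zeta> *s w) - (x + \<zeta> *s w') = \<zeta> *s (w - w')"
    by (simp add: vector_ssub_ldistrib)
  then show ?thesis unfolding dist_norm by (simp only: norm_vector_scalar_mult)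
qed

lemma bounded_linear_vector_scalar_mult_left: "bounded_linear (\<lambda>\<zeta>. \<zeta> *s w)" for w :: "complex ^ 'n"
  by (rule bounded_linear_intro[where K = "norm w"])
     (auto simp: vector_sadd_rdistrib norm_vector_scalar_mult vec_eq_iff)

lemma continuous_on_line [continuous_intros]:
  "continuous_on A g \<Longrightarrow> continuous_on A (\<lambda>\<zeta>. x + g \<zeta> *s w)" for w :: "complex ^ 'n"
  by (intro continuous_intros bounded_linear.continuous_on[OF bounded_linear_vector_scalar_mult_left])

lemma open_line_preimage: "open S \<Longrightarrow> open {\<zeta>. x + \<zeta> *s w \<in> S}" for w :: "complex ^ 'n"
  using open_vimage[of S "\<lambda>\<zeta>. x + \<zeta> *s w"] by (simp add: vimage_def continuous_intros)

lemma holomorphic_Cn_imp_continuous_on: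
  "holomorphic_Cn S f \<Longrightarrow> continuous_on S f"
  unfolding holomorphic_Cn_def
  by (intro continuous_at_imp_continuous_on ballI) (metis has_derivative_continuous)

lemma holomorphic_Cn_on_line:
  fixes f :: "complex ^ 'n \<Rightarrow> complex"
  assumes "holomorphic_Cn S f" "\<And>\<zeta>. \<zeta> \<in> A \<Longrightarrow> x + \<zeta> *s w \<in> S"
  shows "(\<lambda>\<zeta>. f (x + \<zeta> *s w)) holomorphic_on A"
  unfolding holomorphic_on_def
proof
  fix \<zeta> assume "\<zeta> \<in> A"
  then obtain D where D: "(f has_derivative D) (at (x + \<zeta> *s w))" "\<And>c v. D (c *s v) = c * D v"
    using assms unfolding holomorphic_Cn_def by blast
  have "((\<lambda>\<zeta>. x + \<zeta> *s w) has_derivative (\<lambda>h. h *s w)) (at \<zeta>)"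
    using has_derivative_add[OF has_derivative_const
        bounded_linear_imp_has_derivative[OF bounded_linear_vector_scalar_mult_left]] by fastforce
  from has_derivative_compose[OF this D(1)]
  have "((\<lambda>\<zeta>. f (x + \<zeta> *s w)) has_field_derivative D w) (at \<zeta>)"
    unfolding has_field_derivative_def D(2) by (simp only: mult.commute[of _ "D w"])
  then show "(\<lambda>\<zeta>. f (x + \<zeta> *s w)) field_differentiable at \<zeta> within A"
    unfolding field_differentiable_def using has_field_derivative_at_within by blast
qed

text \<open>
  Differentiability at each point alone gives no uniform Lipschitz constant. It comes from the
  bound of \<open>f\<close> on a compact neighbourhood of \<open>K\<close> and Cauchy's
  inequality along the complex line through two neighbouring points.
\<close>

lemma holomorphic_Cn_lipschitz_near_compact:
  fixes f :: "complex ^ 'n \<Rightarrow> complex"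
  assumes "open S" and f: "holomorphic_Cn S f" and K: "compact K" "K \<subseteq> S"
  obtains L \<delta> where "L > 0" "\<delta> > 0"
    "\<And>z z'. z \<in> K \<Longrightarrow> dist z z' < \<delta> \<Longrightarrow> z' \<in> S \<and> cmod (f z' - f z) \<le> L * dist z z'"
proof -
  obtain e where e: "e > 0" "(\<Union>x\<in>K. ball x e) \<subseteq> S"
    using compact_subset_open_imp_ball_epsilon_subset[OF K(1) \<open>open S\<close> K(2)] by blast
  define T where "T = {x + y | x y. x \<in> K \<and> y \<in> cball 0 (e / 2)}"
  have "compact T" unfolding T_def by (rule compact_sums[OF K(1) compact_cball])
  moreover have T: "z' \<in> T" if "z \<in> K" "dist z z' \<le> e / 2" for z z'
  proof -
    have "z' = z + (z' - z)" "z' - z \<in> cball 0 (e / 2)"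
      using that by (auto simp: dist_norm norm_minus_commute)
    then show ?thesis using that(1) unfolding T_def by blast
  qed
  have TS: "T \<subseteq> S"
  proof
    fix z' assume "z' \<in> T"
    then obtain z y where "z \<in> K" "norm y \<le> e / 2" "z' = z + y" unfolding T_def by auto
    then have "z' \<in> ball z e" using e(1) by (simp add: dist_norm)
    then show "z' \<in> S" using e(2) \<open>z \<in> K\<close> by blast
  qed
  have "continuous_on T f" by (rule continuous_on_subset[OF holomorphic_Cn_imp_continuous_on[OF f] TS])
  then have "bounded (f ` T)"
    using \<open>compact T\<close> by (intro compact_imp_bounded compact_continuous_image)
  then obtain M where M: "M > 0" "\<And>z. z \<in> T \<Longrightarrow> cmod (f z) \<le> M"
    unfolding bounded_pos by blast
  show ?thesis
  proof (rule that[of "4 * M / e" "e / 4"])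
    show "4 * M / e > 0" "e / 4 > 0" using e M by auto
    fix z z' assume z: "z \<in> K" "dist z z' < e / 4"
    define d where "d = dist z z'"
    have zS: "z' \<in> S" using T[OF z(1)] TS z(2) e(1) by auto
    show "z' \<in> S \<and> cmod (f z' - f z) \<le> 4 * M / e * dist z z'"
    proof (cases "d = 0")
      case True
      then show ?thesis using zS by (auto simp: d_def)
    next
      case False
      then have d: "d > 0" "d < e / 4" using z by (auto simp: d_def)
      define h where "h \<zeta> = f (z + \<zeta> *s (z' - z))" for \<zeta>
      define Q where "Q = e / (2 * d)"
      have Q: "Q > 2" using d by (simp add: Q_def field_simps)
      have inT: "z + \<zeta> *s (z' - z) \<in> T" if "cmod \<zeta> \<le> Q" for \<zeta>
      proof (rule T[OF z(1)])
        have "dist z (z + \<zeta> *s (z' - z)) = cmod \<zeta> * d"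
          unfolding d_def dist_norm by (simp add: norm_vector_scalar_mult norm_minus_commute
              del: vector_ssub_ldistrib vector_sub_rdistrib)
        also have "\<dots> \<le> Q * d" using that d by (intro mult_right_mono) auto
        also have "\<dots> = e / 2" using d by (simp add: Q_def)
        finally show "dist z (z + \<zeta> *s (z' - z)) \<le> e / 2" .
      qed
      have h: "h holomorphic_on cball 0 Q"
        unfolding h_def by (rule holomorphic_Cn_on_line[OF f]) (use inT TS in auto)
      have "cmod (h 1 - h 0) \<le> 4 * M / e * d * cmod (1 - 0)"
      proof (rule field_differentiable_bound[OF convex_cball[of 0 1], where f' = "deriv h"])
        fix t :: complex assume t: "t \<in> cball 0 1"
        then have "t \<in> ball 0 Q" using Q by auto
        moreover have "h holomorphic_on ball 0 Q" by (rule holomorphic_on_subset[OF h]) auto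
        ultimately show "(h has_field_derivative deriv h t) (at t within cball 0 1)"
          using holomorphic_derivI open_ball by (metis has_field_derivative_at_within)
        have sub: "cball t (Q / 2) \<subseteq> cball 0 Q"
        proof
          fix s assume "s \<in> cball t (Q / 2)"
          then show "s \<in> cball 0 Q" using t Q norm_triangle_ineq2[of s t]
            by (auto simp: dist_norm norm_minus_commute)
        qed
        have "cmod ((deriv ^^ 1) h t) \<le> fact 1 * M / (Q / 2) ^ 1"
        proof (rule Cauchy_inequality)
          show "h holomorphic_on ball t (Q / 2)"
            using sub ball_subset_cball by (intro holomorphic_on_subset[OF h]) blast
          show "continuous_on (cball t (Q / 2)) h"
            by (intro holomorphic_on_imp_continuous_on holomorphic_on_subset[OF h] sub)
          show "0 < Q / 2" using Q by simp
          fix s assume "cmod (t - s) = Q / 2"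
          then have "s \<in> cball t (Q / 2)" by (simp add: dist_norm)
          then have "s \<in> cball 0 Q" using sub by blast
          then show "cmod (h s) \<le> M" unfolding h_def by (intro M(2) inT) auto
        qed
        then show "cmod (deriv h t) \<le> 4 * M / e * d" using d by (simp add: Q_def mult_ac)
      qed auto
      moreover have "z + 1 *s (z' - z) = z'" "z + 0 *s (z' - z) = z"
        by (simp_all add: vec_eq_iff)
      ultimately show ?thesis using zS by (simp add: h_def d_def)
    qed
  qed
qed

lemma cball_subset_open_imp_ball:
  assumes "open S" "cball (c::'a::euclidean_space) r \<subseteq> S" "r > 0"
  obtains R where "R > r" "ball c R \<subseteq> S"
proof -
  obtain e where e: "e > 0" "(\<Union>x\<in>cball c r. ball x e) \<subseteq> S"
    using compact_subset_open_imp_ball_epsilon_subset[OF compact_cball assms(1,2)] by blast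
  show ?thesis
  proof (rule that[of "r + e"])
    show "ball c (r + e) \<subseteq> S"
    proof
      fix z assume z: "z \<in> ball c (r + e)"
      show "z \<in> S"
      proof (cases "z \<in> cball c r")
        case False
        define y where "y = c + (r / dist c z) *\<^sub>R (z - c)"
        have d: "dist c z > r" "dist c z > 0" using False assms(3) by auto
        have "dist c y = r" using d assms(3) by (simp add: y_def dist_norm norm_minus_commute)
        moreover have "z - y = (1 - r / dist c z) *\<^sub>R (z - c)"
          by (simp add: y_def scaleR_diff_left)
        then have "dist y z = (1 - r / dist c z) * dist c z"
          using d by (simp add: dist_norm norm_minus_commute[of y] norm_minus_commute[of c])
        then have "dist y z < e" using z d by (simp add: field_simps)
        ultimately have "z \<in> ball y e" "y \<in> cball c r" by auto
        then show ?thesis using e(2) by blast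
      qed (use assms in auto)
    qed
  qed (use e in auto)
qed

lemma line_perturbation:
  fixes f :: "complex ^ 'n \<Rightarrow> complex"
  assumes "open S" and f: "holomorphic_Cn S f" and r: "r > 0"
    and sub: "\<And>\<zeta>. \<zeta> \<in> cball 0 r \<Longrightarrow> x + \<zeta> *s w \<in> S"
  obtains L \<delta> R where "L > 0" "\<delta> > 0" "R > r"
    "\<And>w' \<zeta>. dist w w' < \<delta> \<Longrightarrow> \<zeta> \<in> ball 0 R \<Longrightarrow>
       x + \<zeta> *s w' \<in> S \<and> cmod (f (x + \<zeta> *s w') - f (x + \<zeta> *s w)) \<le> L * dist w w'"
proof -
  obtain R1 where R1: "R1 > r" "ball 0 R1 \<subseteq> {\<zeta>. x + \<zeta> *s w \<in> S}"
    using cball_subset_open_imp_ball[OF open_line_preimage[OF \<open>open S\<close>, of x w], of 0 r] sub r by blast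
  define R where "R = (r + R1) / 2"
  have R: "R > r" "R < R1" using R1 by (auto simp: R_def)
  define K where "K = (\<lambda>\<zeta>. x + \<zeta> *s w) ` cball 0 R"
  have "compact K" unfolding K_def
    by (intro compact_continuous_image continuous_intros compact_cball)
  moreover have "cball 0 R \<subseteq> ball (0::complex) R1" using R by auto
  then have "K \<subseteq> S" unfolding K_def using R1(2) by blast
  ultimately obtain L \<delta> where L: "L > 0" "\<delta> > 0"
    "\<And>z z'. z \<in> K \<Longrightarrow> dist z z' < \<delta> \<Longrightarrow> z' \<in> S \<and> cmod (f z' - f z) \<le> L * dist z z'"
    using holomorphic_Cn_lipschitz_near_compact[OF \<open>open S\<close> f] by metis
  show ?thesis
  proof (rule that[of "L * R" "\<delta> / R" R])
    show "L * R > 0" "\<delta> / R > 0" "R > r" using L R r by auto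
    fix w' \<zeta> assume w': "dist w w' < \<delta> / R" and \<zeta>: "\<zeta> \<in> ball (0::complex) R"
    have d: "dist (x + \<zeta> *s w) (x + \<zeta> *s w') \<le> R * dist w w'"
      unfolding dist_on_lines using \<zeta> by (intro mult_right_mono) auto
    also have "\<dots> < \<delta>" using w' R r by (simp add: field_simps)
    finally have "dist (x + \<zeta> *s w) (x + \<zeta> *s w') < \<delta>" .
    moreover have "x + \<zeta> *s w \<in> K" using \<zeta> unfolding K_def by auto
    ultimately have "x + \<zeta> *s w' \<in> S"
      "cmod (f (x + \<zeta> *s w') - f (x + \<zeta> *s w)) \<le> L * dist (x + \<zeta> *s w) (x + \<zeta> *s w')"
      using L(3) by blast+
    moreover have "L * dist (x + \<zeta> *s w) (x + \<zeta> *s w') \<le> L * (R * dist w w')"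
      using d L by (intro mult_left_mono) auto
    ultimately show "x + \<zeta> *s w' \<in> S \<and> cmod (f (x + \<zeta> *s w') - f (x + \<zeta> *s w)) \<le> L * R * dist w w'"
      by (simp add: mult.assoc)
  qed
qed

lemma compact_nonzero_lower_bound:
  fixes g :: "'a::topological_space \<Rightarrow> complex"
  assumes "compact T" "continuous_on T g" "\<And>z. z \<in> T \<Longrightarrow> g z \<noteq> 0"
  obtains k where "k > 0" "\<And>z. z \<in> T \<Longrightarrow> k \<le> cmod (g z)"
proof (cases "T = {}")
  case False
  have "continuous_on T (\<lambda>z. cmod (g z))" by (intro continuous_intros assms)
  then obtain z where "z \<in> T" "\<And>y. y \<in> T \<Longrightarrow> cmod (g z) \<le> cmod (g y)"
    using continuous_attains_inf[OF assms(1) False] by blast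
  then show ?thesis using that[of "cmod (g z)"] assms(3) by auto
qed (use that[of 1] in auto)

section \<open>Lines along which orders of vanishing agree with ambient ones\<close>

text \<open>
  Near a given direction \<open>w0\<close>, choose a direction \<open>w\<close> for which
  \<open>f (x + \<zeta> w)\<close> has as many distinct zeros in the disc as possible. For
  \<open>w'\<close> close to \<open>w\<close>, Rouche's theorem on small discs around the zeros
  for \<open>w\<close> yields zeros of the same total order in each of them, and maximality
  forces these to be single zeros of unchanged order. A point \<open>z\<close> near \<open>y = x
  + \<zeta>0 w\<close> has the form \<open>x + \<zeta>0 w'\<close> with \<open>|w' - w| = |z -
  y| / |\<zeta>0|\<close>, because \<open>\<zeta>0 \<noteq> 0\<close> by \<open>f x \<noteq>
  0\<close>. The estimate for perturbed multiple zeros, applied with the parameter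
  \<open>\<zeta>0\<close> fixed and the direction varying, therefore bounds \<open>f\<close> in
  a full neighbourhood of \<open>y\<close>.
\<close>

lemma exists_transversal_line:
  fixes f :: "complex ^ 'n \<Rightarrow> complex"
  assumes S: "open S" and f: "holomorphic_Cn S f" and r: "r > 0" and \<eta>: "\<eta> > 0"
    and sub: "\<And>\<zeta>. \<zeta> \<in> cball 0 r \<Longrightarrow> x + \<zeta> *s w0 \<in> S"
    and nz: "\<And>\<zeta>. \<zeta> \<in> sphere 0 r \<Longrightarrow> f (x + \<zeta> *s w0) \<noteq> 0"
    and x: "f x \<noteq> 0"
  obtains w where "dist w0 w < \<eta>"
    "\<And>\<zeta>. \<zeta> \<in> cball 0 r \<Longrightarrow> x + \<zeta> *s w \<in> S"
    "\<And>\<zeta>. \<zeta> \<in> sphere 0 r \<Longrightarrow> f (x + \<zeta> *s w) \<noteq> 0"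
    "\<And>\<zeta> m. \<lbrakk>\<zeta> \<in> ball 0 r; f (x + \<zeta> *s w) = 0; zorder (\<lambda>\<zeta>. f (x + \<zeta> *s w)) \<zeta> = int m\<rbrakk> \<Longrightarrow>
       \<exists>C>0. \<exists>\<delta>>0. \<forall>z\<in>ball (x + \<zeta> *s w) \<delta>. cmod (f z) \<le> C * dist z (x + \<zeta> *s w) ^ m"
proof -
  define F where "F w \<zeta> = f (x + \<zeta> *s w)" for w \<zeta>
  define Z where "Z w = {\<zeta> \<in> ball 0 r. F w \<zeta> = 0}" for w
  obtain L1 \<delta>1 R1 where L1: "L1 > 0" "\<delta>1 > 0" "R1 > r"
    "\<And>w \<zeta>. dist w0 w < \<delta>1 \<Longrightarrow> \<zeta> \<in> ball 0 R1 \<Longrightarrow> x + \<zeta> *s w \<in> S \<and> cmod (F w \<zeta> - F w0 \<zeta>) \<le> L1 * dist w0 w"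
    using line_perturbation[OF S f r sub] unfolding F_def by metis
  have holF: "F w holomorphic_on A" if "\<And>\<zeta>. \<zeta> \<in> A \<Longrightarrow> x + \<zeta> *s w \<in> S" for w A
    unfolding F_def by (rule holomorphic_Cn_on_line[OF f that])
  have hol1: "F w holomorphic_on ball 0 R1" if "dist w0 w < \<delta>1" for w
    by (rule holF) (use L1(4) that in blast)
  have "continuous_on (sphere 0 r) (F w0)"
    by (intro holomorphic_on_imp_continuous_on holF) (use sub in auto)
  then obtain k1 where k1: "k1 > 0" "\<And>\<zeta>. \<zeta> \<in> sphere 0 r \<Longrightarrow> k1 \<le> cmod (F w0 \<zeta>)"
    by (rule compact_nonzero_lower_bound[OF compact_sphere]) (use nz in \<open>auto simp: F_def\<close>)
  define \<eta>1 where "\<eta>1 = Min {\<delta>1, \<eta>, k1 / L1}"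
  have \<eta>1: "\<eta>1 > 0" "\<eta>1 \<le> \<delta>1" "\<eta>1 \<le> \<eta>" "L1 * \<eta>1 \<le> k1"
  proof -
    have le: "\<eta>1 \<le> \<delta>1" "\<eta>1 \<le> \<eta>" "\<eta>1 \<le> k1 / L1"
      unfolding \<eta>1_def by (rule Min_le; simp)+
    show "\<eta>1 > 0" unfolding \<eta>1_def using L1 k1 \<eta> by (subst Min_gr_iff) auto
    show "\<eta>1 \<le> \<delta>1" "\<eta>1 \<le> \<eta>" "L1 * \<eta>1 \<le> k1"
      using le L1(1) by (auto simp: field_simps)
  qed
  have near: "cmod (F w \<zeta> - F w0 \<zeta>) < cmod (F w0 \<zeta>)" if "dist w0 w < \<eta>1" "\<zeta> \<in> sphere 0 r" for w \<zeta>
  proof -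
    have "cmod (F w \<zeta> - F w0 \<zeta>) \<le> L1 * dist w0 w" using L1(3) L1(4)[of w \<zeta>] that \<eta>1 by auto
    also have "\<dots> < L1 * \<eta>1" using that L1 by simp
    also have "\<dots> \<le> k1" by fact
    also have "\<dots> \<le> cmod (F w0 \<zeta>)" using k1 that by simp
    finally show ?thesis .
  qed
  have nz1: "F w \<zeta> \<noteq> 0" if "dist w0 w < \<eta>1" "\<zeta> \<in> sphere 0 r" for w \<zeta>
    using near[OF that] by auto
  have r_sphere: "of_real r \<in> sphere (0::complex) r" "of_real r \<in> ball (0::complex) R1"
    using r L1(3) by auto
  have rou: "finite (Z w) \<and> (\<Sum>\<zeta>\<in>Z w. zorder (F w) \<zeta>) = (\<Sum>\<zeta>\<in>Z w0. zorder (F w0) \<zeta>)"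
    if "dist w0 w < \<eta>1" for w
  proof -
    have "F w0 holomorphic_on ball 0 R1" "F w holomorphic_on ball 0 R1"
      using hol1 that L1(2) \<eta>1(2) by auto
    from rouche_disc[OF r L1(3) this near[OF that]] show ?thesis unfolding Z_def by auto
  qed
  then have finZ: "finite (Z w)" if "dist w0 w < \<eta>1" for w using that by blast
  have sumZ: "(\<Sum>\<zeta>\<in>Z w. zorder (F w) \<zeta>) = (\<Sum>\<zeta>\<in>Z w0. zorder (F w0) \<zeta>)"
    if "dist w0 w < \<eta>1" for w using rou that by blast
  have pos: "zorder (F w) \<zeta> \<ge> 1" if "dist w0 w < \<eta>1" "\<zeta> \<in> Z w" for w \<zeta>
  proof -
    have "dist w0 w < \<delta>1" "\<zeta> \<in> ball 0 R1" "F w \<zeta> = 0"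
      using that \<eta>1 L1(3) by (auto simp: Z_def)
    then show ?thesis
      using zorder_zero_pos[OF hol1 _ r_sphere(2), of w \<zeta>] nz1[OF that(1) r_sphere(1)] by force
  qed
  have cardZ: "card (Z w) < Suc (nat (\<Sum>\<zeta>\<in>Z w0. zorder (F w0) \<zeta>))" if "dist w0 w < \<eta>1" for w
  proof -
    have "int (card (Z w)) = (\<Sum>\<zeta>\<in>Z w. 1)" by simp
    also have "\<dots> \<le> (\<Sum>\<zeta>\<in>Z w. zorder (F w) \<zeta>)" by (rule sum_mono) (rule pos[OF that])
    finally show ?thesis using sumZ[OF that] by simp
  qed
  obtain w where w: "dist w0 w < \<eta>1" and max: "\<And>w'. dist w0 w' < \<eta>1 \<Longrightarrow> card (Z w') \<le> card (Z w)"
  proof -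
    have "\<exists>w. dist w0 w < \<eta>1 \<and> (\<forall>w'. dist w0 w' < \<eta>1 \<longrightarrow> card (Z w') \<le> card (Z w))"
      by (rule ex_has_greatest_nat[of _ w0 _ "Suc (nat (\<Sum>\<zeta>\<in>Z w0. zorder (F w0) \<zeta>))"])
         (use cardZ \<eta>1(1) in auto)
    then show ?thesis using that by blast
  qed
  have wS: "x + \<zeta> *s w \<in> S" if "\<zeta> \<in> cball 0 r" for \<zeta>
    using L1(3) L1(4)[of w \<zeta>] w \<eta>1(2) that by auto
  obtain L2 \<delta>2 R2 where L2: "L2 > 0" "\<delta>2 > 0" "R2 > r"
    "\<And>w' \<zeta>. dist w w' < \<delta>2 \<Longrightarrow> \<zeta> \<in> ball 0 R2 \<Longrightarrow> x + \<zeta> *s w' \<in> S \<and> cmod (F w' \<zeta> - F w \<zeta>) \<le> L2 * dist w w'"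
    using line_perturbation[OF S f r wS] unfolding F_def by metis
  have hol2: "F w' holomorphic_on ball 0 R2" if "dist w w' < \<delta>2" for w'
    by (rule holF) (use L2(4) that in blast)
  have contF: "continuous_on (cball 0 r) (F w)"
    by (intro holomorphic_on_imp_continuous_on holF) (use wS in auto)
  \<comment> \<open>a lower bound for all distances of zeros to each other and to the circle; the element 1 only keeps the set nonempty\<close>
  define E where "E = {1} \<union> (\<lambda>\<zeta>. r - cmod \<zeta>) ` Z w \<union> (\<lambda>(\<zeta>, \<xi>). dist \<zeta> \<xi>) ` {p \<in> Z w \<times> Z w. fst p \<noteq> snd p}"
  have E: "finite E" "E \<noteq> {}" "\<And>e. e \<in> E \<Longrightarrow> e > 0"
    unfolding E_def using finZ[OF w] by (auto simp: Z_def)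
  define \<rho>0 where "\<rho>0 = Min E / 4"
  have \<rho>0: "\<rho>0 > 0" using E by (simp add: \<rho>0_def)
  have \<rho>0_le: "4 * \<rho>0 \<le> e" if "e \<in> E" for e
    using Min_le[OF E(1) that] by (simp add: \<rho>0_def)
  have disc: "ball \<zeta> (2 * \<rho>0) \<subseteq> ball 0 r" if "\<zeta> \<in> Z w" for \<zeta>
  proof
    fix \<xi> assume "\<xi> \<in> ball \<zeta> (2 * \<rho>0)"
    moreover have "4 * \<rho>0 \<le> r - cmod \<zeta>" using that by (intro \<rho>0_le) (auto simp: E_def)
    ultimately show "\<xi> \<in> ball 0 r"
      using norm_triangle_ineq2[of \<xi> \<zeta>] \<rho>0 by (simp add: dist_norm norm_minus_commute)
  qed
  have sep: "4 * \<rho>0 \<le> dist \<zeta> \<xi>" if "\<zeta> \<in> Z w" "\<xi> \<in> Z w" "\<zeta> \<noteq> \<xi>" for \<zeta> \<xi>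
    using that by (intro \<rho>0_le) (force simp: E_def)
  have order: "\<exists>C>0. \<exists>\<delta>>0. \<forall>z\<in>ball (x + \<zeta>0 *s w) \<delta>. cmod (f z) \<le> C * dist z (x + \<zeta>0 *s w) ^ m"
    if \<zeta>0: "\<zeta>0 \<in> Z w" and m: "zorder (F w) \<zeta>0 = int m" for \<zeta>0 m
  proof -
    have "m > 0" using pos[OF w \<zeta>0] m by simp
    have "bounded (F w ` cball 0 r)"
      by (intro compact_imp_bounded compact_continuous_image contF compact_cball)
    then obtain M where M: "\<And>\<zeta>. \<zeta> \<in> cball 0 r \<Longrightarrow> cmod (F w \<zeta>) \<le> M"
      unfolding bounded_iff by blast
    have sub0: "ball \<zeta>0 (2 * \<rho>0) \<subseteq> ball 0 R2" "ball \<zeta>0 (2 * \<rho>0) \<subseteq> cball 0 r"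
      using disc[OF \<zeta>0] L2(3) by force+
    have holw: "F w holomorphic_on ball \<zeta>0 (2 * \<rho>0)"
      by (rule holomorphic_on_subset[OF hol2 sub0(1)]) (use L2 in simp)
    define p where "p = \<zeta>0 + of_real \<rho>0"
    have p: "p \<in> ball \<zeta>0 (2 * \<rho>0)" "p \<noteq> \<zeta>0" "dist \<zeta>0 p < 4 * \<rho>0" using \<rho>0 by (auto simp: p_def dist_norm)
    have Fp: "F w p \<noteq> 0"
    proof
      assume "F w p = 0"
      then have "p \<in> Z w" using disc[OF \<zeta>0] p(1) by (auto simp: Z_def)
      then show False using sep[OF \<zeta>0] p by force
    qed
    have bnd: "2 * \<rho>0 > 0" "\<And>\<zeta>. \<zeta> \<in> ball \<zeta>0 (2 * \<rho>0) \<Longrightarrow> cmod (F w \<zeta>) \<le> M"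
      using \<rho>0 M sub0(2) by auto
    obtain C \<rho> where C: "0 < \<rho>" "\<rho> \<le> 2 * \<rho>0 / 4" "0 < C"
      "\<And>g e z w'. \<lbrakk>g holomorphic_on ball \<zeta>0 (2 * \<rho>0); \<And>\<zeta>. \<zeta> \<in> ball \<zeta>0 (2 * \<rho>0) \<Longrightarrow> cmod (g \<zeta> - F w \<zeta>) \<le> e; e \<le> 1;
       z \<in> ball \<zeta>0 \<rho>; zorder g z = int m; w' \<in> ball \<zeta>0 (2 * \<rho>0); g w' \<noteq> 0\<rbrakk> \<Longrightarrow> cmod (g \<zeta>0) \<le> C * e ^ m"
      by (rule norm_le_perturbed_multiple_zero[OF holw p(1) Fp m \<open>m > 0\<close> bnd])
        (assumption, (rule that; blast))
    define T where "T = cball 0 r - (\<Union>\<zeta>\<in>Z w. ball \<zeta> \<rho>)"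
    have "compact T" unfolding T_def
      by (intro compact_diff compact_cball open_UN ballI open_ball)
    moreover have "F w \<zeta> \<noteq> 0" if "\<zeta> \<in> T" for \<zeta>
    proof
      assume "F w \<zeta> = 0"
      moreover have "\<zeta> \<notin> sphere 0 r" using nz1[OF w] \<open>F w \<zeta> = 0\<close> by blast
      ultimately have "\<zeta> \<in> Z w" using that by (auto simp: T_def Z_def)
      then show False using that C(1) by (auto simp: T_def)
    qed
    moreover have "continuous_on T (F w)"
      by (rule continuous_on_subset[OF contF]) (auto simp: T_def)
    ultimately obtain k2 where k2: "k2 > 0" "\<And>\<zeta>. \<zeta> \<in> T \<Longrightarrow> k2 \<le> cmod (F w \<zeta>)"
      using compact_nonzero_lower_bound[of T "F w"] by blast
    have sphere_T: "sphere \<zeta> \<rho> \<subseteq> T" if \<zeta>: "\<zeta> \<in> Z w" for \<zeta>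
    proof
      fix \<xi> assume \<xi>: "\<xi> \<in> sphere \<zeta> \<rho>"
      then have "\<xi> \<in> ball \<zeta> (2 * \<rho>0)" using C(1,2) \<rho>0 by auto
      then have "\<xi> \<in> ball 0 r" using disc[OF \<zeta>] by blast
      moreover have "\<xi> \<notin> ball \<zeta>' \<rho>" if "\<zeta>' \<in> Z w" for \<zeta>'
      proof
        assume *: "\<xi> \<in> ball \<zeta>' \<rho>"
        then have "\<zeta>' \<noteq> \<zeta>" using \<xi> by auto
        then have "4 * \<rho>0 \<le> dist \<zeta> \<zeta>'" using sep \<zeta> that by metis
        then show False using * \<xi> C(1,2) \<rho>0 dist_triangle[of \<zeta> \<zeta>' \<xi>] by (simp add: dist_commute)
      qed
      ultimately show "\<xi> \<in> T" by (auto simp: T_def)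
    qed
    define \<delta>3 where "\<delta>3 = Min {\<delta>2, k2 / L2, 1 / L2, \<eta>1 - dist w0 w}"
    have \<delta>3: "\<delta>3 > 0" "\<delta>3 \<le> \<delta>2" "L2 * \<delta>3 \<le> k2" "L2 * \<delta>3 \<le> 1" "\<delta>3 \<le> \<eta>1 - dist w0 w"
    proof -
      have le: "\<delta>3 \<le> \<delta>2" "\<delta>3 \<le> k2 / L2" "\<delta>3 \<le> 1 / L2" "\<delta>3 \<le> \<eta>1 - dist w0 w"
        unfolding \<delta>3_def by (rule Min_le; simp)+
      show "\<delta>3 > 0" unfolding \<delta>3_def using L2 k2 w by (subst Min_gr_iff) auto
      show "\<delta>3 \<le> \<delta>2" "L2 * \<delta>3 \<le> k2" "L2 * \<delta>3 \<le> 1" "\<delta>3 \<le> \<eta>1 - dist w0 w"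
        using le L2(1) by (auto simp: field_simps)
    qed
    have key: "cmod (F w' \<zeta>0) \<le> C * (L2 * dist w w') ^ m" if w': "dist w w' < \<delta>3" for w'
    proof -
      have w'1: "dist w0 w' < \<eta>1" using dist_triangle[of w0 w' w] w' \<delta>3 by simp
      have w'2: "dist w w' < \<delta>2" using w' \<delta>3 by simp
      have close: "cmod (F w' \<zeta> - F w \<zeta>) \<le> L2 * dist w w'" if "\<zeta> \<in> ball 0 R2" for \<zeta>
        using L2(4)[OF w'2 that] by blast
      have Lk: "L2 * dist w w' < k2" "L2 * dist w w' \<le> 1"
        using mult_strict_left_mono[OF w' L2(1)] \<delta>3(3,4) by linarith+
      define P where "P \<zeta> = {\<xi> \<in> ball \<zeta> \<rho>. F w' \<xi> = 0}" for \<zeta>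
      have P: "finite (P \<zeta>)" "(\<Sum>\<xi>\<in>P \<zeta>. zorder (F w') \<xi>) = zorder (F w) \<zeta>" if \<zeta>: "\<zeta> \<in> Z w" for \<zeta>
      proof -
        have subR: "ball \<zeta> (2 * \<rho>0) \<subseteq> ball 0 R2" using disc[OF \<zeta>] L2(3) by force
        have holg: "F w' holomorphic_on ball \<zeta> (2 * \<rho>0)" "F w holomorphic_on ball \<zeta> (2 * \<rho>0)"
          using hol2 w'2 L2(2) by (auto intro!: holomorphic_on_subset[OF _ subR])
        have less: "cmod (F w' \<xi> - F w \<xi>) < cmod (F w \<xi>)" if \<xi>: "\<xi> \<in> sphere \<zeta> \<rho>" for \<xi>
        proof -
          have "\<xi> \<in> ball \<zeta> (2 * \<rho>0)" using \<xi> C(1,2) \<rho>0 by auto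
          then have "\<xi> \<in> ball 0 R2" using subR by blast
          then show ?thesis using close[of \<xi>] Lk k2(2)[of \<xi>] sphere_T[OF \<zeta>] \<xi> by force
        qed
        have "\<rho> < 2 * \<rho>0" using C(1,2) \<rho>0 by simp
        note rou = rouche_disc[OF C(1) this holg(2,1) less]
        show "finite (P \<zeta>)" unfolding P_def by (rule rou(2))
        have "{\<xi> \<in> ball \<zeta> \<rho>. F w \<xi> = 0} = {\<zeta>}"
        proof (intro equalityI subsetI)
          fix \<xi> assume \<xi>: "\<xi> \<in> {\<xi> \<in> ball \<zeta> \<rho>. F w \<xi> = 0}"
          then have "\<xi> \<in> ball \<zeta> (2 * \<rho>0)" using C(1,2) \<rho>0 by auto
          then have "\<xi> \<in> Z w" using disc[OF \<zeta>] \<xi> by (auto simp: Z_def)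
          then show "\<xi> \<in> {\<zeta>}" using sep[OF \<zeta>, of \<xi>] \<xi> C(1,2) \<rho>0 by force
        qed (use \<zeta> C in \<open>auto simp: Z_def\<close>)
        then show "(\<Sum>\<xi>\<in>P \<zeta>. zorder (F w') \<xi>) = zorder (F w) \<zeta>"
          using rou(3) unfolding P_def by simp
      qed
      \<comment> \<open>no small disc loses its zero, and by maximality there is no room for a second one\<close>
      have card_P: "card (P \<zeta>) \<ge> 1" if \<zeta>: "\<zeta> \<in> Z w" for \<zeta>
      proof (rule ccontr)
        assume "\<not> 1 \<le> card (P \<zeta>)"
        then have "P \<zeta> = {}" using P(1)[OF \<zeta>] by (simp add: not_le)
        then show False using P(2)[OF \<zeta>] pos[OF w \<zeta>] by simp
      qed
      have "card (P \<zeta>0) + (\<Sum>\<zeta>\<in>Z w - {\<zeta>0}. 1) \<le> card (P \<zeta>0) + (\<Sum>\<zeta>\<in>Z w - {\<zeta>0}. card (P \<zeta>))"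
        by (intro add_left_mono sum_mono) (use card_P in auto)
      also have "\<dots> = (\<Sum>\<zeta>\<in>Z w. card (P \<zeta>))"
        using sum.remove[OF finZ[OF w] \<zeta>0, of "\<lambda>\<zeta>. card (P \<zeta>)"] by simp
      also have "\<dots> = card (\<Union>\<zeta>\<in>Z w. P \<zeta>)"
      proof (rule card_UN_disjoint[symmetric])
        show "\<forall>\<zeta>\<in>Z w. \<forall>\<xi>\<in>Z w. \<zeta> \<noteq> \<xi> \<longrightarrow> P \<zeta> \<inter> P \<xi> = {}"
        proof (intro ballI impI, rule ccontr)
          fix \<zeta> \<xi> assume *: "\<zeta> \<in> Z w" "\<xi> \<in> Z w" "\<zeta> \<noteq> \<xi>" "P \<zeta> \<inter> P \<xi> \<noteq> {}"
          then obtain t where "dist \<zeta> t < \<rho>" "dist \<xi> t < \<rho>" by (auto simp: P_def)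
          then show False using sep[OF *(1-3)] dist_triangle2[of \<zeta> \<xi> t] C(1,2) \<rho>0 by simp
        qed
      qed (use finZ[OF w] P in auto)
      also have "\<dots> \<le> card (Z w')"
      proof (rule card_mono[OF finZ[OF w'1]])
        show "(\<Union>\<zeta>\<in>Z w. P \<zeta>) \<subseteq> Z w'"
        proof
          fix \<xi> assume "\<xi> \<in> (\<Union>\<zeta>\<in>Z w. P \<zeta>)"
          then obtain \<zeta> where "\<zeta> \<in> Z w" "\<xi> \<in> ball \<zeta> \<rho>" "F w' \<xi> = 0" by (auto simp: P_def)
          moreover from this have "\<xi> \<in> ball \<zeta> (2 * \<rho>0)" using C(1,2) \<rho>0 by auto
          ultimately show "\<xi> \<in> Z w'" using disc[of \<zeta>] by (auto simp: Z_def)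
        qed
      qed
      also have "\<dots> \<le> card (Z w)" by (rule max[OF w'1])
      finally have "card (P \<zeta>0) \<le> 1"
        using card_Suc_Diff1[OF finZ[OF w] \<zeta>0] unfolding card_eq_sum by linarith
      then have "card (P \<zeta>0) = 1" using card_P[OF \<zeta>0] by simp
      then obtain z where z: "P \<zeta>0 = {z}" using card_1_singletonE by blast
      then have zm: "zorder (F w') z = int m" using P(2)[OF \<zeta>0] m by simp
      have zb: "z \<in> ball \<zeta>0 \<rho>" using z by (auto simp: P_def)
      define q where "q = \<zeta>0 + of_real \<rho>"
      have q: "q \<in> sphere \<zeta>0 \<rho>" "q \<in> ball \<zeta>0 (2 * \<rho>0)" using C(1,2) \<rho>0 by (auto simp: q_def dist_norm)
      have "q \<in> ball 0 R2" using q(2) sub0 by blast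
      then have "cmod (F w' q - F w q) < cmod (F w q)"
        using close[of q] Lk k2(2)[of q] sphere_T[OF \<zeta>0] q(1) by force
      then have "F w' q \<noteq> 0" by auto
      show ?thesis
      proof (rule C(4)[OF _ _ Lk(2) zb zm q(2) \<open>F w' q \<noteq> 0\<close>])
        show "F w' holomorphic_on ball \<zeta>0 (2 * \<rho>0)"
          by (rule holomorphic_on_subset[OF hol2[OF w'2] sub0(1)])
        show "cmod (F w' \<zeta> - F w \<zeta>) \<le> L2 * dist w w'" if "\<zeta> \<in> ball \<zeta>0 (2 * \<rho>0)" for \<zeta>
          by (rule close) (use that sub0 in blast)
      qed
    qed
    have "x + 0 *s w = x" by (simp add: vec_eq_iff)
    then have "F w 0 \<noteq> 0" using x by (simp add: F_def)
    then have \<zeta>0_nz: "\<zeta>0 \<noteq> 0" using \<zeta>0 by (auto simp: Z_def)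
    define y where "y = x + \<zeta>0 *s w"
    have "cmod (f z) \<le> C * (L2 / cmod \<zeta>0) ^ m * dist z y ^ m" if "z \<in> ball y (\<delta>3 * cmod \<zeta>0)" for z
    proof -
      define w' where "w' = w + (1 / \<zeta>0) *s (z - y)"
      have xw': "x + \<zeta>0 *s w' = z"
        using \<zeta>0_nz by (simp add: w'_def y_def vec_eq_iff field_simps)
      have d: "dist w w' = dist z y / cmod \<zeta>0"
        by (simp add: w'_def dist_norm norm_vector_scalar_mult norm_divide
            del: vector_ssub_ldistrib)
      also have "\<dots> < \<delta>3" using that \<zeta>0_nz by (simp add: field_simps dist_commute)
      finally have "cmod (F w' \<zeta>0) \<le> C * (L2 * dist w w') ^ m" by (rule key)
      then show ?thesis
        by (simp add: F_def xw' d power_mult_distrib power_divide mult.assoc)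
    qed
    moreover have "C * (L2 / cmod \<zeta>0) ^ m > 0" "\<delta>3 * cmod \<zeta>0 > 0" using C L2 \<zeta>0_nz \<delta>3 by auto
    ultimately show ?thesis unfolding y_def by blast
  qed
  show ?thesis
  proof (rule that[of w])
    show "dist w0 w < \<eta>" using w \<eta>1 by simp
    show "x + \<zeta> *s w \<in> S" if "\<zeta> \<in> cball 0 r" for \<zeta> by (rule wS[OF that])
    show "f (x + \<zeta> *s w) \<noteq> 0" if "\<zeta> \<in> sphere 0 r" for \<zeta> using nz1[OF w that] by (simp add: F_def)
    show "\<exists>C>0. \<exists>\<delta>>0. \<forall>z\<in>ball (x + \<zeta> *s w) \<delta>. cmod (f z) \<le> C * dist z (x + \<zeta> *s w) ^ m"
      if "\<zeta> \<in> ball 0 r" "f (x + \<zeta> *s w) = 0" "zorder (\<lambda>\<zeta>. f (x + \<zeta> *s w)) \<zeta> = int m" for \<zeta> m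
      by (rule order) (use that in \<open>auto simp: F_def[abs_def] Z_def\<close>)
  qed
qed


section \<open>Plurisubharmonic functions bounded by the logarithm of a holomorphic function\<close>

lemma usc_on_compose:
  assumes "usc_on S u" "continuous_on A g" "\<And>t. t \<in> A \<Longrightarrow> g t \<in> S"
  shows "usc_on A (\<lambda>t. u (g t))"
  unfolding usc_on_def
proof
  fix c
  obtain T where T: "open T" "{x \<in> S. u x < c} = S \<inter> T"
    using assms(1) unfolding usc_on_def openin_open by blast
  have "{t \<in> A. u (g t) < c} = A \<inter> g -` T" using T(2) assms(3) by blast
  then show "openin (top_of_set A) {t \<in> A. u (g t) < c}"
    using continuous_openin_preimage_gen[OF assms(2) T(1)] by simp
qed

lemma usc_on_affine:
  fixes u :: "'a::topological_space \<Rightarrow> ereal"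
  assumes "usc_on S u" "c > 0"
  shows "usc_on S (\<lambda>x. ereal c * u x - ereal e)"
  unfolding usc_on_def
proof
  fix d
  have "(ereal c * t - ereal e < d) = (t < (d + ereal e) / ereal c)" for t :: ereal
    using \<open>c > 0\<close> by (cases t; cases d) (auto simp: field_simps)
  then show "openin (top_of_set S) {x \<in> S. ereal c * u x - ereal e < d}"
    using assms(1) unfolding usc_on_def by simp
qed

lemma psh_Cn_subset:
  assumes "psh_Cn S u" "T \<subseteq> S"
  shows "psh_Cn T u"
proof -
  have "usc_on S u" using assms(1) unfolding psh_Cn_def by blast
  then have "usc_on T (\<lambda>x. u x)" by (rule usc_on_compose) (use assms(2) in auto)
  moreover have "u a \<le> circle_mean (\<lambda>\<zeta>. u (a + \<zeta> *s w))"
    if "a \<in> T" "\<forall>\<zeta>. cmod \<zeta> \<le> 1 \<longrightarrow> a + \<zeta> *s w \<in> T" for a w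
    using assms that unfolding psh_Cn_def by (meson subsetD)
  moreover have "\<forall>z\<in>T. u z < \<infinity>" using assms unfolding psh_Cn_def by blast
  ultimately show ?thesis unfolding psh_Cn_def by simp
qed

lemma psh_Cn_affine:
  assumes u: "psh_Cn S u" and neg: "\<And>z. z \<in> S \<Longrightarrow> u z \<le> 0" and c: "c > 0" and e: "e \<ge> 0"
  shows "psh_Cn S (\<lambda>z. ereal c * u z - ereal e)"
  unfolding psh_Cn_def
proof (intro conjI ballI allI impI)
  fix z assume "z \<in> S"
  then show "ereal c * u z - ereal e < \<infinity>" using neg[of z] c by (cases "u z") auto
next
  show "usc_on S (\<lambda>x. ereal c * u x - ereal e)"
    using u c unfolding psh_Cn_def by (intro usc_on_affine) auto
next
  fix a w assume a: "a \<in> S" and sub: "\<forall>\<zeta>. cmod \<zeta> \<le> 1 \<longrightarrow> a + \<zeta> *s w \<in> S"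
  have "usc_on S u" using u unfolding psh_Cn_def by blast
  then have "usc_on (sphere 0 1) (\<lambda>\<zeta>. u (a + \<zeta> *s w))"
    by (rule usc_on_compose) (use sub in \<open>auto intro!: continuous_intros\<close>)
  moreover have "u (a + cis \<theta> *s w) \<le> 0" for \<theta> using sub neg by simp
  ultimately have "circle_mean (\<lambda>\<zeta>. ereal c * u (a + \<zeta> *s w) - ereal e)
      = ereal c * circle_mean (\<lambda>\<zeta>. u (a + \<zeta> *s w)) - ereal e"
    using c e by (intro circle_mean_affine)
  moreover have "u a \<le> circle_mean (\<lambda>\<zeta>. u (a + \<zeta> *s w))"
    using u a sub unfolding psh_Cn_def by blast
  ultimately show "ereal c * u a - ereal e \<le> circle_mean (\<lambda>\<zeta>. ereal c * u (a + \<zeta> *s w) - ereal e)"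
    using c by (auto intro!: ereal_minus_mono ereal_mult_left_mono)
qed

lemma psh_Cn_mean_on_line:
  assumes "psh_Cn S u" "\<And>\<xi>. \<xi> \<in> cball \<zeta> \<rho> \<Longrightarrow> x + \<xi> *s w \<in> S" "\<rho> \<ge> 0"
  shows "u (x + \<zeta> *s w) \<le> circle_mean (\<lambda>\<xi>. u (x + (\<zeta> + of_real \<rho> * \<xi>) *s w))"
proof -
  have eq: "(x + \<zeta> *s w) + \<xi> *s (of_real \<rho> *s w) = x + (\<zeta> + of_real \<rho> * \<xi>) *s w" for \<xi>
    by (simp add: vec_eq_iff algebra_simps)
  have "x + \<zeta> *s w \<in> S" using assms(2)[of \<zeta>] assms(3) by simp
  moreover have "(x + \<zeta> *s w) + \<xi> *s (of_real \<rho> *s w) \<in> S" if "cmod \<xi> \<le> 1" for \<xi>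
    unfolding eq using that assms(3)
    by (intro assms(2)) (simp add: dist_norm norm_mult mult_left_le)
  ultimately show ?thesis
    using assms(1) unfolding psh_Cn_def eq[symmetric] by blast
qed

lemma ereal_le_from_scaled_le:
  assumes approx: "\<And>t::real. t > 0 \<Longrightarrow> ereal (1 + t) * a - ereal t \<le> b" and "a \<le> 0"
  shows "a \<le> b"
proof (cases a)
  case (real r)
  show ?thesis
  proof (cases b)
    case b: (real b')
    have "r \<le> b' + e" if "e > 0" for e
    proof -
      define t where "t = e / (\<bar>r\<bar> + 1)"
      have t: "t > 0" "t * (\<bar>r\<bar> + 1) = e" using that by (auto simp: t_def)
      have "(1 + t) * r - t \<le> b'" using approx[OF t(1)] real b by simp
      moreover have "- (t * r) \<le> t * \<bar>r\<bar>" using t(1) by (simp add: abs_if)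
      ultimately show ?thesis using t(2) by (simp add: algebra_simps)
    qed
    then have "r \<le> b'" by (rule field_le_epsilon)
    then show ?thesis using real b by simp
  next
    case MInf
    then show ?thesis using approx[of 1] real by simp
  qed simp
qed (use assms in auto)

text \<open>
  Let \<open>F\<close> be the restriction of \<open>f\<close> to the line. Since \<open>v \<le>
  m ln |\<zeta> - \<zeta>0| + O(1)\<close> at a zero of order \<open>m\<close>, the function
  \<open>(1 + t) v - ln |F|\<close> tends to \<open>-\<infinity>\<close> there. The maximum
  principle on the disc with small discs around the zeros removed bounds it by \<open>- ln
  k\<close>, its bound on the circle, where \<open>v \<le> 0\<close>. The factor \<open>1 +
  t\<close> turns a mere upper bound near the zeros into the required one.
\<close>

lemma psh_le_log_on_transversal_line:
  fixes f :: "complex ^ 'n \<Rightarrow> complex"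
  assumes S: "open S" and f: "holomorphic_Cn S f" and v: "psh_Cn S v"
    and neg: "\<And>z. z \<in> S \<Longrightarrow> v z \<le> 0" and r: "r > 0"
    and sub: "\<And>\<zeta>. \<zeta> \<in> cball 0 r \<Longrightarrow> x + \<zeta> *s w \<in> S"
    and lower: "\<And>\<zeta>. \<zeta> \<in> sphere 0 r \<Longrightarrow> k \<le> cmod (f (x + \<zeta> *s w))" and k: "k > 0"
    and x: "f x \<noteq> 0"
    and order: "\<And>\<zeta> m. \<lbrakk>\<zeta> \<in> ball 0 r; f (x + \<zeta> *s w) = 0; zorder (\<lambda>\<zeta>. f (x + \<zeta> *s w)) \<zeta> = int m; m > 0\<rbrakk> \<Longrightarrow>
       \<exists>C. \<exists>\<delta>>0. \<forall>z\<in>ball (x + \<zeta> *s w) \<delta> - {x + \<zeta> *s w}. v z \<le> ereal (real m * ln (dist z (x + \<zeta> *s w)) + C)"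
  shows "v x \<le> ereal (ln (cmod (f x)) - ln k)"
proof (rule ereal_le_from_scaled_le)
  have x0: "x + 0 *s w = x" by (simp add: vec_eq_iff)
  show "v x \<le> 0" using neg sub[of 0] r x0 by simp
  fix t :: real assume t: "t > 0"
  define F where "F \<zeta> = f (x + \<zeta> *s w)" for \<zeta>
  obtain R where R: "R > r" "ball 0 R \<subseteq> {\<zeta>. x + \<zeta> *s w \<in> S}"
    using cball_subset_open_imp_ball[OF open_line_preimage[OF S, of x w], of 0 r] sub r by blast
  have holF: "F holomorphic_on ball 0 R"
    unfolding F_def by (rule holomorphic_Cn_on_line[OF f]) (use R in auto)
  have F0: "F 0 \<noteq> 0" using x x0 by (simp add: F_def)
  have zR: "0 \<in> ball (0::complex) R" using R r by simp
  define Z where "Z = {\<zeta> \<in> cball 0 r. F \<zeta> = 0}"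
  have finZ: "finite Z" unfolding Z_def by (rule finite_zeros_cball[OF holF R(1) zR F0])
  have Zball: "\<zeta> \<in> ball 0 r" if "\<zeta> \<in> Z" for \<zeta>
    using lower[of \<zeta>] k that unfolding Z_def F_def by fastforce
  define H where "H \<zeta> = - ln (cmod (F \<zeta>)) + ln k" for \<zeta>
  define s where "s \<zeta> = ereal (1 + t) * v (x + \<zeta> *s w) - ereal 0" for \<zeta>
  have local: "\<exists>\<tau>>0. \<forall>\<zeta>\<in>ball \<zeta>0 \<tau> - {\<zeta>0}. s \<zeta> + ereal (H \<zeta>) \<le> 0" if \<zeta>0: "\<zeta>0 \<in> Z" for \<zeta>0
  proof -
    have \<zeta>R: "\<zeta>0 \<in> ball 0 R" "F \<zeta>0 = 0" using Zball[OF \<zeta>0] R \<zeta>0 by (auto simp: Z_def)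
    have "zorder F \<zeta>0 > 0" by (rule zorder_zero_pos[OF holF \<zeta>R(1) zR F0 \<zeta>R(2)])
    then obtain m where m: "zorder F \<zeta>0 = int m" "m > 0"
      by (metis of_nat_0_less_iff pos_int_cases)
    obtain h where h: "h holomorphic_on ball 0 R" "h \<zeta>0 \<noteq> 0"
      "\<And>\<zeta>. \<zeta> \<in> ball 0 R \<Longrightarrow> F \<zeta> = h \<zeta> * (\<zeta> - \<zeta>0) ^ m"
      by (rule factor_zero[OF holF \<zeta>R(1) zR F0 m(1)]) blast
    define y where "y = x + \<zeta>0 *s w"
    obtain C \<delta> where C: "\<delta> > 0" "\<And>z. z \<in> ball y \<delta> - {y} \<Longrightarrow> v z \<le> ereal (real m * ln (dist z y) + C)"
      using order[OF Zball[OF \<zeta>0], of m] \<zeta>R(2) m unfolding F_def y_def by metis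
    have "w \<noteq> 0"
    proof
      assume "w = 0"
      then have "x + \<zeta>0 *s w = x" by (simp add: vec_eq_iff)
      then show False using \<zeta>R(2) x unfolding F_def by metis
    qed
    then have w: "norm w > 0" by simp
    define b where "b = cmod (h \<zeta>0) / 2"
    have b: "b > 0" using h(2) by (simp add: b_def)
    have "isCont h \<zeta>0"
      using continuous_on_eq_continuous_at[OF open_ball] holomorphic_on_imp_continuous_on[OF h(1)] \<zeta>R(1)
      by blast
    then have "((\<lambda>\<zeta>. cmod (h \<zeta>)) \<longlongrightarrow> cmod (h \<zeta>0)) (at \<zeta>0)"
      by (intro tendsto_norm) (simp add: isCont_def)
    then have "eventually (\<lambda>\<zeta>. b < cmod (h \<zeta>)) (at \<zeta>0)"
      by (rule order_tendstoD) (use h(2) in \<open>simp add: b_def\<close>)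
    moreover have "eventually (\<lambda>\<zeta>. \<zeta> \<in> ball 0 R) (at \<zeta>0)"
      using \<zeta>R(1) by (intro eventually_at_in_open') auto
    moreover have "eventually (\<lambda>\<zeta>. cmod (\<zeta> - \<zeta>0) < \<delta> / norm w) (at \<zeta>0)"
      using C(1) w unfolding eventually_at by (intro exI[of _ "\<delta> / norm w"]) (simp add: dist_norm)
    \<comment> \<open>the constant that \<open>t m ln |\<zeta> - \<zeta>0|\<close> has to outweigh\<close>
    moreover define D where "D = (1 + t) * (real m * ln (norm w) + C) - ln b + ln k"
    have "eventually (\<lambda>\<zeta>. cmod (\<zeta> - \<zeta>0) < exp (- D / (t * real m))) (at \<zeta>0)"
      unfolding eventually_at by (intro exI[of _ "exp (- D / (t * real m))"]) (simp add: dist_norm)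
    ultimately have "eventually (\<lambda>\<zeta>. s \<zeta> + ereal (H \<zeta>) \<le> 0) (at \<zeta>0)"
      using eventually_neq_at_within[of \<zeta>0 \<zeta>0 UNIV]
    proof eventually_elim
      case (elim \<zeta>)
      define d where "d = cmod (\<zeta> - \<zeta>0)"
      have d: "d > 0" using elim by (simp add: d_def)
      have dist: "dist (x + \<zeta> *s w) y = d * norm w"
      proof -
        have "(x + \<zeta> *s w) - y = (\<zeta> - \<zeta>0) *s w" by (simp add: y_def vec_eq_iff algebra_simps)
        then show ?thesis unfolding dist_norm d_def by (simp only: norm_vector_scalar_mult)
      qed
      have "x + \<zeta> *s w \<in> ball y \<delta> - {y}"
        using dist elim(3) d w by (auto simp: dist_commute d_def field_simps)
      from C(2)[OF this] have vle: "v (x + \<zeta> *s w) \<le> ereal (real m * ln (d * norm w) + C)"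
        by (simp add: dist)
      have "x + \<zeta> *s w \<in> S" using elim(2) R by auto
      then have vneg: "v (x + \<zeta> *s w) \<le> 0" by (rule neg)
      have "cmod (F \<zeta>) = cmod (h \<zeta>) * d ^ m"
        using h(3)[OF elim(2)] by (simp add: d_def norm_mult norm_power)
      then have "ln (cmod (F \<zeta>)) = ln (cmod (h \<zeta>)) + real m * ln d"
        using d order_less_trans[OF b elim(1)] by (simp add: ln_mult ln_realpow)
      moreover have "ln b < ln (cmod (h \<zeta>))" using elim(1) b by (subst ln_less_cancel_iff) auto
      ultimately have Hle: "H \<zeta> \<le> - (ln b + real m * ln d) + ln k" by (simp add: H_def)
      have "d < exp (- D / (t * real m))" using elim(4) by (simp add: d_def)
      then have "ln d < ln (exp (- D / (t * real m)))" using d by (subst ln_less_cancel_iff) auto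
      then have "ln d < - D / (t * real m)" by simp
      then have "t * real m * ln d < - D" using t m(2) by (simp add: field_simps)
      then have "(1 + t) * (real m * ln (d * norm w) + C) - (ln b + real m * ln d) + ln k \<le> 0"
        using d w by (simp add: D_def ln_mult algebra_simps)
      then have fin: "(1 + t) * (real m * ln (d * norm w) + C) + H \<zeta> \<le> 0" using Hle by simp
      have "s \<zeta> \<le> ereal ((1 + t) * (real m * ln (d * norm w) + C))"
        using vle vneg t unfolding s_def by (cases "v (x + \<zeta> *s w)") (auto intro: mult_left_mono)
      then have "s \<zeta> + ereal (H \<zeta>) \<le> ereal ((1 + t) * (real m * ln (d * norm w) + C)) + ereal (H \<zeta>)"
        by (rule add_right_mono)
      also have "\<dots> \<le> 0" using fin by (simp add: zero_ereal_def)
      finally show ?case .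
    qed
    then obtain d where "d > 0" "\<And>\<zeta>. \<zeta> \<noteq> \<zeta>0 \<Longrightarrow> dist \<zeta> \<zeta>0 < d \<Longrightarrow> s \<zeta> + ereal (H \<zeta>) \<le> 0"
      unfolding eventually_at by auto
    then show ?thesis by (intro exI[of _ d]) (auto simp: dist_commute)
  qed
  obtain \<tau> where \<tau>: "\<And>\<zeta>. \<zeta> \<in> Z \<Longrightarrow> \<tau> \<zeta> > 0"
    "\<And>\<zeta> \<xi>. \<zeta> \<in> Z \<Longrightarrow> \<xi> \<in> ball \<zeta> (\<tau> \<zeta>) - {\<zeta>} \<Longrightarrow> s \<xi> + ereal (H \<xi>) \<le> 0"
  proof -
    from local have "\<forall>\<zeta>0\<in>Z. \<exists>\<tau>. \<tau> > 0 \<and> (\<forall>\<zeta>\<in>ball \<zeta>0 \<tau> - {\<zeta>0}. s \<zeta> + ereal (H \<zeta>) \<le> 0)"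
      by blast
    from bchoice[OF this] show ?thesis using that by blast
  qed
  \<comment> \<open>smaller than \<open>\<tau> \<zeta>\<close>, so that the rims of the removed discs lie in \<open>B\<close>, and small enough to keep the point 0\<close>
  define \<sigma> where "\<sigma> \<zeta> = min (\<tau> \<zeta> / 2) (cmod \<zeta> / 2)" for \<zeta>
  have \<sigma>: "\<sigma> \<zeta> > 0" "\<sigma> \<zeta> < \<tau> \<zeta>" "\<sigma> \<zeta> < cmod \<zeta>" if "\<zeta> \<in> Z" for \<zeta>
  proof -
    have "\<zeta> \<noteq> 0" using that F0 by (auto simp: Z_def)
    then show "\<sigma> \<zeta> > 0" "\<sigma> \<zeta> < \<tau> \<zeta>" "\<sigma> \<zeta> < cmod \<zeta>" using \<tau>(1)[OF that] by (auto simp: \<sigma>_def min_def)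
  qed
  define S' where "S' = cball 0 r - (\<Union>\<zeta>\<in>Z. ball \<zeta> (\<sigma> \<zeta>))"
  define B where "B = sphere 0 r \<union> (\<Union>\<zeta>\<in>Z. ball \<zeta> (\<tau> \<zeta>))"
  have S'sub: "S' \<subseteq> cball 0 r" by (auto simp: S'_def)
  have nz: "F \<zeta> \<noteq> 0" if "\<zeta> \<in> S'" for \<zeta>
    using that \<sigma>(1)[of \<zeta>] by (auto simp: S'_def Z_def)
  have pv: "psh_Cn S (\<lambda>z. ereal (1 + t) * v z - ereal 0)"
    by (rule psh_Cn_affine[OF v neg]) (use t in auto)
  have "s 0 + ereal (H 0) \<le> 0"
  proof (rule max_principle[where S = S' and B = B])
    show "compact S'" unfolding S'_def by (intro compact_diff compact_cball open_UN ballI open_ball)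
    show "usc_on S' s" unfolding s_def
    proof (rule usc_on_compose[where u = "\<lambda>z. ereal (1 + t) * v z - ereal 0"])
      show "usc_on S (\<lambda>z. ereal (1 + t) * v z - ereal 0)" using pv unfolding psh_Cn_def by blast
    qed (use S'sub sub in \<open>auto intro!: continuous_intros\<close>)
    have "continuous_on S' F"
      using S'sub R by (intro holomorphic_on_imp_continuous_on holomorphic_on_subset[OF holF]) auto
    then show "continuous_on S' H" unfolding H_def
      by (intro continuous_intros) (use nz in auto)
    show "s \<zeta> \<le> 0" if "\<zeta> \<in> S'" for \<zeta>
    proof -
      have "v (x + \<zeta> *s w) \<le> 0" by (intro neg sub) (use that S'sub in blast)
      then show ?thesis unfolding s_def using t by (cases "v (x + \<zeta> *s w)") (auto simp: zero_ereal_def mult_nonneg_nonpos)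
    qed
    show "s \<zeta> + ereal (H \<zeta>) \<le> 0" if \<zeta>: "\<zeta> \<in> S' \<inter> B" for \<zeta>
    proof (cases "\<zeta> \<in> sphere 0 r")
      case True
      have "k \<le> cmod (F \<zeta>)" using lower[OF True] by (simp add: F_def)
      then have "ln k \<le> ln (cmod (F \<zeta>))" using k by (subst ln_le_cancel_iff) auto
      then have "H \<zeta> \<le> 0" by (simp add: H_def)
      moreover have "v (x + \<zeta> *s w) \<le> 0" by (intro neg sub) (use True in auto)
      then have "s \<zeta> \<le> 0" unfolding s_def using t by (cases "v (x + \<zeta> *s w)") (auto simp: zero_ereal_def mult_nonneg_nonpos)
      ultimately show ?thesis by (cases "s \<zeta>") auto
    next
      case False
      then obtain \<zeta>' where "\<zeta>' \<in> Z" "\<zeta> \<in> ball \<zeta>' (\<tau> \<zeta>')"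
        using \<zeta> False unfolding B_def by blast
      moreover from this have "\<zeta> \<noteq> \<zeta>'" using \<zeta> nz by (auto simp: Z_def)
      ultimately show ?thesis using \<tau>(2) by blast
    qed
    have "0 \<notin> ball \<zeta> (\<sigma> \<zeta>)" if "\<zeta> \<in> Z" for \<zeta> using \<sigma>(3)[OF that] by simp
    then show "0 \<in> S'" using r by (auto simp: S'_def)
    fix \<zeta> assume \<zeta>: "\<zeta> \<in> S' - B"
    define O' where "O' = ball 0 r - (\<Union>\<zeta>\<in>Z. cball \<zeta> (\<sigma> \<zeta>))"
    have "open O'" unfolding O'_def by (intro open_Diff closed_UN finZ) auto
    moreover have "\<zeta> \<in> O'"
      using \<zeta> \<sigma>(2) by (fastforce simp: S'_def B_def O'_def)
    ultimately obtain e where e: "e > 0" "ball \<zeta> e \<subseteq> O'" using openE by blast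
    have OS: "O' \<subseteq> S'" unfolding O'_def S'_def by force
    show "\<exists>\<rho>>0. cball \<zeta> \<rho> \<subseteq> S' \<and>
        s \<zeta> \<le> circle_mean (\<lambda>\<xi>. s (\<zeta> + of_real \<rho> * \<xi>)) \<and>
        ((\<lambda>\<theta>. H (\<zeta> + of_real \<rho> * cis \<theta>)) has_integral 2*pi * H \<zeta>) {0..2*pi}"
    proof (intro exI[of _ "e / 2"] conjI)
      have "cball \<zeta> (e / 2) \<subseteq> ball \<zeta> e" using e by auto
      then show sub1: "cball \<zeta> (e / 2) \<subseteq> S'" using e OS by blast
      show "s \<zeta> \<le> circle_mean (\<lambda>\<xi>. s (\<zeta> + of_real (e / 2) * \<xi>))"
        unfolding s_def
      proof (rule psh_Cn_mean_on_line[OF pv])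
        show "x + \<xi> *s w \<in> S" if "\<xi> \<in> cball \<zeta> (e / 2)" for \<xi>
          by (rule sub) (use that sub1 S'sub in blast)
      qed (use e in auto)
      have "F holomorphic_on ball \<zeta> e"
        using e OS S'sub R by (intro holomorphic_on_subset[OF holF]) force
      moreover have "F \<xi> \<noteq> 0" if "\<xi> \<in> ball \<zeta> e" for \<xi> using that e OS nz by blast
      ultimately have "((\<lambda>\<theta>. ln (cmod (F (\<zeta> + of_real (e / 2) * cis \<theta>)))) has_integral 2*pi * ln (cmod (F \<zeta>))) {0..2*pi}"
        using e by (intro mean_value_ln_norm) auto
      from has_integral_add[OF has_integral_neg[OF this] has_integral_const_real[of "ln k" 0 "2*pi"]]
      show "((\<lambda>\<theta>. H (\<zeta> + of_real (e / 2) * cis \<theta>)) has_integral 2*pi * H \<zeta>) {0..2*pi}"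
        unfolding H_def by (simp add: algebra_simps)
    qed (use e in auto)
  qed
  then have "ereal (1 + t) * v x + ereal (H 0) \<le> 0" by (simp add: s_def x0)
  then have "ereal (1 + t) * v x \<le> ereal (ln (cmod (f x)) - ln k)"
    by (cases "ereal (1 + t) * v x") (auto simp: H_def F_def x0)
  then show "ereal (1 + t) * v x - ereal t \<le> ereal (ln (cmod (f x)) - ln k)"
    using t by (cases "ereal (1 + t) * v x") auto
qed

text \<open>
  Some line through \<open>a\<close> carries a circle on which \<open>f\<close> has no zero. The
  lower bound \<open>k\<close> of \<open>|f|\<close> on this circle persists, up to a factor 2,
  for all nearby base points \<open>x\<close> and directions \<open>w\<close>; hence the
  constant obtained from a line through \<open>x\<close> does not depend on \<open>x\<close>,
  although the line does.
\<close>

lemma psh_le_log_holomorphic: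
  fixes f :: "complex ^ 'n \<Rightarrow> complex"
  assumes S: "open S" and f: "holomorphic_Cn S f" and v: "psh_Cn S v"
    and neg: "\<And>z. z \<in> S \<Longrightarrow> v z \<le> 0" and a: "a \<in> S"
    and nontrivial: "\<And>e. e > 0 \<Longrightarrow> \<exists>z\<in>ball a e. f z \<noteq> 0"
    and order: "\<And>y m C \<delta>. \<lbrakk>y \<in> S; f y = 0; m > 0; C > 0; \<delta> > 0;
         \<And>z. z \<in> ball y \<delta> \<Longrightarrow> cmod (f z) \<le> C * dist z y ^ m\<rbrakk> \<Longrightarrow>
       \<exists>C. \<exists>\<delta>>0. \<forall>z\<in>ball y \<delta> - {y}. v z \<le> ereal (real m * ln (dist z y) + C)"
  obtains C \<delta> where "\<delta> > 0" "\<And>x. x \<in> ball a \<delta> \<Longrightarrow> f x \<noteq> 0 \<Longrightarrow> v x \<le> ereal (ln (cmod (f x)) + C)"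
proof -
  obtain e where e: "e > 0" "ball a e \<subseteq> S" using S a openE by blast
  obtain z0 where z0: "z0 \<in> ball a (e / 2)" "f z0 \<noteq> 0" using nontrivial[of "e / 2"] e by auto
  define w0 where "w0 = z0 - a"
  have w0: "norm w0 < e / 2" using z0(1) by (simp add: w0_def dist_norm norm_minus_commute)
  have inS: "a + \<zeta> *s w0 \<in> S" if "cmod \<zeta> < 2" for \<zeta>
  proof -
    have "cmod \<zeta> * norm w0 \<le> 2 * norm w0" using that by (intro mult_right_mono) auto
    also have "\<dots> < e" using w0 by simp
    finally have "a + \<zeta> *s w0 \<in> ball a e" by (simp add: dist_norm norm_vector_scalar_mult)
    then show ?thesis using e by blast
  qed
  define F where "F \<zeta> = f (a + \<zeta> *s w0)" for \<zeta>
  have holF: "F holomorphic_on ball 0 2"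
    unfolding F_def by (rule holomorphic_Cn_on_line[OF f]) (use inS in auto)
  have "a + 1 *s w0 = z0" by (simp add: w0_def)
  then have F1: "F 1 \<noteq> 0" using z0 by (simp add: F_def)
  have "finite {\<zeta> \<in> cball 0 1. F \<zeta> = 0}"
    by (rule finite_zeros_cball[OF holF _ _ F1]) auto
  then have "finite (cmod ` {\<zeta> \<in> cball 0 1. F \<zeta> = 0})" by simp
  moreover have "infinite {0<..<1::real}" by simp
  ultimately have "\<not> {0<..<1} \<subseteq> cmod ` {\<zeta> \<in> cball 0 1. F \<zeta> = 0}"
    using finite_subset by blast
  then obtain r where r: "r \<in> {0<..<1}" "r \<notin> cmod ` {\<zeta> \<in> cball 0 1. F \<zeta> = 0}"
    by blast
  have nz: "F \<zeta> \<noteq> 0" if "\<zeta> \<in> sphere 0 r" for \<zeta>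
    using r that by force
  have "continuous_on (sphere 0 r) F"
    by (intro holomorphic_on_imp_continuous_on holomorphic_on_subset[OF holF]) (use r in auto)
  then obtain k where k: "k > 0" "\<And>\<zeta>. \<zeta> \<in> sphere 0 r \<Longrightarrow> k \<le> cmod (F \<zeta>)"
    by (rule compact_nonzero_lower_bound[OF compact_sphere]) (use nz in auto)
  define K where "K = (\<lambda>\<zeta>. a + \<zeta> *s w0) ` cball 0 r"
  have "compact K" unfolding K_def
    by (intro compact_continuous_image continuous_intros compact_cball)
  moreover have "K \<subseteq> S" unfolding K_def using inS r by auto
  ultimately obtain L \<delta> where L: "L > 0" "\<delta> > 0"
    "\<And>z z'. z \<in> K \<Longrightarrow> dist z z' < \<delta> \<Longrightarrow> z' \<in> S \<and> cmod (f z' - f z) \<le> L * dist z z'"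
    using holomorphic_Cn_lipschitz_near_compact[OF S f] by metis
  define \<eta> where "\<eta> = min (\<delta> / 2) (k / (4 * L))"
  have \<eta>: "\<eta> > 0" "2 * \<eta> \<le> \<delta>" "L * (2 * \<eta>) \<le> k / 2"
  proof -
    have "\<eta> \<le> \<delta> / 2" "\<eta> \<le> k / (4 * L)" by (simp_all add: \<eta>_def)
    then show "2 * \<eta> \<le> \<delta>" "L * (2 * \<eta>) \<le> k / 2" using L(1) by (simp_all add: field_simps)
  qed (use L k in \<open>simp add: \<eta>_def\<close>)
  have near: "x + \<zeta> *s w \<in> S" "\<zeta> \<in> sphere 0 r \<Longrightarrow> k / 2 \<le> cmod (f (x + \<zeta> *s w))"
    if "dist a x < \<eta>" "dist w0 w < \<eta>" "\<zeta> \<in> cball 0 r" for x w \<zeta>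
  proof -
    have "dist (a + \<zeta> *s w0) (x + \<zeta> *s w) \<le> dist (a + \<zeta> *s w0) (x + \<zeta> *s w0) + dist (x + \<zeta> *s w0) (x + \<zeta> *s w)"
      by (rule dist_triangle)
    also have "\<dots> = dist a x + cmod \<zeta> * dist w0 w" unfolding dist_on_lines by simp
    also have "\<dots> \<le> dist a x + 1 * dist w0 w"
      using that(3) r by (intro add_left_mono mult_right_mono) auto
    also have "\<dots> < 2 * \<eta>" using that by simp
    finally have d: "dist (a + \<zeta> *s w0) (x + \<zeta> *s w) < 2 * \<eta>" .
    have inK: "a + \<zeta> *s w0 \<in> K" using that(3) unfolding K_def by blast
    note Lz = L(3)[OF inK, of "x + \<zeta> *s w"]
    show "x + \<zeta> *s w \<in> S" using Lz d \<eta>(2) by simp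
    assume \<zeta>: "\<zeta> \<in> sphere 0 r"
    have "cmod (f (x + \<zeta> *s w) - F \<zeta>) \<le> L * dist (a + \<zeta> *s w0) (x + \<zeta> *s w)"
      unfolding F_def using Lz d \<eta>(2) by simp
    also have "\<dots> \<le> L * (2 * \<eta>)" using d L(1) by (intro mult_left_mono) auto
    finally have "cmod (f (x + \<zeta> *s w) - F \<zeta>) \<le> k / 2" using \<eta>(3) by simp
    moreover have "cmod (F \<zeta>) - cmod (f (x + \<zeta> *s w)) \<le> cmod (f (x + \<zeta> *s w) - F \<zeta>)"
      by (metis norm_minus_commute norm_triangle_ineq2)
    ultimately show "k / 2 \<le> cmod (f (x + \<zeta> *s w))" using k(2)[OF \<zeta>] by simp
  qed
  show ?thesis
  proof (rule that[of \<eta> "- ln (k / 2)"])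
    show "\<eta> > 0" by fact
    fix x assume x: "x \<in> ball a \<eta>" "f x \<noteq> 0"
    have ax: "dist a x < \<eta>" using x by simp
    have r0: "r > 0" using r by simp
    have sub0: "x + \<zeta> *s w0 \<in> S" if "\<zeta> \<in> cball 0 r" for \<zeta>
      using near(1)[OF ax _ that, of w0] \<eta> by simp
    have nz0: "f (x + \<zeta> *s w0) \<noteq> 0" if "\<zeta> \<in> sphere 0 r" for \<zeta>
      using near(2)[OF ax _ _ that, of w0] \<eta> k that by auto
    obtain w where w: "dist w0 w < \<eta>" "\<And>\<zeta>. \<zeta> \<in> cball 0 r \<Longrightarrow> x + \<zeta> *s w \<in> S"
      "\<And>\<zeta>. \<zeta> \<in> sphere 0 r \<Longrightarrow> f (x + \<zeta> *s w) \<noteq> 0"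
      "\<And>\<zeta> m. \<lbrakk>\<zeta> \<in> ball 0 r; f (x + \<zeta> *s w) = 0; zorder (\<lambda>\<zeta>. f (x + \<zeta> *s w)) \<zeta> = int m\<rbrakk> \<Longrightarrow>
       \<exists>C>0. \<exists>\<delta>>0. \<forall>z\<in>ball (x + \<zeta> *s w) \<delta>. cmod (f z) \<le> C * dist z (x + \<zeta> *s w) ^ m"
      using exists_transversal_line[OF S f r0 \<eta>(1) sub0 nz0 x(2)] by blast
    have "v x \<le> ereal (ln (cmod (f x)) - ln (k / 2))"
    proof (rule psh_le_log_on_transversal_line[OF S f v neg r0 w(2)])
      show "k / 2 \<le> cmod (f (x + \<zeta> *s w))" if "\<zeta> \<in> sphere 0 r" for \<zeta>
        using that by (intro near(2)[OF ax w(1)]) auto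
      show "0 < k / 2" "f x \<noteq> 0" using k x by auto
      fix \<zeta> m assume \<zeta>: "\<zeta> \<in> ball 0 r" "f (x + \<zeta> *s w) = 0"
          "zorder (\<lambda>\<zeta>. f (x + \<zeta> *s w)) \<zeta> = int m" "m > 0"
      obtain C \<delta> where C: "C > 0" "\<delta> > 0" "\<forall>z\<in>ball (x + \<zeta> *s w) \<delta>. cmod (f z) \<le> C * dist z (x + \<zeta> *s w) ^ m"
        using w(4)[OF \<zeta>(1-3)] by blast
      show "\<exists>C. \<exists>\<delta>>0. \<forall>z\<in>ball (x + \<zeta> *s w) \<delta> - {x + \<zeta> *s w}.
          v z \<le> ereal (real m * ln (dist z (x + \<zeta> *s w)) + C)"
        by (rule order[OF w(2) \<zeta>(2,4) C(1,2)]) (use \<zeta>(1) C(3) in auto)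
    qed auto
    then show "v x \<le> ereal (ln (cmod (f x)) + - ln (k / 2))" by simp
  qed
qed


section \<open>Lelong numbers in coordinates\<close>

text \<open>
  Hadamard's three circles theorem on each complex line through \<open>p\<close>, with the bound
  \<open>0\<close> on the outer sphere.
\<close>

lemma psh_three_circles:
  fixes v :: "complex ^ 'n \<Rightarrow> ereal"
  assumes v: "psh_Cn S v" and neg: "\<And>z. z \<in> S \<Longrightarrow> v z \<le> 0" and sub: "cball p R \<subseteq> S"
    and r1: "0 < r1" and c: "c \<ge> 0"
    and inner: "\<And>z. z \<in> sphere p r1 \<Longrightarrow> v z \<le> ereal (c * ln (r1 / R))"
    and z: "r1 \<le> dist p z" "dist p z \<le> R"
  shows "v z \<le> ereal (c * ln (dist p z / R))"
proof -
  define d where "d = dist p z"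
  have d: "0 < d" "r1 \<le> d" "d \<le> R" using z r1 by (auto simp: d_def)
  define w where "w = of_real (1 / d) *s (z - p)"
  have w: "norm w = 1"
    using d unfolding w_def norm_vector_scalar_mult by (simp add: d_def dist_norm norm_minus_commute norm_divide)
  have pz: "p + of_real d *s w = z"
    using d by (simp add: w_def vec_eq_iff)
  define S' where "S' = cball 0 R - ball (0::complex) r1"
  define H where "H \<zeta> = - c * (ln (cmod \<zeta>) - ln R)" for \<zeta> :: complex
  define s where "s \<zeta> = v (p + \<zeta> *s w)" for \<zeta>
  have inS: "p + \<zeta> *s w \<in> S" if "\<zeta> \<in> cball 0 R" for \<zeta>
  proof -
    have "dist p (p + \<zeta> *s w) = cmod \<zeta>" using w by (simp add: dist_norm norm_vector_scalar_mult)
    then show ?thesis using sub that by auto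
  qed
  have "s (of_real d) + ereal (H (of_real d)) \<le> 0"
  proof (rule max_principle[where S = S' and B = "sphere 0 R \<union> sphere 0 r1"])
    show "compact S'" unfolding S'_def by (intro compact_diff compact_cball open_ball)
    have "usc_on S v" using v unfolding psh_Cn_def by blast
    then show "usc_on S' s" unfolding s_def
      by (rule usc_on_compose) (use inS in \<open>auto simp: S'_def intro!: continuous_intros\<close>)
    show "continuous_on S' H" unfolding H_def
      by (intro continuous_intros) (use r1 in \<open>auto simp: S'_def\<close>)
    show "s \<zeta> \<le> 0" if "\<zeta> \<in> S'" for \<zeta>
      unfolding s_def by (rule neg[OF inS]) (use that in \<open>auto simp: S'_def\<close>)
    show "of_real d \<in> S'" using d by (simp add: S'_def)
    show "s \<zeta> + ereal (H \<zeta>) \<le> 0" if \<zeta>: "\<zeta> \<in> S' \<inter> (sphere 0 R \<union> sphere 0 r1)" for \<zeta>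
    proof -
      have cm: "cmod \<zeta> = R \<or> cmod \<zeta> = r1" using \<zeta> by auto
      have \<zeta>S: "p + \<zeta> *s w \<in> S" using \<zeta> by (intro inS) (auto simp: S'_def)
      have "s \<zeta> \<le> ereal (- H \<zeta>)"
      proof (cases "cmod \<zeta> = R")
        case True
        then show ?thesis using neg[OF \<zeta>S] by (simp add: s_def H_def zero_ereal_def)
      next
        case False
        then have "cmod \<zeta> = r1" using cm by simp
        then have "p + \<zeta> *s w \<in> sphere p r1" using w by (simp add: dist_norm norm_vector_scalar_mult)
        from inner[OF this] show ?thesis
          using \<open>cmod \<zeta> = r1\<close> r1 d by (simp add: s_def H_def ln_div)
      qed
      then show ?thesis by (cases "s \<zeta>") (auto simp: zero_ereal_def)
    qed
    fix \<zeta> assume \<zeta>: "\<zeta> \<in> S' - (sphere 0 R \<union> sphere 0 r1)"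
    have "open (ball 0 R - cball (0::complex) r1)" by (intro open_Diff) auto
    moreover have "\<zeta> \<in> ball 0 R - cball 0 r1" using \<zeta> by (auto simp: S'_def)
    ultimately obtain e where e: "e > 0" "ball \<zeta> e \<subseteq> ball 0 R - cball 0 r1" using openE by blast
    have sub2: "cball \<zeta> (e / 2) \<subseteq> ball \<zeta> e" using e by auto
    have sub3: "ball 0 R - cball (0::complex) r1 \<subseteq> S'" by (auto simp: S'_def)
    show "\<exists>\<rho>>0. cball \<zeta> \<rho> \<subseteq> S' \<and>
        s \<zeta> \<le> circle_mean (\<lambda>\<xi>. s (\<zeta> + of_real \<rho> * \<xi>)) \<and>
        ((\<lambda>\<theta>. H (\<zeta> + of_real \<rho> * cis \<theta>)) has_integral 2*pi * H \<zeta>) {0..2*pi}"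
    proof (intro exI[of _ "e / 2"] conjI)
      show sub4: "cball \<zeta> (e / 2) \<subseteq> S'" using e sub2 sub3 by blast
      show "s \<zeta> \<le> circle_mean (\<lambda>\<xi>. s (\<zeta> + of_real (e / 2) * \<xi>))"
        unfolding s_def
      proof (rule psh_Cn_mean_on_line[OF v])
        fix \<xi> assume "\<xi> \<in> cball \<zeta> (e / 2)"
        then show "p + \<xi> *s w \<in> S" using sub4 by (intro inS) (auto simp: S'_def)
      qed (use e in auto)
      have "\<xi> \<noteq> 0" if "\<xi> \<in> ball \<zeta> e" for \<xi>
      proof -
        have "\<xi> \<notin> cball 0 r1" using that e(2) by blast
        then show ?thesis using r1 by auto
      qed
      then have "((\<lambda>\<theta>. ln (cmod (\<zeta> + of_real (e / 2) * cis \<theta>))) has_integral 2*pi * ln (cmod \<zeta>)) {0..2*pi}"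
        using e by (intro mean_value_ln_norm[where f = "\<lambda>z. z" and R = e]) (auto intro: holomorphic_intros)
      from has_integral_mult_right[OF has_integral_diff[OF this has_integral_const_real[of "ln R" 0 "2*pi"]], of "- c"]
      show "((\<lambda>\<theta>. H (\<zeta> + of_real (e / 2) * cis \<theta>)) has_integral 2*pi * H \<zeta>) {0..2*pi}"
        unfolding H_def by (simp add: algebra_simps)
    qed (use e in auto)
  qed
  then have "v z + ereal (- (c * ln (d / R))) \<le> 0"
    using d by (simp add: s_def pz H_def ln_div algebra_simps)
  then show ?thesis unfolding d_def by (cases "v z") auto
qed

text \<open>
  By the three circles theorem the quotient \<open>\<Lambda> r\<close> of the supremum over the
  sphere by \<open>ln (r / R)\<close> is increasing in \<open>r\<close>, so its limit at
  \<open>0\<close> is its infimum. This gives the existence of the limit and, since the infimum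
  is a lower bound, the estimate at every radius. The denominators \<open>ln (r / R)\<close> and
  \<open>ln r\<close> are asymptotically equal.
\<close>

lemma lelong_limit:
  fixes v :: "complex ^ 'n \<Rightarrow> ereal"
  assumes v: "psh_Cn S v" and neg: "\<And>z. z \<in> S \<Longrightarrow> v z \<le> 0" and sub: "cball p R \<subseteq> S" and R: "R > 0"
  obtains l where "((\<lambda>r. (SUP z\<in>sphere p r. v z) / ereal (ln r)) \<longlongrightarrow> l) (at_right 0)" "0 \<le> l"
    "\<And>c z. \<lbrakk>0 \<le> c; ereal c \<le> l; 0 < dist p z; dist p z \<le> R\<rbrakk> \<Longrightarrow> v z \<le> ereal (c * ln (dist p z / R))"
proof -
  define M where "M r = (SUP z\<in>sphere p r. v z)" for r
  define \<Lambda> where "\<Lambda> r = M r / ereal (ln (r / R))" for r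
  have M_le: "M r \<le> ereal t \<longleftrightarrow> (\<forall>z\<in>sphere p r. v z \<le> ereal t)" for r t
    by (simp add: M_def SUP_le_iff)
  have M_neg: "M r \<le> 0" if "r \<le> R" for r
    unfolding M_def by (rule SUP_least) (use neg sub that in force)
  have ln_neg: "ln (r / R) < 0" if "0 < r" "r < R" for r using that by simp
  have \<Lambda>_ge: "ereal c \<le> \<Lambda> r \<longleftrightarrow> M r \<le> ereal (c * ln (r / R))" if "0 < r" "r < R" for c r
    unfolding \<Lambda>_def using ln_neg[OF that] by (subst ereal_le_divide_neg) (auto simp: mult.commute)
  have \<Lambda>_nonneg: "0 \<le> \<Lambda> r" if "0 < r" "r < R" for r
    using \<Lambda>_ge[OF that, of 0] M_neg[of r] that by (simp add: zero_ereal_def)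
  have \<Lambda>_step: "ereal c \<le> \<Lambda> r2" if c: "0 \<le> c" "ereal c \<le> \<Lambda> r1" and r: "0 < r1" "r1 \<le> r2" "r2 < R" for c r1 r2
  proof -
    have inner: "v z \<le> ereal (c * ln (r1 / R))" if "z \<in> sphere p r1" for z
      using \<Lambda>_ge[of r1 c] c(2) r M_le that by auto
    have "v z \<le> ereal (c * ln (r2 / R))" if "z \<in> sphere p r2" for z
      using psh_three_circles[OF v neg sub r(1) c(1) inner, of z] that r by auto
    then show ?thesis using \<Lambda>_ge[of r2 c] r M_le by auto
  qed
  have \<Lambda>_mono: "\<Lambda> r1 \<le> \<Lambda> r2" if r: "0 < r1" "r1 \<le> r2" "r2 < R" for r1 r2
  proof (rule ccontr)
    assume "\<not> \<Lambda> r1 \<le> \<Lambda> r2"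
    then obtain c where c: "\<Lambda> r2 < ereal c" "ereal c < \<Lambda> r1" 
      using ereal_dense2[of "\<Lambda> r2" "\<Lambda> r1"] by (auto simp: not_le)
    have "0 < ereal c" by (rule le_less_trans[OF \<Lambda>_nonneg c(1)]) (use r in auto)
    then have "ereal c \<le> \<Lambda> r2" by (intro \<Lambda>_step[OF _ less_imp_le[OF c(2)] r]) simp
    then show False using c(1) by simp
  qed
  define l where "l = (INF r\<in>{0<..<R}. \<Lambda> r)"
  have l_le: "l \<le> \<Lambda> r" if "0 < r" "r < R" for r
    unfolding l_def using that by (intro INF_lower) auto
  have ev: "eventually (\<lambda>r. 0 < r \<and> r < b) (at_right 0)" if "b > 0" for b :: real
    using that by (auto simp: eventually_at_right_less eventually_at_right_field intro!: exI[of _ b])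
  have lim: "(\<Lambda> \<longlongrightarrow> l) (at_right 0)"
  proof (rule order_tendstoI)
    fix a assume a: "a < l"
    show "eventually (\<lambda>r. a < \<Lambda> r) (at_right 0)"
      by (rule eventually_mono[OF ev[OF R]]) (use less_le_trans[OF a l_le] in blast)
  next
    fix a assume "l < a"
    then obtain r0 where r0: "0 < r0" "r0 < R" "\<Lambda> r0 < a" unfolding l_def by (auto simp: INF_less_iff)
    show "eventually (\<lambda>r. \<Lambda> r < a) (at_right 0)"
      by (rule eventually_mono[OF ev[OF r0(1)]])
         (use le_less_trans[OF \<Lambda>_mono r0(3)] r0(2) less_imp_le in blast)
  qed
  have "((\<lambda>r. ln (r / R) / ln r) \<longlongrightarrow> 1) (at_right 0)"
    using R by real_asymp
  then have "((\<lambda>r. ereal (ln (r / R) / ln r)) \<longlongrightarrow> 1) (at_right 0)" by (simp add: one_ereal_def)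
  then have "((\<lambda>r. \<Lambda> r * ereal (ln (r / R) / ln r)) \<longlongrightarrow> l * 1) (at_right 0)"
    by (intro tendsto_mult_ereal lim) auto
  moreover have "eventually (\<lambda>r. \<Lambda> r * ereal (ln (r / R) / ln r) = M r / ereal (ln r)) (at_right 0)"
    using ev[OF R] ev[OF zero_less_one]
  proof eventually_elim
    case (elim r)
    have ln: "ln (r / R) < 0" "ln r < 0" using elim by auto
    then have quot: "ln (r / R) / ln r > 0" by (rule divide_neg_neg)
    show ?case
    proof (cases "M r")
      case (real t)
      then show ?thesis unfolding \<Lambda>_def using ln by simp
    next
      case PInf
      then show ?thesis using M_neg[of r] elim by auto
    next
      case MInf
      then show ?thesis unfolding \<Lambda>_def using ln quot by (simp add: divide_ereal_def)
    qed
  qed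
  ultimately have lim2: "((\<lambda>r. M r / ereal (ln r)) \<longlongrightarrow> l) (at_right 0)"
    by (simp add: filterlim_cong)
  show ?thesis
  proof (rule that[of l])
    show "((\<lambda>r. (SUP z\<in>sphere p r. v z) / ereal (ln r)) \<longlongrightarrow> l) (at_right 0)"
      using lim2 by (simp add: M_def)
    show "0 \<le> l" unfolding l_def by (rule INF_greatest) (simp add: \<Lambda>_nonneg)
    fix c z assume c: "0 \<le> c" "ereal c \<le> l" and z: "0 < dist p z" "dist p z \<le> R"
    show "v z \<le> ereal (c * ln (dist p z / R))"
    proof (cases "dist p z = R")
      case True
      have "v z \<le> 0" using z sub by (intro neg) auto
      then show ?thesis using True R by (simp add: zero_ereal_def)
    next
      case False
      then have d: "0 < dist p z" "dist p z < R" using z by auto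
      have "M (dist p z) \<le> ereal (c * ln (dist p z / R))"
        using \<Lambda>_ge[OF d, of c] c(2) l_le[OF d] by (auto intro: order_trans)
      then show ?thesis using M_le by auto
    qed
  qed
qed

lemma log_ratio_limit_unaffected_by_bounded:
  fixes M N :: "real \<Rightarrow> ereal"
  assumes "((\<lambda>r. N r / ereal (ln r)) \<longlongrightarrow> l) (at_right 0)"
    and "eventually (\<lambda>r. M r \<le> N r + ereal C \<and> N r \<le> M r + ereal C) (at_right 0)"
  shows "((\<lambda>r. M r / ereal (ln r)) \<longlongrightarrow> l) (at_right 0)"
proof (rule tendsto_sandwich)
  have "((\<lambda>r. C / ln r) \<longlongrightarrow> 0) (at_right 0)" by real_asymp
  then have z: "((\<lambda>r. ereal (C / ln r)) \<longlongrightarrow> 0) (at_right 0)"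
    "((\<lambda>r. ereal (- (C / ln r))) \<longlongrightarrow> 0) (at_right 0)"
    using tendsto_minus by (fastforce simp: zero_ereal_def)+
  show "((\<lambda>r. N r / ereal (ln r) + ereal (C / ln r)) \<longlongrightarrow> l) (at_right 0)"
    "((\<lambda>r. N r / ereal (ln r) + ereal (- (C / ln r))) \<longlongrightarrow> l) (at_right 0)"
    using tendsto_add_ereal_general1[OF _ assms(1) z(1)] tendsto_add_ereal_general1[OF _ assms(1) z(2)] by auto
  have ev: "eventually (\<lambda>r::real. 0 < r \<and> r < 1) (at_right 0)"
    by (auto simp: eventually_at_right_field intro!: exI[of _ 1])
  show "eventually (\<lambda>r. N r / ereal (ln r) + ereal (C / ln r) \<le> M r / ereal (ln r)) (at_right 0)"
    using assms(2) ev
  proof eventually_elim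
    case (elim r)
    have neg: "ln r < 0" using elim by simp
    have "b / ln r + C / ln r \<le> a / ln r" if "a \<le> b + C" for a b
      using divide_right_mono_neg[OF that, of "ln r"] neg by (simp add: add_divide_distrib)
    then show ?case using elim(1) neg by (cases "M r"; cases "N r") auto
  qed
  show "eventually (\<lambda>r. M r / ereal (ln r) \<le> N r / ereal (ln r) + ereal (- (C / ln r))) (at_right 0)"
    using assms(2) ev
  proof eventually_elim
    case (elim r)
    have neg: "ln r < 0" using elim by simp
    have "a / ln r \<le> b / ln r - C / ln r" if "b \<le> a + C" for a b
      using divide_right_mono_neg[of "b - C" a "ln r"] that neg by (simp add: diff_divide_distrib)
    then show ?case using elim(1) neg by (cases "M r"; cases "N r") auto
  qed
qed


section \<open>Charts\<close>

lemma manifold_chart: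
  assumes "complex_manifold \<A>" "(U, \<phi>) \<in> \<A>"
  shows "open U" "open (\<phi> ` U)" "homeomorphism U (\<phi> ` U) \<phi> (inv_into U \<phi>)"
proof -
  have "\<forall>(U, \<phi>)\<in>\<A>. open U \<and> open (\<phi> ` U) \<and> homeomorphism U (\<phi> ` U) \<phi> (inv_into U \<phi>)"
    using assms(1) unfolding complex_manifold_def by blast
  then show "open U" "open (\<phi> ` U)" "homeomorphism U (\<phi> ` U) \<phi> (inv_into U \<phi>)"
    using assms(2) by auto
qed

lemma chart_at:
  assumes "complex_manifold \<A>"
  obtains U \<phi> where "(U, \<phi>) \<in> \<A>" "a \<in> U"
proof -
  have "a \<in> (\<Union>(U, \<phi>)\<in>\<A>. U)" using assms unfolding complex_manifold_def by simp
  then show ?thesis using that by auto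
qed

lemma chart_inverse:
  assumes "complex_manifold \<A>" "(U, \<phi>) \<in> \<A>"
  shows "x \<in> U \<Longrightarrow> inv_into U \<phi> (\<phi> x) = x"
    and "z \<in> \<phi> ` U \<Longrightarrow> \<phi> (inv_into U \<phi> z) = z"
    and "z \<in> \<phi> ` U \<Longrightarrow> inv_into U \<phi> z \<in> U"
  using manifold_chart(3)[OF assms] by (auto simp: homeomorphism_apply1 inv_into_into f_inv_into_f)

lemma chart_image_iff:
  assumes "complex_manifold \<A>" "(U, \<phi>) \<in> \<A>"
  shows "z \<in> \<phi> ` (U \<inter> W) \<longleftrightarrow> z \<in> \<phi> ` U \<and> inv_into U \<phi> z \<in> W"
proof
  assume "z \<in> \<phi> ` (U \<inter> W)"
  then show "z \<in> \<phi> ` U \<and> inv_into U \<phi> z \<in> W" using chart_inverse(1)[OF assms] by auto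
next
  assume z: "z \<in> \<phi> ` U \<and> inv_into U \<phi> z \<in> W"
  then have "z = \<phi> (inv_into U \<phi> z)" "inv_into U \<phi> z \<in> U \<inter> W"
    using chart_inverse(2,3)[OF assms, of z] by auto
  then show "z \<in> \<phi> ` (U \<inter> W)" by blast
qed

lemma open_chart_image:
  assumes "complex_manifold \<A>" "(U, \<phi>) \<in> \<A>" "open W"
  shows "open (\<phi> ` (U \<inter> W))"
proof -
  note chart = manifold_chart[OF assms(1,2)]
  have "\<phi> ` (U \<inter> W) = \<phi> ` U \<inter> inv_into U \<phi> -` W"
    using chart_image_iff[OF assms(1,2)] by blast
  then show ?thesis
    using continuous_open_preimage[OF homeomorphism_cont2[OF chart(3)] chart(2) assms(3)] by simp
qed

lemma open_chart_preimage:
  assumes "complex_manifold \<A>" "(U, \<phi>) \<in> \<A>" "open Y"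
  shows "open (U \<inter> \<phi> -` Y)"
  using continuous_open_preimage[OF homeomorphism_cont1[OF manifold_chart(3)[OF assms(1,2)]]
      manifold_chart(1)[OF assms(1,2)] assms(3)] .

text \<open>
  The chart in the definition of the Lelong number is chosen separately at each point. This
  bound carries estimates in terms of the distance to \<open>y\<close> from that chart to a
  fixed one.
\<close>

lemma transition_lipschitz:
  fixes \<A> :: "('a::{t2_space, second_countable_topology}, 'n::finite) chart set"
  assumes man: "complex_manifold \<A>" and U: "(U, \<phi>) \<in> \<A>" and V: "(V, \<psi>) \<in> \<A>" and y: "y \<in> U" "y \<in> V"
  obtains L \<delta> where "L > 0" "\<delta> > 0"
    "\<And>z. dist z (\<phi> y) < \<delta> \<Longrightarrow> z \<in> \<phi> ` (U \<inter> V) \<and>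
      dist (\<psi> (inv_into U \<phi> z)) (\<psi> y) \<le> L * dist z (\<phi> y)"
proof -
  define S where "S = \<phi> ` (U \<inter> V)"
  define T where "T z = \<psi> (inv_into U \<phi> z)" for z
  have S: "open S" unfolding S_def by (rule open_chart_image[OF man U manifold_chart(1)[OF man V]])
  have "\<forall>(U, \<phi>)\<in>\<A>. \<forall>(V, \<psi>)\<in>\<A>. \<forall>i. holomorphic_Cn (\<phi> ` (U \<inter> V)) (\<lambda>z. \<psi> (inv_into U \<phi> z) $ i)"
    using man unfolding complex_manifold_def by blast
  then have hol: "holomorphic_Cn S (\<lambda>z. T z $ i)" for i
    using U V unfolding S_def T_def by fastforce
  have "compact {\<phi> y}" "{\<phi> y} \<subseteq> S" using y by (auto simp: S_def)
  then have "\<exists>L \<delta>. L > 0 \<and> \<delta> > 0 \<and> (\<forall>z. dist (\<phi> y) z < \<delta> \<longrightarrow> z \<in> S \<and>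
      cmod (T z $ i - T (\<phi> y) $ i) \<le> L * dist (\<phi> y) z)" for i
    using holomorphic_Cn_lipschitz_near_compact[OF S hol[of i], of "{\<phi> y}"] by (metis singletonI)
  then obtain L \<delta> where L: "\<And>i. L i > 0" "\<And>i. \<delta> i > 0"
    "\<And>i z. dist (\<phi> y) z < \<delta> i \<Longrightarrow> z \<in> S \<and> cmod (T z $ i - T (\<phi> y) $ i) \<le> L i * dist (\<phi> y) z"
    by metis
  show ?thesis
  proof (rule that[of "\<Sum>i\<in>UNIV. L i" "Min (range \<delta>)"])
    show "(\<Sum>i\<in>UNIV. L i) > 0" by (rule sum_pos) (use L in auto)
    show "Min (range \<delta>) > 0" using L(2) by (subst Min_gr_iff) auto
    fix z assume z: "dist z (\<phi> y) < Min (range \<delta>)"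
    have z': "dist (\<phi> y) z < \<delta> i" for i
    proof -
      have "Min (range \<delta>) \<le> \<delta> i" by (rule Min_le) auto
      then show ?thesis using z by (simp add: dist_commute)
    qed
    have "norm (T z - T (\<phi> y)) \<le> (\<Sum>i\<in>UNIV. cmod ((T z - T (\<phi> y)) $ i))"
      unfolding norm_vec_def by (rule L2_set_le_sum) simp
    also have "\<dots> \<le> (\<Sum>i\<in>UNIV. L i * dist (\<phi> y) z)"
      by (rule sum_mono) (use L(3)[OF z'] in simp)
    also have "\<dots> = (\<Sum>i\<in>UNIV. L i) * dist z (\<phi> y)" by (simp add: sum_distrib_right dist_commute)
    finally have "dist (T z) (T (\<phi> y)) \<le> (\<Sum>i\<in>UNIV. L i) * dist z (\<phi> y)" by (simp add: dist_norm)
    moreover have "T (\<phi> y) = \<psi> y" using chart_inverse(1)[OF man U y(1)] by (simp add: T_def)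
    ultimately show "z \<in> \<phi> ` (U \<inter> V) \<and> dist (\<psi> (inv_into U \<phi> z)) (\<psi> y) \<le> (\<Sum>i\<in>UNIV. L i) * dist z (\<phi> y)"
      using L(3)[OF z'] by (simp add: S_def T_def)
  qed
qed

text \<open>
  The quotient whose limit is the Lelong number, with the chart as a parameter. An estimate of
  the Lelong number through its defining limit requires convergence of this quotient first.
\<close>

definition log_ratio :: "'a set \<times> ('a \<Rightarrow> complex ^ 'n) \<Rightarrow> ('a \<Rightarrow> ereal) \<Rightarrow> 'a \<Rightarrow> real \<Rightarrow> ereal" where
  "log_ratio c u a r = (SUP z\<in>sphere (snd c a) r. u (inv_into (fst c) (snd c) z)) / ereal (ln r)"

lemma lelong_chart:
  assumes "complex_manifold \<A>"
  obtains V \<psi> where "(V, \<psi>) \<in> \<A>" "a \<in> V"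
    "\<And>u l. (log_ratio (V, \<psi>) u a \<longlongrightarrow> l) (at_right 0) \<Longrightarrow> lelong \<A> u a = l"
proof -
  define c where "c = (SOME c. c \<in> \<A> \<and> a \<in> fst c)"
  obtain U \<phi> where "(U, \<phi>) \<in> \<A>" "a \<in> U" using chart_at[OF assms] by blast
  then have "\<exists>c. c \<in> \<A> \<and> a \<in> fst c" by (intro exI[of _ "(U, \<phi>)"]) simp
  then have c: "c \<in> \<A> \<and> a \<in> fst c" unfolding c_def by (rule someI_ex)
  obtain V \<psi> where V: "c = (V, \<psi>)" by (cases c)
  show ?thesis
  proof (rule that[of V \<psi>])
    show "(V, \<psi>) \<in> \<A>" "a \<in> V" using c V by auto
    fix u l assume "(log_ratio (V, \<psi>) u a \<longlongrightarrow> l) (at_right 0)"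
    then have "Lim (at_right 0) (log_ratio (V, \<psi>) u a) = l"
      by (intro tendsto_Lim) auto
    then show "lelong \<A> u a = l"
      unfolding lelong_def c_def[symmetric] V by (simp add: log_ratio_def[abs_def])
  qed
qed

lemma psh_in_chart: "psh \<A> X v \<Longrightarrow> (U, \<phi>) \<in> \<A> \<Longrightarrow> psh_Cn (\<phi> ` (U \<inter> X)) (\<lambda>z. v (inv_into U \<phi> z))"
  unfolding psh_def comp_def by fastforce

lemma nonpos_in_chart:
  assumes "complex_manifold \<A>" "(U, \<phi>) \<in> \<A>" "\<forall>x\<in>X. v x \<le> 0"
  shows "z \<in> \<phi> ` (U \<inter> X) \<Longrightarrow> v (inv_into U \<phi> z) \<le> 0"
  using chart_image_iff[OF assms(1,2)] assms(3) by blast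

lemma log_ratio_limit:
  fixes \<A> :: "('a::{t2_space, second_countable_topology}, 'n::finite) chart set"
  assumes man: "complex_manifold \<A>" and V: "(V, \<psi>) \<in> \<A>" "a \<in> V" and X: "open X" "a \<in> X"
    and v: "psh \<A> X v" "\<forall>x\<in>X. v x \<le> 0"
  obtains l R where "R > 0" "cball (\<psi> a) R \<subseteq> \<psi> ` (V \<inter> X)"
    "(log_ratio (V, \<psi>) v a \<longlongrightarrow> l) (at_right 0)" "0 \<le> l"
    "\<And>c z. \<lbrakk>0 \<le> c; ereal c \<le> l; 0 < dist (\<psi> a) z; dist (\<psi> a) z \<le> R\<rbrakk> \<Longrightarrow>
       v (inv_into V \<psi> z) \<le> ereal (c * ln (dist (\<psi> a) z / R))"
proof -
  have "open (\<psi> ` (V \<inter> X))" "\<psi> a \<in> \<psi> ` (V \<inter> X)"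
    using open_chart_image[OF man V(1) X(1)] V X by auto
  then obtain R where R: "R > 0" "cball (\<psi> a) R \<subseteq> \<psi> ` (V \<inter> X)"
    using open_contains_cball by blast
  have neg: "v (inv_into V \<psi> z) \<le> 0" if "z \<in> \<psi> ` (V \<inter> X)" for z
    using nonpos_in_chart[where v = v and X = X, OF man V(1) v(2) that] .
  show ?thesis
  proof (rule lelong_limit[OF psh_in_chart[OF v(1) V(1)] neg R(2,1)])
    fix l assume "((\<lambda>r. (SUP z\<in>sphere (\<psi> a) r. v (inv_into V \<psi> z)) / ereal (ln r)) \<longlongrightarrow> l) (at_right 0)" "0 \<le> l"
      "\<And>c z. \<lbrakk>0 \<le> c; ereal c \<le> l; 0 < dist (\<psi> a) z; dist (\<psi> a) z \<le> R\<rbrakk> \<Longrightarrow>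
         v (inv_into V \<psi> z) \<le> ereal (c * ln (dist (\<psi> a) z / R))"
    then show thesis using that[of R l] R by (simp add: log_ratio_def[abs_def])
  qed auto
qed

lemma log_ratio_limit_transfer:
  fixes \<A> :: "('a::{t2_space, second_countable_topology}, 'n::finite) chart set"
  assumes man: "complex_manifold \<A>" and V: "(V, \<psi>) \<in> \<A>" "a \<in> V" and N: "open N" "a \<in> N"
    and C: "\<forall>x\<in>N. h x \<le> u x + ereal C \<and> u x \<le> h x + ereal C"
    and lim: "(log_ratio (V, \<psi>) u a \<longlongrightarrow> l) (at_right 0)"
  shows "(log_ratio (V, \<psi>) h a \<longlongrightarrow> l) (at_right 0)"
proof -
  have "open (\<psi> ` (V \<inter> N))" "\<psi> a \<in> \<psi> ` (V \<inter> N)"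
    using open_chart_image[OF man V(1) N(1)] V N by auto
  then obtain R where R: "R > 0" "cball (\<psi> a) R \<subseteq> \<psi> ` (V \<inter> N)"
    using open_contains_cball by blast
  have le: "(SUP z\<in>sphere (\<psi> a) r. h1 (inv_into V \<psi> z)) \<le> (SUP z\<in>sphere (\<psi> a) r. h2 (inv_into V \<psi> z)) + ereal C"
    if "r < R" "\<And>x. x \<in> N \<Longrightarrow> h1 x \<le> h2 x + ereal C" for r h1 h2
  proof (rule SUP_least)
    fix z assume z: "z \<in> sphere (\<psi> a) r"
    then have "z \<in> cball (\<psi> a) R" using that(1) by simp
    then have "inv_into V \<psi> z \<in> N" using R(2) chart_image_iff[OF man V(1)] by blast
    then have "h1 (inv_into V \<psi> z) \<le> h2 (inv_into V \<psi> z) + ereal C" by (rule that(2))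
    also have "\<dots> \<le> (SUP z\<in>sphere (\<psi> a) r. h2 (inv_into V \<psi> z)) + ereal C"
      by (intro add_right_mono SUP_upper z)
    finally show "h1 (inv_into V \<psi> z) \<le> (SUP z\<in>sphere (\<psi> a) r. h2 (inv_into V \<psi> z)) + ereal C" .
  qed
  have "eventually (\<lambda>r. r < R) (at_right 0)"
    using R(1) by (auto simp: eventually_at_right_field intro!: exI[of _ R])
  then have "eventually (\<lambda>r. (SUP z\<in>sphere (\<psi> a) r. h (inv_into V \<psi> z)) \<le> (SUP z\<in>sphere (\<psi> a) r. u (inv_into V \<psi> z)) + ereal C
      \<and> (SUP z\<in>sphere (\<psi> a) r. u (inv_into V \<psi> z)) \<le> (SUP z\<in>sphere (\<psi> a) r. h (inv_into V \<psi> z)) + ereal C) (at_right 0)"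
    by eventually_elim (use le C in auto)
  from log_ratio_limit_unaffected_by_bounded[OF _ this, of l]
  show ?thesis using lim by (simp add: log_ratio_def[abs_def])
qed

text \<open>
  The logarithm of \<open>|f|\<close> is at most \<open>m ln r + O(1)\<close> on spheres in the
  chart \<open>\<phi>\<close>, and the change to the chart \<open>\<psi>\<close> alters only the
  constant. The existence of the limit will come from comparison with a plurisubharmonic
  function.
\<close>

lemma log_ratio_limit_ge_order:
  fixes \<A> :: "('a::{t2_space, second_countable_topology}, 'n::finite) chart set"
  assumes man: "complex_manifold \<A>" and U: "(U, \<phi>) \<in> \<A>" "a \<in> U" and V: "(V, \<psi>) \<in> \<A>" "a \<in> V"
    and C: "C > 0" "\<delta> > 0"
      "\<forall>z\<in>ball (\<phi> a) \<delta>. cmod (f (inv_into U \<phi> z)) \<le> C * dist z (\<phi> a) ^ m"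
    and lim: "(log_ratio (V, \<psi>) (log_abs f) a \<longlongrightarrow> l) (at_right 0)"
  shows "ereal (real m) \<le> l"
proof -
  obtain L \<delta>' where L: "L > 0" "\<delta>' > 0"
    "\<And>z. dist z (\<psi> a) < \<delta>' \<Longrightarrow> z \<in> \<psi> ` (V \<inter> U) \<and>
      dist (\<phi> (inv_into V \<psi> z)) (\<phi> a) \<le> L * dist z (\<psi> a)"
    using transition_lipschitz[OF man V(1) U(1) V(2) U(2)] by blast
  define c where "c = ln (C * L ^ m)"
  define r0 where "r0 = min \<delta>' (min (\<delta> / L) 1)"
  have r0: "r0 > 0" using L C by (simp add: r0_def)
  have le: "log_abs f (inv_into V \<psi> z) \<le> ereal (real m * ln r + c)"
    if r: "0 < r" "r < r0" and z: "z \<in> sphere (\<psi> a) r" for r z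
  proof -
    have d: "dist z (\<psi> a) = r" using z by (simp add: dist_commute)
    then have dz: "dist z (\<psi> a) < \<delta>'" using r by (simp add: r0_def)
    define x where "x = inv_into V \<psi> z"
    have x: "x \<in> U" using L(3)[OF dz] chart_image_iff[OF man V(1)] by (simp add: x_def)
    have dx: "dist (\<phi> x) (\<phi> a) \<le> L * r" using L(3)[OF dz] d by (simp add: x_def)
    also have "L * r < \<delta>" using r L(1) by (simp add: r0_def field_simps)
    finally have "cmod (f (inv_into U \<phi> (\<phi> x))) \<le> C * dist (\<phi> x) (\<phi> a) ^ m"
      by (intro C(3)[rule_format]) (simp add: dist_commute)
    then have "cmod (f x) \<le> C * dist (\<phi> x) (\<phi> a) ^ m" using chart_inverse(1)[OF man U(1) x] by simp
    also have "\<dots> \<le> C * (L * r) ^ m" using dx C(1) by (intro mult_left_mono power_mono) auto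
    finally have fx: "cmod (f x) \<le> C * L ^ m * r ^ m" by (simp add: power_mult_distrib)
    show ?thesis
    proof (cases "f x = 0")
      case False
      then have "ln (cmod (f x)) \<le> ln (C * L ^ m * r ^ m)"
        using fx C(1) L(1) r by (subst ln_le_cancel_iff) auto
      also have "\<dots> = real m * ln r + c"
        using C(1) L(1) r by (simp add: c_def ln_mult ln_realpow)
      finally show ?thesis using False by (simp add: log_abs_def x_def)
    qed (simp add: log_abs_def x_def)
  qed
  have "((\<lambda>r. (real m * ln r + c) / ln r) \<longlongrightarrow> real m) (at_right 0)" by real_asymp
  then have lim_m: "((\<lambda>r. ereal ((real m * ln r + c) / ln r)) \<longlongrightarrow> ereal (real m)) (at_right 0)" by simp
  have ev: "eventually (\<lambda>r. 0 < r \<and> r < r0) (at_right 0)"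
    using r0 by (auto simp: eventually_at_right_field intro!: exI[of _ r0])
  have "eventually (\<lambda>r. ereal ((real m * ln r + c) / ln r) \<le> log_ratio (V, \<psi>) (log_abs f) a r) (at_right 0)"
    using ev
  proof eventually_elim
    case (elim r)
    define M where "M = (SUP z\<in>sphere (\<psi> a) r. log_abs f (inv_into V \<psi> z))"
    have ln: "ln r < 0" using elim by (simp add: r0_def)
    have "M \<le> ereal (real m * ln r + c)"
      unfolding M_def by (rule SUP_least) (use le elim in blast)
    also have "\<dots> = ereal (ln r) * ereal ((real m * ln r + c) / ln r)" using ln by simp
    finally have "ereal ((real m * ln r + c) / ln r) \<le> M / ereal (ln r)"
      using ln by (subst ereal_le_divide_neg) auto
    then show ?case by (simp add: log_ratio_def M_def)
  qed
  from tendsto_le[OF _ lim lim_m this] show ?thesis by simp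
qed

lemma holomorphic_fun_in_chart:
  "holomorphic_fun \<A> X f \<Longrightarrow> (U, \<phi>) \<in> \<A> \<Longrightarrow> holomorphic_Cn (\<phi> ` (U \<inter> X)) (\<lambda>z. f (inv_into U \<phi> z))"
  unfolding holomorphic_fun_def comp_def by fastforce

lemma holomorphic_fun_continuous_on:
  assumes man: "complex_manifold \<A>" and X: "open X" and f: "holomorphic_fun \<A> X f"
  shows "continuous_on X f"
proof (intro continuous_at_imp_continuous_on ballI)
  fix x assume x: "x \<in> X"
  obtain U \<phi> where U: "(U, \<phi>) \<in> \<A>" "x \<in> U" using chart_at[OF man] by blast
  have "continuous_on (\<phi> ` (U \<inter> X)) (\<lambda>z. f (inv_into U \<phi> z))"
    by (rule holomorphic_Cn_imp_continuous_on[OF holomorphic_fun_in_chart[OF f U(1)]])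
  then have "continuous_on (U \<inter> X) (\<lambda>x. f (inv_into U \<phi> (\<phi> x)))"
    by (rule continuous_on_compose2)
       (use continuous_on_subset[OF homeomorphism_cont1[OF manifold_chart(3)[OF man U(1)]]] in auto)
  then have "continuous_on (U \<inter> X) f"
    by (rule continuous_on_eq) (use chart_inverse(1)[OF man U(1)] in auto)
  moreover have "open (U \<inter> X)" "x \<in> U \<inter> X" using manifold_chart(1)[OF man U(1)] X U x by auto
  ultimately show "isCont f x" using continuous_on_eq_continuous_at by blast
qed

text \<open>
  The identity theorem on \<open>X\<close>: the interior \<open>Z\<close> of the zero set is
  open and closed in \<open>X\<close>. If a coordinate ball meets \<open>Z\<close> in
  \<open>q\<close>, then \<open>f\<close> vanishes on every complex line through
  \<open>q\<close> within the ball, hence on the ball.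
\<close>

lemma holomorphic_fun_nonzero_near:
  fixes \<A> :: "('a::{t2_space, second_countable_topology}, 'n::finite) chart set"
  assumes man: "complex_manifold \<A>" and X: "open X" "connected X" and f: "holomorphic_fun \<A> X f"
    and nz: "\<exists>x\<in>X. f x \<noteq> 0" and a: "a \<in> X" and N: "open N" "a \<in> N"
  shows "\<exists>x\<in>N \<inter> X. f x \<noteq> 0"
proof (rule ccontr)
  assume contra: "\<not> ?thesis"
  define Z where "Z = \<Union>{N. open N \<and> N \<subseteq> X \<and> (\<forall>y\<in>N. f y = 0)}"
  define Z' where "Z' = \<Union>{N. open N \<and> N \<subseteq> X \<and> N \<inter> Z = {}}"
  have open_Z: "open Z" "open Z'" unfolding Z_def Z'_def by auto
  have "a \<in> N \<inter> X" "open (N \<inter> X)" using a N X by auto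
  then have aZ: "a \<in> Z" using contra unfolding Z_def by blast
  have Z0: "f y = 0" if "y \<in> Z" for y using that unfolding Z_def by blast
  have cover: "x \<in> Z \<union> Z'" if x: "x \<in> X" for x
  proof (rule ccontr)
    assume "x \<notin> Z \<union> Z'"
    then have xZ: "x \<notin> Z" "x \<notin> Z'" by auto
    obtain U \<phi> where U: "(U, \<phi>) \<in> \<A>" "x \<in> U" using chart_at[OF man] by blast
    define F where "F z = f (inv_into U \<phi> z)" for z
    have F: "holomorphic_Cn (\<phi> ` (U \<inter> X)) F"
      unfolding F_def by (rule holomorphic_fun_in_chart[OF f U(1)])
    have "open (\<phi> ` (U \<inter> X))" "\<phi> x \<in> \<phi> ` (U \<inter> X)"
      using open_chart_image[OF man U(1) X(1)] U x by auto
    then obtain e where e: "e > 0" "ball (\<phi> x) e \<subseteq> \<phi> ` (U \<inter> X)" using openE by blast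
    define B where "B = U \<inter> \<phi> -` ball (\<phi> x) e"
    have B: "open B" "x \<in> B" unfolding B_def using open_chart_preimage[OF man U(1) open_ball] U e by auto
    have BX: "B \<subseteq> X"
    proof
      fix y assume "y \<in> B"
      then have "\<phi> y \<in> \<phi> ` (U \<inter> X)" "y \<in> U" using e by (auto simp: B_def)
      then show "y \<in> X" using chart_image_iff[OF man U(1)] chart_inverse(1)[OF man U(1)] by metis
    qed
    have "B \<inter> Z \<noteq> {}"
    proof
      assume "B \<inter> Z = {}"
      then have "x \<in> Z'" using B BX unfolding Z'_def by blast
      then show False using xZ by simp
    qed
    then obtain q where q: "q \<in> B" "q \<in> Z" by blast
    have qU: "q \<in> U" "\<phi> q \<in> ball (\<phi> x) e" using q by (auto simp: B_def)
    have openq: "open (\<phi> ` (U \<inter> Z))" "\<phi> q \<in> \<phi> ` (U \<inter> Z)"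
      using open_chart_image[OF man U(1) open_Z(1)] qU q by auto
    have FZ: "F z = 0" if "z \<in> \<phi> ` (U \<inter> Z)" for z
      using that Z0 chart_image_iff[OF man U(1)] unfolding F_def by blast
    have Fz: "F z = 0" if z: "z \<in> ball (\<phi> x) e" for z
    proof -
      define w where "w = z - \<phi> q"
      define S where "S = {\<zeta>. \<phi> q + \<zeta> *s w \<in> ball (\<phi> x) e}"
      define S0 where "S0 = S \<inter> {\<zeta>. \<phi> q + \<zeta> *s w \<in> \<phi> ` (U \<inter> Z)}"
      have openS: "open S" "open S0"
        unfolding S0_def S_def by (intro open_Int open_line_preimage open_ball openq)+
      have "S = (\<lambda>\<zeta>. \<zeta> *s w) -` ball (\<phi> x - \<phi> q) e"
        unfolding S_def by (auto simp: dist_norm algebra_simps)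
      moreover have "convex ((\<lambda>\<zeta>. \<zeta> *s w) -` ball (\<phi> x - \<phi> q) e)"
        by (intro convex_linear_vimage bounded_linear.linear[OF bounded_linear_vector_scalar_mult_left] convex_ball)
      ultimately have "connected S" using convex_connected by metis
      have 0: "\<phi> q + 0 *s w = \<phi> q" and 1: "\<phi> q + 1 *s w = z" by (simp_all add: vec_eq_iff w_def)
      have "0 \<in> S0" unfolding S0_def S_def using 0 qU openq by auto
      have "1 \<in> S" unfolding S_def using 1 z by simp
      have "(\<lambda>\<zeta>. F (\<phi> q + \<zeta> *s w)) holomorphic_on S"
        by (rule holomorphic_Cn_on_line[OF F]) (use e in \<open>auto simp: S_def\<close>)
      moreover have "S0 \<noteq> {}" "S0 \<subseteq> S" using \<open>0 \<in> S0\<close> by (auto simp: S0_def)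
      moreover have "F (\<phi> q + \<zeta> *s w) = 0" if "\<zeta> \<in> S0" for \<zeta>
        using that FZ unfolding S0_def by blast
      ultimately have "F (\<phi> q + 1 *s w) = 0"
        by (intro analytic_continuation_open[OF openS(2,1) _ \<open>connected S\<close> _ _
              holomorphic_on_const _ \<open>1 \<in> S\<close>, of "\<lambda>\<zeta>. F (\<phi> q + \<zeta> *s w)" 0])
      then show ?thesis by (simp only: 1)
    qed
    have "f y = 0" if "y \<in> B" for y
      using Fz[of "\<phi> y"] that chart_inverse(1)[OF man U(1)] by (simp add: B_def F_def)
    then have "x \<in> Z" using B BX unfolding Z_def by blast
    then show False using xZ by simp
  qed
  have "Z \<inter> Z' \<inter> X = {}" unfolding Z'_def by blast
  moreover have "Z \<inter> X \<noteq> {}" using aZ a by blast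
  ultimately have "Z' \<inter> X = {}"
    using connectedD[OF X(2) open_Z] cover by blast
  then have "\<forall>x\<in>X. x \<in> Z" using cover by blast
  then show False using nz Z0 by blast
qed

section \<open>Restriction of plurisubharmonic functions and compact neighbourhoods\<close>

lemma psh_restrict_affine:
  assumes man: "complex_manifold \<A>" and v: "psh \<A> X v" and neg: "\<forall>x\<in>X. v x \<le> 0"
    and W: "W \<subseteq> X" and c: "c > 0" "e \<ge> 0"
  shows "psh \<A> W (\<lambda>x. ereal c * v x - ereal e)"
  unfolding psh_def
proof clarify
  fix U \<phi> assume U: "(U, \<phi>) \<in> \<A>"
  have neg': "v (inv_into U \<phi> z) \<le> 0" if "z \<in> \<phi> ` (U \<inter> X)" for z
    using nonpos_in_chart[where v = v and X = X, OF man U neg that] .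
  have "psh_Cn (\<phi> ` (U \<inter> X)) (\<lambda>z. ereal c * v (inv_into U \<phi> z) - ereal e)"
    by (rule psh_Cn_affine[OF psh_in_chart[OF v U] neg' c])
  then show "psh_Cn (\<phi> ` (U \<inter> W)) ((\<lambda>x. ereal c * v x - ereal e) \<circ> inv_into U \<phi>)"
    unfolding comp_def by (rule psh_Cn_subset) (use W in blast)
qed

lemma manifold_relatively_compact_nbhd:
  fixes \<A> :: "('a::{t2_space, second_countable_topology}, 'n::finite) chart set"
    and W :: "'a set"
  assumes man: "complex_manifold \<A>" and W: "open W" "x \<in> W"
  obtains N where "open N" "x \<in> N" "compact (closure N)" "closure N \<subseteq> W"
proof -
  obtain U \<phi> where U: "(U, \<phi>) \<in> \<A>" "x \<in> U" using chart_at[OF man] by blast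
  have "open (\<phi> ` (U \<inter> W))" "\<phi> x \<in> \<phi> ` (U \<inter> W)"
    using open_chart_image[OF man U(1) W(1)] U W by auto
  then obtain e where e: "e > 0" "cball (\<phi> x) e \<subseteq> \<phi> ` (U \<inter> W)" using open_contains_cball by blast
  define N where "N = U \<inter> \<phi> -` ball (\<phi> x) e"
  define C where "C = inv_into U \<phi> ` cball (\<phi> x) e"
  have "continuous_on (cball (\<phi> x) e) (inv_into U \<phi>)"
    by (rule continuous_on_subset[OF homeomorphism_cont2[OF manifold_chart(3)[OF man U(1)]]]) (use e in blast)
  then have C: "compact C" unfolding C_def by (intro compact_continuous_image compact_cball)
  have CW: "C \<subseteq> W" unfolding C_def using e chart_image_iff[OF man U(1)] by blast
  have "N \<subseteq> C"
  proof
    fix y assume "y \<in> N"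
    then have "y = inv_into U \<phi> (\<phi> y)" "\<phi> y \<in> cball (\<phi> x) e"
      using chart_inverse(1)[OF man U(1)] by (auto simp: N_def)
    then show "y \<in> C" unfolding C_def by blast
  qed
  then have NC: "closure N \<subseteq> C" using compact_imp_closed[OF C] by (rule closure_minimal)
  show ?thesis
  proof (rule that[of N])
    show "open N" unfolding N_def by (rule open_chart_preimage[OF man U(1) open_ball])
    show "x \<in> N" using U e by (simp add: N_def)
    show "compact (closure N)" using C NC closed_closure compact_Int_closed[OF C, of "closure N"]
      by (simp add: Int_absorb1)
    show "closure N \<subseteq> W" using NC CW by blast
  qed
qed

lemma manifold_compact_nbhd:
  fixes \<A> :: "('a::{t2_space, second_countable_topology}, 'n::finite) chart set"
    and W :: "'a set"
  assumes man: "complex_manifold \<A>" and W: "open W" and K: "compact K" "K \<subseteq> W"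
  obtains N where "open N" "K \<subseteq> N" "compact (closure N)" "closure N \<subseteq> W"
proof -
  have "\<exists>N. open N \<and> x \<in> N \<and> compact (closure N) \<and> closure N \<subseteq> W" if "x \<in> K" for x
  proof -
    have "x \<in> W" using that K(2) by blast
    from manifold_relatively_compact_nbhd[OF man W this] show ?thesis by metis
  qed
  then have "\<forall>x\<in>K. \<exists>N. open N \<and> x \<in> N \<and> compact (closure N) \<and> closure N \<subseteq> W" by blast
  from bchoice[OF this] obtain N where
    N: "\<forall>x\<in>K. open (N x) \<and> x \<in> N x \<and> compact (closure (N x)) \<and> closure (N x) \<subseteq> W" ..
  then have "\<And>x. x \<in> K \<Longrightarrow> open (N x)" "K \<subseteq> (\<Union>x\<in>K. N x)" by blast+
  then obtain D where D: "D \<subseteq> K" "finite D" "K \<subseteq> (\<Union>x\<in>D. N x)"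
    by (rule compactE_image[OF K(1)])
  have cl: "closure (\<Union>x\<in>D. N x) = (\<Union>x\<in>D. closure (N x))"
    using D(2) by (induction D rule: finite_induct) simp_all
  show ?thesis
  proof (rule that[of "\<Union>x\<in>D. N x"])
    show "open (\<Union>x\<in>D. N x)" using N D by blast
    show "K \<subseteq> (\<Union>x\<in>D. N x)" by (rule D(3))
    show "compact (closure (\<Union>x\<in>D. N x))" unfolding cl using N D by (intro compact_UN) auto
    show "closure (\<Union>x\<in>D. N x) \<subseteq> W" unfolding cl using N D by blast
  qed
qed


section \<open>The class defining the Green function\<close>

lemma log_abs_bounded_near_nonzero:
  assumes X: "open X" "a \<in> X" and f: "continuous_on X f" and fa: "f a \<noteq> 0"
  obtains N C where "open N" "a \<in> N" "\<And>x. x \<in> N \<Longrightarrow> log_abs f x \<le> ereal C \<and> ereal (- C) \<le> log_abs f x"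
proof -
  have "open (X \<inter> f -` (ball (f a) (cmod (f a) / 2)))"
    by (rule continuous_open_preimage[OF f X(1) open_ball])
  moreover have "a \<in> X \<inter> f -` (ball (f a) (cmod (f a) / 2))" using X fa by simp
  moreover define C where "C = max \<bar>ln (cmod (f a) / 2)\<bar> \<bar>ln (2 * cmod (f a))\<bar>"
  have "log_abs f x \<le> ereal C \<and> ereal (- C) \<le> log_abs f x"
    if x: "x \<in> X \<inter> f -` (ball (f a) (cmod (f a) / 2))" for x
  proof -
    have d: "cmod (f a - f x) < cmod (f a) / 2" using x by (simp add: dist_norm)
    then have "cmod (f a) / 2 < cmod (f x)" "cmod (f x) < 2 * cmod (f a)"
      using norm_triangle_ineq2[of "f a" "f x"] norm_triangle_ineq2[of "f x" "f a"]
        norm_ge_zero[of "f a"] by (simp_all add: norm_minus_commute)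
    moreover from this have "f x \<noteq> 0" "0 < cmod (f x)" by auto
    ultimately have "ln (cmod (f a) / 2) \<le> ln (cmod (f x))" "ln (cmod (f x)) \<le> ln (2 * cmod (f a))"
      using fa by (subst ln_le_cancel_iff; simp)+
    then have "ln (cmod (f x)) \<le> C" "- C \<le> ln (cmod (f x))" unfolding C_def by linarith+
    then show ?thesis using \<open>f x \<noteq> 0\<close> by (simp add: log_abs_def)
  qed
  ultimately show ?thesis using that by blast
qed

lemma log_ratio_zero: "(log_ratio (V, \<psi>) (\<lambda>_. 0) a \<longlongrightarrow> 0) (at_right 0)"
proof -
  have "log_ratio (V, \<psi>) (\<lambda>_. 0) a r = 0" if "r > 0" for r
  proof -
    obtain z where "dist (\<psi> a) z = r" using vector_choose_dist[of r "\<psi> a"] \<open>r > 0\<close> by auto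
    then have "sphere (\<psi> a) r \<noteq> {}" by auto
    then show ?thesis by (simp add: log_ratio_def)
  qed
  then have "eventually (\<lambda>r. log_ratio (V, \<psi>) (\<lambda>_. 0) a r = 0) (at_right 0)"
    by (auto simp: eventually_at_right_field intro!: exI[of _ 1])
  then show ?thesis by (simp add: tendsto_eventually)
qed

lemma log_abs_ratio_limit_at_divisor:
  fixes \<A> :: "('a::{t2_space, second_countable_topology}, 'n::finite) chart set"
  assumes man: "complex_manifold \<A>" and V: "(V, \<psi>) \<in> \<A>" "a \<in> V" and X: "open X" "a \<in> X"
    and u: "psh \<A> X u" "\<forall>x\<in>X. u x \<le> 0"
    and near: "open N" "a \<in> N"
      "\<forall>x\<in>N. log_abs f x - ereal C \<le> u x \<and> u x \<le> log_abs f x + ereal C"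
  obtains l where "(log_ratio (V, \<psi>) u a \<longlongrightarrow> l) (at_right 0)"
    "(log_ratio (V, \<psi>) (log_abs f) a \<longlongrightarrow> l) (at_right 0)"
proof -
  obtain l where l: "(log_ratio (V, \<psi>) u a \<longlongrightarrow> l) (at_right 0)"
    by (rule log_ratio_limit[OF man V X u]) (rule that)
  have "log_abs f x \<le> u x + ereal C \<and> u x \<le> log_abs f x + ereal C" if "x \<in> N" for x
    using bspec[OF near(3) that] by (cases "u x"; cases "log_abs f x") auto
  then have "\<forall>x\<in>N. log_abs f x \<le> u x + ereal C \<and> u x \<le> log_abs f x + ereal C" by blast
  from log_ratio_limit_transfer[OF man V near(1,2) this l] l show ?thesis using that by blast
qed

lemma solution_in_green_class:
  fixes \<A> :: "('a::{t2_space, second_countable_topology}, 'n::finite) chart set"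
  assumes man: "complex_manifold \<A>" and X: "open X" and f: "holomorphic_fun \<A> X f"
    and u: "psh \<A> X u" "\<forall>x\<in>X. u x \<le> 0"
    and near: "\<forall>a\<in>divisor_set X f.
           \<exists>U C. open U \<and> a \<in> U \<and> U \<subseteq> X \<and> (C::real) > 0 \<and>
             (\<forall>x\<in>U. log_abs f x - ereal C \<le> u x \<and> u x \<le> log_abs f x + ereal C)"
  shows "u \<in> green_class \<A> X f"
proof -
  have "divisor_lelong \<A> f a \<le> lelong \<A> u a" if a: "a \<in> X" for a
  proof -
    obtain V \<psi> where V: "(V, \<psi>) \<in> \<A>" "a \<in> V"
      and lelong: "\<And>u l. (log_ratio (V, \<psi>) u a \<longlongrightarrow> l) (at_right 0) \<Longrightarrow> lelong \<A> u a = l"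
      using lelong_chart[OF man] by metis
    show ?thesis
    proof (cases "f a = 0")
      case True
      then obtain N C where N: "open N" "a \<in> N"
        "\<forall>x\<in>N. log_abs f x - ereal C \<le> u x \<and> u x \<le> log_abs f x + ereal C"
        using bspec[OF near, of a] a unfolding divisor_set_def by blast
      obtain l where "(log_ratio (V, \<psi>) u a \<longlongrightarrow> l) (at_right 0)"
        "(log_ratio (V, \<psi>) (log_abs f) a \<longlongrightarrow> l) (at_right 0)"
        by (rule log_abs_ratio_limit_at_divisor[OF man V X a u N]) (rule that)
      then show ?thesis unfolding divisor_lelong_def by (simp add: lelong)
    next
      case False
      obtain N C where N: "open N" "a \<in> N"
        "\<And>x. x \<in> N \<Longrightarrow> log_abs f x \<le> ereal C \<and> ereal (- C) \<le> log_abs f x"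
        using log_abs_bounded_near_nonzero[OF X a holomorphic_fun_continuous_on[OF man X f] False] by blast
      have "log_abs f x \<le> 0 + ereal C \<and> 0 \<le> log_abs f x + ereal C" if "x \<in> N" for x
        using N(3)[OF that] by (cases "log_abs f x") (auto simp: zero_ereal_def)
      then have "\<forall>x\<in>N. log_abs f x \<le> 0 + ereal C \<and> 0 \<le> log_abs f x + ereal C" by blast
      from log_ratio_limit_transfer[OF man V N(1,2) this log_ratio_zero]
      have "divisor_lelong \<A> f a = 0" unfolding divisor_lelong_def by (rule lelong)
      moreover obtain l where "(log_ratio (V, \<psi>) u a \<longlongrightarrow> l) (at_right 0)" "0 \<le> l"
        by (rule log_ratio_limit[OF man V X a u]) (rule that)
      ultimately show ?thesis by (simp add: lelong)
    qed
  qed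
  then show ?thesis using u unfolding green_class_def by blast
qed

text \<open>
  Both Lelong numbers are computed in the chart \<open>\<psi>\<close> selected at
  \<open>a\<close>. That of \<open>log |f|\<close> exists as a limit because \<open>u\<close>
  has one, and it is at least \<open>m\<close>. Hence \<open>v\<close> has Lelong number at
  least \<open>m\<close>, which by the three circles theorem is an upper bound for
  \<open>v\<close> in the chart \<open>\<psi>\<close>, and so in \<open>\<phi>\<close>.
\<close>

lemma green_class_le_order:
  fixes \<A> :: "('a::{t2_space, second_countable_topology}, 'n::finite) chart set"
  assumes man: "complex_manifold \<A>" and U: "(U, \<phi>) \<in> \<A>" "a \<in> U" and X: "open X" "a \<in> X"
    and u: "psh \<A> X u" "\<forall>x\<in>X. u x \<le> 0"
    and near: "open N" "a \<in> N"
      "\<forall>x\<in>N. log_abs f x - ereal C \<le> u x \<and> u x \<le> log_abs f x + ereal C"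
    and v: "v \<in> green_class \<A> X f"
    and order: "C' > 0" "\<delta> > 0"
      "\<forall>z\<in>ball (\<phi> a) \<delta>. cmod (f (inv_into U \<phi> z)) \<le> C' * dist z (\<phi> a) ^ m"
  shows "\<exists>C. \<exists>\<delta>>0. \<forall>z\<in>ball (\<phi> a) \<delta> - {\<phi> a}. v (inv_into U \<phi> z) \<le> ereal (real m * ln (dist z (\<phi> a)) + C)"
proof -
  have pv: "psh \<A> X v" "\<forall>x\<in>X. v x \<le> 0" and ge: "divisor_lelong \<A> f a \<le> lelong \<A> v a"
    using v X unfolding green_class_def by auto
  obtain V \<psi> where V: "(V, \<psi>) \<in> \<A>" "a \<in> V"
    and lelong: "\<And>u l. (log_ratio (V, \<psi>) u a \<longlongrightarrow> l) (at_right 0) \<Longrightarrow> lelong \<A> u a = l"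
    using lelong_chart[OF man] by metis
  obtain l where l: "(log_ratio (V, \<psi>) (log_abs f) a \<longlongrightarrow> l) (at_right 0)"
    by (rule log_abs_ratio_limit_at_divisor[OF man V X u near]) (rule that)
  have "ereal (real m) \<le> l" by (rule log_ratio_limit_ge_order[OF man U V order l])
  also have "l = divisor_lelong \<A> f a" unfolding divisor_lelong_def by (rule lelong[OF l, symmetric])
  also note ge
  finally have m_le: "ereal (real m) \<le> lelong \<A> v a" .
  obtain l' R where R: "R > 0" "cball (\<psi> a) R \<subseteq> \<psi> ` (V \<inter> X)"
    and l': "(log_ratio (V, \<psi>) v a \<longlongrightarrow> l') (at_right 0)"
    and bound: "\<And>c z. \<lbrakk>0 \<le> c; ereal c \<le> l'; 0 < dist (\<psi> a) z; dist (\<psi> a) z \<le> R\<rbrakk> \<Longrightarrow>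
       v (inv_into V \<psi> z) \<le> ereal (c * ln (dist (\<psi> a) z / R))"
    by (rule log_ratio_limit[OF man V X pv]) (rule that; (assumption | blast))
  have m_le': "ereal (real m) \<le> l'" using m_le lelong[OF l'] by simp
  obtain L \<delta>' where L: "L > 0" "\<delta>' > 0"
    "\<And>z. dist z (\<phi> a) < \<delta>' \<Longrightarrow> z \<in> \<phi> ` (U \<inter> V) \<and>
      dist (\<psi> (inv_into U \<phi> z)) (\<psi> a) \<le> L * dist z (\<phi> a)"
    by (rule transition_lipschitz[OF man U(1) V(1) U(2) V(2)]) (rule that; (assumption | blast))
  have "v (inv_into U \<phi> z) \<le> ereal (real m * ln (dist z (\<phi> a)) + real m * ln (L / R))"
    if z: "z \<in> ball (\<phi> a) (min \<delta>' (R / L)) - {\<phi> a}" for z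
  proof -
    define x where "x = inv_into U \<phi> z"
    have dz: "dist z (\<phi> a) < \<delta>'" "L * dist z (\<phi> a) < R" "0 < dist z (\<phi> a)"
      using z L(1) by (auto simp: dist_commute field_simps)
    have zUV: "z \<in> \<phi> ` U" "x \<in> V"
      using L(3)[OF dz(1)] chart_image_iff[OF man U(1)] unfolding x_def by blast+
    have d_le: "dist (\<psi> a) (\<psi> x) \<le> L * dist z (\<phi> a)"
      using L(3)[OF dz(1)] by (simp add: x_def dist_commute)
    have "\<psi> x \<noteq> \<psi> a"
    proof
      assume "\<psi> x = \<psi> a"
      then have "x = a" using chart_inverse(1)[OF man V(1)] zUV V by metis
      then have "z = \<phi> a" using chart_inverse(2)[OF man U(1) zUV(1)] by (simp add: x_def)
      then show False using z by simp
    qed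
    then have pos: "0 < dist (\<psi> a) (\<psi> x)" by simp
    have "v (inv_into V \<psi> (\<psi> x)) \<le> ereal (real m * ln (dist (\<psi> a) (\<psi> x) / R))"
      by (rule bound[OF _ m_le' pos]) (use d_le dz in auto)
    then have "v x \<le> ereal (real m * ln (dist (\<psi> a) (\<psi> x) / R))"
      using chart_inverse(1)[OF man V(1) zUV(2)] by simp
    also have "\<dots> \<le> ereal (real m * ln (L * dist z (\<phi> a) / R))"
    proof -
      have "ln (dist (\<psi> a) (\<psi> x) / R) \<le> ln (L * dist z (\<phi> a) / R)"
        using pos R(1) d_le dz(3) L(1) by (subst ln_le_cancel_iff) (auto intro: divide_right_mono)
      then show ?thesis by (simp add: mult_left_mono)
    qed
    also have "real m * ln (L * dist z (\<phi> a) / R) = real m * ln (dist z (\<phi> a)) + real m * ln (L / R)"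
      using dz(3) L(1) R(1) by (simp add: ln_mult ln_div algebra_simps)
    finally show ?thesis by (simp add: x_def)
  qed
  moreover have "min \<delta>' (R / L) > 0" using L R by simp
  ultimately show ?thesis by blast
qed

lemma green_class_le_log_near_divisor:
  fixes \<A> :: "('a::{t2_space, second_countable_topology}, 'n::finite) chart set"
  assumes man: "complex_manifold \<A>" and X: "open X" "connected X" and f: "holomorphic_fun \<A> X f"
    and nz: "\<exists>x\<in>X. f x \<noteq> 0"
    and u: "psh \<A> X u" "\<forall>x\<in>X. u x \<le> 0"
    and near: "\<forall>a\<in>divisor_set X f.
           \<exists>U C. open U \<and> a \<in> U \<and> U \<subseteq> X \<and> (C::real) > 0 \<and>
             (\<forall>x\<in>U. log_abs f x - ereal C \<le> u x \<and> u x \<le> log_abs f x + ereal C)"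
    and v: "v \<in> green_class \<A> X f" and a: "a \<in> X"
  obtains N C where "open N" "a \<in> N" "N \<subseteq> X" "\<And>x. x \<in> N \<Longrightarrow> f x \<noteq> 0 \<Longrightarrow> v x \<le> ereal (ln (cmod (f x)) + C)"
proof -
  have pv: "psh \<A> X v" "\<forall>x\<in>X. v x \<le> 0"
    using v unfolding green_class_def by auto
  obtain U \<phi> where U: "(U, \<phi>) \<in> \<A>" "a \<in> U" using chart_at[OF man] by blast
  define S where "S = \<phi> ` (U \<inter> X)"
  have S: "open S" unfolding S_def by (rule open_chart_image[OF man U(1) X(1)])
  have aS: "\<phi> a \<in> S" using U a by (simp add: S_def)
  have neg: "v (inv_into U \<phi> z) \<le> 0" if "z \<in> S" for z
    using nonpos_in_chart[where v = v and X = X, OF man U(1) pv(2)] that unfolding S_def .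
  have nontrivial: "\<exists>z\<in>ball (\<phi> a) e. f (inv_into U \<phi> z) \<noteq> 0" if "e > 0" for e
  proof -
    have "open (U \<inter> \<phi> -` ball (\<phi> a) e)" "a \<in> U \<inter> \<phi> -` ball (\<phi> a) e"
      using open_chart_preimage[OF man U(1) open_ball] U that by auto
    from holomorphic_fun_nonzero_near[OF man X f nz a this] obtain x
      where "x \<in> U" "\<phi> x \<in> ball (\<phi> a) e" "f x \<noteq> 0" by blast
    then show ?thesis using chart_inverse(1)[OF man U(1)] by metis
  qed
  have order: "\<exists>C. \<exists>\<delta>>0. \<forall>z\<in>ball y \<delta> - {y}. v (inv_into U \<phi> z) \<le> ereal (real m * ln (dist z y) + C)"
    if y: "y \<in> S" "f (inv_into U \<phi> y) = 0" and C: "C > 0" "\<delta> > 0"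
      "\<And>z. z \<in> ball y \<delta> \<Longrightarrow> cmod (f (inv_into U \<phi> z)) \<le> C * dist z y ^ m" for y m C \<delta>
  proof -
    define b where "b = inv_into U \<phi> y"
    have yU: "y \<in> \<phi> ` U" "b \<in> X" using y(1) chart_image_iff[OF man U(1)] unfolding S_def b_def by blast+
    have b: "b \<in> U" "\<phi> b = y" using chart_inverse(2,3)[OF man U(1) yU(1)] by (auto simp: b_def)
    have "b \<in> divisor_set X f" using yU y by (simp add: divisor_set_def b_def)
    from bspec[OF near this] obtain N C' where N: "open N" "b \<in> N"
        "\<forall>x\<in>N. log_abs f x - ereal C' \<le> u x \<and> u x \<le> log_abs f x + ereal C'" by blast
    have ord: "\<forall>z\<in>ball (\<phi> b) \<delta>. cmod (f (inv_into U \<phi> z)) \<le> C * dist z (\<phi> b) ^ m"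
      using C(3) b(2) by simp
    from green_class_le_order[OF man U(1) b(1) X(1) yU(2) u N v C(1,2) ord]
    show ?thesis by (simp add: b(2))
  qed
  obtain C \<delta> where C: "\<delta> > 0"
    "\<And>z. z \<in> ball (\<phi> a) \<delta> \<Longrightarrow> f (inv_into U \<phi> z) \<noteq> 0 \<Longrightarrow>
       v (inv_into U \<phi> z) \<le> ereal (ln (cmod (f (inv_into U \<phi> z))) + C)"
  proof (rule psh_le_log_holomorphic[OF S, of "\<lambda>z. f (inv_into U \<phi> z)" "\<lambda>z. v (inv_into U \<phi> z)" "\<phi> a"])
    show "holomorphic_Cn S (\<lambda>z. f (inv_into U \<phi> z))"
      unfolding S_def by (rule holomorphic_fun_in_chart[OF f U(1)])
    show "psh_Cn S (\<lambda>z. v (inv_into U \<phi> z))"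
      unfolding S_def by (rule psh_in_chart[OF pv(1) U(1)])
  qed (use neg aS nontrivial order in blast)+
  show ?thesis
  proof (rule that[of "U \<inter> \<phi> -` ball (\<phi> a) \<delta> \<inter> X" C])
    show "open (U \<inter> \<phi> -` ball (\<phi> a) \<delta> \<inter> X)"
      by (intro open_Int[OF open_chart_preimage[OF man U(1) open_ball] X(1)])
    show "a \<in> U \<inter> \<phi> -` ball (\<phi> a) \<delta> \<inter> X" using U a C(1) by simp
    fix x assume "x \<in> U \<inter> \<phi> -` ball (\<phi> a) \<delta> \<inter> X" "f x \<noteq> 0"
    then show "v x \<le> ereal (ln (cmod (f x)) + C)"
      using C(2)[of "\<phi> x"] chart_inverse(1)[OF man U(1), of x] by simp
  qed auto
qed

text \<open>
  A holomorphic function is Lipschitz, so it vanishes at a zero to order at least 1. Thus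
  \<open>v \<le> ln \<rho> + C\<close> on circles of radius \<open>\<rho>\<close> around
  \<open>a\<close> in a complex line, and the mean value inequality gives \<open>v a \<le> ln
  \<rho> + C\<close> for all small \<open>\<rho>\<close>.
\<close>

lemma green_class_eq_minus_infinity_on_divisor:
  fixes \<A> :: "('a::{t2_space, second_countable_topology}, 'n::finite) chart set"
  assumes man: "complex_manifold \<A>" and X: "open X" and f: "holomorphic_fun \<A> X f"
    and u: "psh \<A> X u" "\<forall>x\<in>X. u x \<le> 0"
    and near: "\<forall>a\<in>divisor_set X f.
           \<exists>U C. open U \<and> a \<in> U \<and> U \<subseteq> X \<and> (C::real) > 0 \<and>
             (\<forall>x\<in>U. log_abs f x - ereal C \<le> u x \<and> u x \<le> log_abs f x + ereal C)"
    and v: "v \<in> green_class \<A> X f" and a: "a \<in> divisor_set X f"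
  shows "v a = -\<infinity>"
proof -
  have pv: "psh \<A> X v" "\<forall>x\<in>X. v x \<le> 0"
    using v unfolding green_class_def by auto
  have aX: "a \<in> X" "f a = 0" using a by (auto simp: divisor_set_def)
  obtain U \<phi> where U: "(U, \<phi>) \<in> \<A>" "a \<in> U" using chart_at[OF man] by blast
  define S where "S = \<phi> ` (U \<inter> X)"
  define g where "g = inv_into U \<phi>"
  define p where "p = \<phi> a"
  have S: "open S" unfolding S_def by (rule open_chart_image[OF man U(1) X(1)])
  have pS: "p \<in> S" using U aX by (simp add: S_def p_def)
  have gp: "g p = a" using chart_inverse(1)[OF man U] by (simp add: g_def p_def)
  have hol: "holomorphic_Cn S (\<lambda>z. f (g z))"
    unfolding S_def g_def by (rule holomorphic_fun_in_chart[OF f U(1)])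
  have "compact {p}" "{p} \<subseteq> S" using pS by auto
  then obtain L \<delta> where L: "L > 0" "\<delta> > 0" "\<And>z. dist p z < \<delta> \<Longrightarrow> cmod (f (g z) - f (g p)) \<le> L * dist p z"
    using holomorphic_Cn_lipschitz_near_compact[OF S hol] by (metis singletonI)
  have ord: "\<forall>z\<in>ball (\<phi> a) \<delta>. cmod (f (inv_into U \<phi> z)) \<le> L * dist z (\<phi> a) ^ 1"
    using L(3) gp aX by (simp add: g_def p_def dist_commute)
  from bspec[OF near a] obtain N C' where N: "open N" "a \<in> N"
    "\<forall>x\<in>N. log_abs f x - ereal C' \<le> u x \<and> u x \<le> log_abs f x + ereal C'" by blast
  from green_class_le_order[OF man U X aX(1) u N v L(1,2) ord]
  have "\<exists>C. \<exists>\<delta>>0. \<forall>z\<in>ball p \<delta> - {p}. v (g z) \<le> ereal (real 1 * ln (dist z p) + C)"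
    unfolding g_def p_def .
  then obtain C \<delta>' where C: "\<delta>' > 0" "\<And>z. z \<in> ball p \<delta>' - {p} \<Longrightarrow> v (g z) \<le> ereal (ln (dist z p) + C)"
    unfolding of_nat_1 mult_1_left by blast
  obtain e where e: "e > 0" "ball p e \<subseteq> S" using S pS openE by blast
  have psh: "psh_Cn S (\<lambda>z. v (g z))"
    unfolding S_def g_def by (rule psh_in_chart[OF pv(1) U(1)])
  have neg: "v (g z) \<le> 0" if "z \<in> S" for z
    using nonpos_in_chart[where v = v and X = X, OF man U(1) pv(2)] that unfolding S_def g_def .
  obtain w :: "complex ^ 'n" where w: "norm w = 1" using vector_choose_size[of 1] by auto
  have bound: "v a \<le> ereal (ln \<rho> + C)" if \<rho>: "0 < \<rho>" "\<rho> < min e \<delta>'" for \<rho>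
  proof -
    have d: "dist (p + \<xi> *s w) p = cmod \<xi>" for \<xi>
      using w by (simp add: dist_norm norm_vector_scalar_mult)
    have inS: "p + \<xi> *s w \<in> S" if "\<xi> \<in> cball 0 \<rho>" for \<xi>
      using d[of \<xi>] that \<rho> e(2) by (intro subsetD[OF e(2)]) (simp add: dist_commute)
    have "v (g (p + 0 *s w)) \<le> circle_mean (\<lambda>\<xi>. v (g (p + (0 + of_real \<rho> * \<xi>) *s w)))"
      using psh_Cn_mean_on_line[where u = "\<lambda>z. v (g z)" and \<zeta> = 0, OF psh inS] \<rho> by simp
    also have "\<dots> \<le> ereal (2 * pi * (ln \<rho> + C) / (2 * pi))"
    proof (rule circle_mean_le[where k = "\<lambda>_. ln \<rho> + C"])
      fix \<theta>
      have \<theta>: "cmod (0 + of_real \<rho> * cis \<theta>) = \<rho>" using \<rho> by (simp add: norm_mult)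
      show "v (g (p + (0 + of_real \<rho> * cis \<theta>) *s w)) \<le> 0"
        by (intro neg inS) (use \<theta> in simp)
      have "p + (0 + of_real \<rho> * cis \<theta>) *s w \<in> ball p \<delta>' - {p}"
        using d[of "0 + of_real \<rho> * cis \<theta>"] \<theta> \<rho> by (auto simp: dist_commute)
      from C(2)[OF this] show "v (g (p + (0 + of_real \<rho> * cis \<theta>) *s w)) \<le> ereal (ln \<rho> + C)"
        using d[of "0 + of_real \<rho> * cis \<theta>"] \<theta> by simp
    next
      show "((\<lambda>_. ln \<rho> + C) has_integral 2 * pi * (ln \<rho> + C)) {0..2 * pi}"
        using has_integral_const_real[of "ln \<rho> + C" 0 "2 * pi"] by simp
    qed auto
    also have "p + 0 *s w = p" by (simp add: vec_eq_iff)
    finally show ?thesis by (simp add: gp)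
  qed
  show ?thesis
  proof (cases "v a")
    case (real t)
    define \<rho> where "\<rho> = min (min e \<delta>' / 2) (exp (t - C - 1))"
    have "0 < \<rho>" "\<rho> < min e \<delta>'" using e C(1) by (auto simp: \<rho>_def min_def)
    from bound[OF this] have "t \<le> ln \<rho> + C" using real by simp
    moreover have "ln \<rho> \<le> ln (exp (t - C - 1))"
      using \<open>0 < \<rho>\<close> by (subst ln_le_cancel_iff) (auto simp: \<rho>_def)
    ultimately show ?thesis by simp
  qed (use bspec[OF pv(2) aX(1)] in auto)
qed


section \<open>Comparison by maximality\<close>

text \<open>
  From \<open>v \<le> log |f| + C1\<close> and \<open>log |f| - C2 \<le> u\<close>: the
  additional term \<open>t log |f|\<close> outweighs the constants as soon as \<open>|f| <
  d\<close>.
\<close>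

lemma scaled_green_class_le_near_divisor:
  fixes \<A> :: "('a::{t2_space, second_countable_topology}, 'n::finite) chart set"
  assumes man: "complex_manifold \<A>" and X: "open X" "connected X" and f: "holomorphic_fun \<A> X f"
    and nz: "\<exists>x\<in>X. f x \<noteq> 0"
    and u: "psh \<A> X u" "\<forall>x\<in>X. u x \<le> 0"
    and near: "\<forall>a\<in>divisor_set X f.
           \<exists>U C. open U \<and> a \<in> U \<and> U \<subseteq> X \<and> (C::real) > 0 \<and>
             (\<forall>x\<in>U. log_abs f x - ereal C \<le> u x \<and> u x \<le> log_abs f x + ereal C)"
    and v: "v \<in> green_class \<A> X f" and a: "a \<in> divisor_set X f" and t: "t > 0"
  shows "\<exists>N. open N \<and> a \<in> N \<and> (\<forall>x\<in>N - divisor_set X f. ereal (1 + t) * v x \<le> u x)"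
proof -
  have aX: "a \<in> X" "f a = 0" using a by (auto simp: divisor_set_def)
  obtain N1 C1 where N1: "open N1" "a \<in> N1" "N1 \<subseteq> X"
    "\<And>x. x \<in> N1 \<Longrightarrow> f x \<noteq> 0 \<Longrightarrow> v x \<le> ereal (ln (cmod (f x)) + C1)"
    by (rule green_class_le_log_near_divisor[OF man X f nz u near v aX(1)])
       (rule that; (assumption | blast))
  obtain N2 C2 where N2: "open N2" "a \<in> N2" "\<forall>x\<in>N2. log_abs f x - ereal C2 \<le> u x"
    using bspec[OF near a] by blast
  define d where "d = exp ((- C2 - (1 + t) * C1) / t)"
  define N where "N = N1 \<inter> N2 \<inter> (X \<inter> f -` ball 0 d)"
  have "open (X \<inter> f -` ball 0 d)"
    by (rule continuous_open_preimage[OF holomorphic_fun_continuous_on[OF man X(1) f] X(1) open_ball])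
  then have "open N" unfolding N_def using N1 N2 by blast
  moreover have "a \<in> N" unfolding N_def using N1 N2 aX by (simp add: d_def)
  moreover have "ereal (1 + t) * v x \<le> u x" if x: "x \<in> N - divisor_set X f" for x
  proof -
    have fx: "f x \<noteq> 0" "cmod (f x) < d" "x \<in> N1" "x \<in> N2"
      using x by (auto simp: N_def divisor_set_def)
    define s where "s = ln (cmod (f x))"
    have "s \<le> ln d" unfolding s_def using fx by (subst ln_le_cancel_iff) (auto simp: d_def)
    then have "t * s \<le> - C2 - (1 + t) * C1" using t by (simp add: d_def field_simps)
    then have le: "(1 + t) * (s + C1) \<le> s - C2" by (simp add: algebra_simps)
    have "v x \<le> ereal (s + C1)" using N1(4)[OF fx(3,1)] by (simp add: s_def)
    then have "ereal (1 + t) * v x \<le> ereal (1 + t) * ereal (s + C1)"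
      using t by (intro ereal_mult_left_mono) auto
    also have "\<dots> \<le> ereal (s - C2)" using le by simp
    also have "\<dots> = log_abs f x - ereal C2" using fx by (simp add: log_abs_def s_def)
    also have "\<dots> \<le> u x" using N2(3) fx by blast
    finally show ?thesis .
  qed
  ultimately show ?thesis by blast
qed

text \<open>
  Outside the compact subset \<open>K - O'\<close> of \<open>X \<setminus> A\<close> the
  inequality is known. A relatively compact open neighbourhood \<open>U\<close> of this set in
  \<open>X \<setminus> A\<close> has its frontier in the region where it is known, and
  maximality of \<open>u\<close> extends it to \<open>U\<close>.
\<close>

lemma scaled_green_class_le:
  fixes \<A> :: "('a::{t2_space, second_countable_topology}, 'n::finite) chart set"
  assumes man: "complex_manifold \<A>" and X: "open X" and f: "holomorphic_fun \<A> X f"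
    and v: "psh \<A> X v" "\<forall>x\<in>X. v x \<le> 0"
    and max: "maximal_psh \<A> (X - divisor_set X f) u"
    and K: "compact K" "K \<subseteq> X" "\<forall>x\<in>X - K. v x \<le> u x + ereal t"
    and near: "\<forall>a\<in>divisor_set X f.
      \<exists>N. open N \<and> a \<in> N \<and> (\<forall>x\<in>N - divisor_set X f. ereal (1 + t) * v x \<le> u x)"
    and t: "t > 0" and x: "x \<in> X - divisor_set X f"
  shows "ereal (1 + t) * v x - ereal t \<le> u x"
proof -
  define W where "W = X - divisor_set X f"
  define w where "w x = ereal (1 + t) * v x - ereal t" for x
  define O' where "O' = \<Union>{N. open N \<and> (\<forall>x\<in>N - divisor_set X f. ereal (1 + t) * v x \<le> u x)}"
  have O': "open O'" "divisor_set X f \<subseteq> O'" using near unfolding O'_def by fast+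
  have scaled: "ereal (1 + t) * v y \<le> v y" if "y \<in> X" for y
    using bspec[OF v(2) that] t by (cases "v y") (auto simp: zero_ereal_def algebra_simps mult_nonneg_nonpos2)
  have w_le_nearO: "w y \<le> u y" if "y \<in> O' \<inter> W" for y
  proof -
    have "ereal (1 + t) * v y \<le> u y" using that unfolding O'_def W_def by blast
    moreover have "w y \<le> ereal (1 + t) * v y"
      unfolding w_def using t by (cases "ereal (1 + t) * v y") auto
    ultimately show ?thesis by (rule order_trans[rotated])
  qed
  have w_le_offK: "w y \<le> u y" if "y \<in> W - K" for y
  proof -
    have "y \<in> X" using that by (auto simp: W_def)
    have "ereal (1 + t) * v y \<le> u y + ereal t"
    proof (rule order_trans[OF scaled[OF \<open>y \<in> X\<close>]])
      show "v y \<le> u y + ereal t" using K(3) that \<open>y \<in> X\<close> by blast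
    qed
    then show ?thesis unfolding w_def by (cases "ereal (1 + t) * v y"; cases "u y") auto
  qed
  have "W = X \<inter> f -` (- {0})" by (auto simp: W_def divisor_set_def)
  then have W: "open W"
    using continuous_open_preimage[OF holomorphic_fun_continuous_on[OF man X f] X
        open_Compl[OF closed_singleton]] by simp
  have "compact (K - O')" by (rule compact_diff[OF K(1) O'(1)])
  moreover have "K - O' \<subseteq> W" using K(2) O'(2) by (auto simp: W_def)
  ultimately obtain U where U: "open U" "K - O' \<subseteq> U" "compact (closure U)" "closure U \<subseteq> W"
    by (rule manifold_compact_nbhd[OF man W]) (rule that; assumption)
  have "psh \<A> W w" unfolding w_def
    by (rule psh_restrict_affine[OF man v]) (use t in \<open>auto simp: W_def\<close>)
  moreover have "\<forall>y\<in>frontier U. w y \<le> u y"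
  proof
    fix y assume y: "y \<in> frontier U"
    then have "y \<in> W" "y \<notin> U" using U(1,4) by (auto simp: frontier_def interior_open)
    then have "y \<in> O' \<inter> W \<or> y \<in> W - K" using U(2) by blast
    then show "w y \<le> u y" using w_le_nearO w_le_offK by blast
  qed
  ultimately have inU: "\<forall>y\<in>U. w y \<le> u y"
    using max U(1,3,4) unfolding maximal_psh_def W_def[symmetric] by blast
  have "x \<in> U \<or> x \<in> O' \<inter> W \<or> x \<in> W - K" using x U(2) by (auto simp: W_def)
  then show ?thesis using inU w_le_nearO w_le_offK unfolding w_def by blast
qed

theorem mainTheorem4:
  fixes \<A> :: "('a::{t2_space, second_countable_topology}, 'n::finite) chart set"
    and X :: "'a set" and f :: "'a \<Rightarrow> complex" and u :: "'a \<Rightarrow> ereal"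
  assumes "complex_manifold \<A>"
    and "open X" and "connected X" and "X \<noteq> {}" and "compact (closure X)"
    and "holomorphic_fun \<A> X f" and "\<exists>x\<in>X. f x \<noteq> 0"
    and "psh \<A> X u" and "\<And>x. x \<in> X \<Longrightarrow> u x \<le> 0"
    and "locally_bounded_on (X - divisor_set X f) u"
    and "maximal_psh \<A> (X - divisor_set X f) u"
    and "\<And>\<epsilon>::real. \<epsilon> > 0 \<Longrightarrow>
           \<exists>K. compact K \<and> K \<subseteq> X \<and> (\<forall>x\<in>X - K. green \<A> X f x \<le> u x + ereal \<epsilon>)"
    and "\<And>a. a \<in> divisor_set X f \<Longrightarrow>
           \<exists>U C. open U \<and> a \<in> U \<and> U \<subseteq> X \<and> (C::real) > 0 \<and>
             (\<forall>x\<in>U. log_abs f x - ereal C \<le> u x \<and> u x \<le> log_abs f x + ereal C)"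
  shows "\<forall>x\<in>X. u x = green \<A> X f x"
proof -
  note man = assms(1)
  have neg: "\<forall>x\<in>X. u x \<le> 0" using assms(9) by blast
  have near: "\<forall>a\<in>divisor_set X f. \<exists>U C. open U \<and> a \<in> U \<and> U \<subseteq> X \<and> (C::real) > 0 \<and>
      (\<forall>x\<in>U. log_abs f x - ereal C \<le> u x \<and> u x \<le> log_abs f x + ereal C)"
    using assms(13) by blast
  have mem: "u \<in> green_class \<A> X f"
    by (rule solution_in_green_class[OF man assms(2,6,8) neg near])
  have le: "v x \<le> u x" if v: "v \<in> green_class \<A> X f" and x: "x \<in> X" for v x
  proof (cases "x \<in> divisor_set X f")
    case True
    then show ?thesis
      using green_class_eq_minus_infinity_on_divisor[OF man assms(2,6,8) neg near v] by simp
  next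
    case False
    have pv: "psh \<A> X v" "\<forall>x\<in>X. v x \<le> 0" using v unfolding green_class_def by auto
    have approx: "ereal (1 + t) * v x - ereal t \<le> u x" if t: "t > 0" for t
    proof -
      obtain K where K: "compact K" "K \<subseteq> X" "\<forall>x\<in>X - K. green \<A> X f x \<le> u x + ereal t"
        using assms(12)[OF t] by blast
      have off_K: "\<forall>x\<in>X - K. v x \<le> u x + ereal t"
      proof
        fix y assume "y \<in> X - K"
        have "v y \<le> green \<A> X f y" unfolding green_def by (rule SUP_upper[OF v])
        also have "\<dots> \<le> u y + ereal t" using K(3) \<open>y \<in> X - K\<close> by blast
        finally show "v y \<le> u y + ereal t" .
      qed
      have at_divisor: "\<forall>a\<in>divisor_set X f.
          \<exists>N. open N \<and> a \<in> N \<and> (\<forall>x\<in>N - divisor_set X f. ereal (1 + t) * v x \<le> u x)"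
        using scaled_green_class_le_near_divisor[OF man assms(2,3,6,7,8) neg near v _ t] by blast
      show ?thesis
        by (rule scaled_green_class_le[OF man assms(2,6) pv assms(11) K(1,2) off_K at_divisor t])
           (use x False in blast)
    qed
    show ?thesis by (rule ereal_le_from_scaled_le[OF approx bspec[OF pv(2) x]])
  qed
  show ?thesis
  proof
    fix x assume x: "x \<in> X"
    show "u x = green \<A> X f x"
    proof (rule antisym)
      show "u x \<le> green \<A> X f x" unfolding green_def by (rule SUP_upper[OF mem])
      show "green \<A> X f x \<le> u x" unfolding green_def by (rule SUP_least) (rule le[OF _ x])
    qed
  qed
qed


end
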